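(* Let $\mathcal T$ be a compactly generated triangulated category whose subcategory $\mathcal T^c$ of compact objects admits a countable skeleton (i.e. a skeleton with only countably many morphisms). Then every cohomological functor on $\mathcal T^c$ is representable by an object of $\mathcal T$, and every natural transformation between such functors is induced by a map in $\mathcal T$. That is, every natural transformation $H\to H'$ between cohomological functors $H,H'\colon(\mathcal T^c)^{\mathrm{op}}\to\mathrm{Mod}\,\Bbbk$ is isomorphic to one of the form $\mathcal T(-,X)|_{\mathcal T^c}\to\mathcal T(-,X')|_{\mathcal T^c}$ induced by some morphism $f\colon X\to X'$ of $\mathcal T$.
   Context: $\mathcal T$ is linear over a commutative base ring $\Bbbk$ (e.g. $\Bbbk=\mathbb Z$), and functors are $\Bbbk$-linear. A compactly generated triangulated category has arbitrary set-indexed coproducts and a set of compact generators. A cohomological functor on $\mathcal T^c$ is a linear contravariant functor to modules sending distinguished triangles to exact sequences. *)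

theory Defs
  imports "HOL-Algebra.Module" "HOL-Library.Countable_Set"
begin

section \<open>Size conventions\<close>

text \<open>
  The categories in question are large: one with coproducts indexed by all sets in bijection with
  its collection of morphisms is trivial (Freyd).  So sets have to be told from classes.  The
  type \<open>'u\<close> plays the role of the class of all sets, and, as in von Neumann's axiom
  of limitation of size, a collection is a set ("small") iff it has strictly smaller
  cardinality than \<open>'u\<close>.  The cardinality of \<open>'u\<close> is required to be regular
  (replacement) and uncountable (infinity).  Grothendieck universes are the case where
  it is moreover a strong limit; this is not assumed.
\<close>

context includes cardinal_syntax
begin

definition set_universe :: "'u itself \<Rightarrow> bool" where
  "set_universe U \<longleftrightarrow> uncountable (UNIV :: 'u set) \<and> regularCard |UNIV :: 'u set|"

definition small :: "'u itself \<Rightarrow> 'a set \<Rightarrow> bool" where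
  "small U A \<longleftrightarrow> |A| <o |UNIV :: 'u set|"

end


section \<open>Linear categories\<close>

text \<open>
  The ring fields \<open>mult\<close> and \<open>one\<close> of the records \<open>Hom C A B\<close>
  are never used.
\<close>

record ('k, 'o, 'm) lincat =
  Obj :: "'o set"
  Hom :: "'o \<Rightarrow> 'o \<Rightarrow> ('k, 'm) module"
  Ident :: "'o \<Rightarrow> 'm"
  Comp :: "'m \<Rightarrow> 'm \<Rightarrow> 'm"  (infixl \<open>\<cdot>\<index>\<close> 75)

abbreviation arrows :: "('k, 'o, 'm, 'z) lincat_scheme \<Rightarrow> 'o \<Rightarrow> 'o \<Rightarrow> 'm set" where
  "arrows C A B \<equiv> carrier (Hom C A B)"

text \<open>\<open>g \<cdot> f\<close> is "first \<open>f\<close>, then \<open>g\<close>".\<close>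

locale linear_category =
  fixes k :: "('k, 'r) ring_scheme"
    and C :: "('k, 'o, 'm, 'z) lincat_scheme"  (structure)
  assumes base_ring: "cring k"
    and hom_module: "\<lbrakk>A \<in> Obj C; B \<in> Obj C\<rbrakk> \<Longrightarrow> module k (Hom C A B)"
    and hom_disjoint:
      "\<lbrakk>A \<in> Obj C; B \<in> Obj C; A' \<in> Obj C; B' \<in> Obj C; f \<in> arrows C A B; f \<in> arrows C A' B'\<rbrakk>
        \<Longrightarrow> A = A' \<and> B = B'"
    and ident_arrow: "A \<in> Obj C \<Longrightarrow> Ident C A \<in> arrows C A A"
    and comp_arrow:
      "\<lbrakk>A \<in> Obj C; B \<in> Obj C; D \<in> Obj C; f \<in> arrows C A B; g \<in> arrows C B D\<rbrakk>
        \<Longrightarrow> g \<cdot> f \<in> arrows C A D"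
    and comp_ident_right: "\<lbrakk>A \<in> Obj C; B \<in> Obj C; f \<in> arrows C A B\<rbrakk> \<Longrightarrow> f \<cdot> Ident C A = f"
    and comp_ident_left: "\<lbrakk>A \<in> Obj C; B \<in> Obj C; f \<in> arrows C A B\<rbrakk> \<Longrightarrow> Ident C B \<cdot> f = f"
    and comp_assoc:
      "\<lbrakk>A \<in> Obj C; B \<in> Obj C; D \<in> Obj C; E \<in> Obj C;
        f \<in> arrows C A B; g \<in> arrows C B D; h \<in> arrows C D E\<rbrakk>
        \<Longrightarrow> (h \<cdot> g) \<cdot> f = h \<cdot> (g \<cdot> f)"
    and comp_add_right:
      "\<lbrakk>A \<in> Obj C; B \<in> Obj C; D \<in> Obj C;
        f \<in> arrows C A B; f' \<in> arrows C A B; g \<in> arrows C B D\<rbrakk>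
        \<Longrightarrow> g \<cdot> (f \<oplus>\<^bsub>Hom C A B\<^esub> f') = (g \<cdot> f) \<oplus>\<^bsub>Hom C A D\<^esub> (g \<cdot> f')"
    and comp_add_left:
      "\<lbrakk>A \<in> Obj C; B \<in> Obj C; D \<in> Obj C;
        f \<in> arrows C A B; g \<in> arrows C B D; g' \<in> arrows C B D\<rbrakk>
        \<Longrightarrow> (g \<oplus>\<^bsub>Hom C B D\<^esub> g') \<cdot> f = (g \<cdot> f) \<oplus>\<^bsub>Hom C A D\<^esub> (g' \<cdot> f)"
    and comp_smult_right:
      "\<lbrakk>A \<in> Obj C; B \<in> Obj C; D \<in> Obj C; a \<in> carrier k; f \<in> arrows C A B; g \<in> arrows C B D\<rbrakk>
        \<Longrightarrow> g \<cdot> (a \<odot>\<^bsub>Hom C A B\<^esub> f) = a \<odot>\<^bsub>Hom C A D\<^esub> (g \<cdot> f)"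
    and comp_smult_left:
      "\<lbrakk>A \<in> Obj C; B \<in> Obj C; D \<in> Obj C; a \<in> carrier k; f \<in> arrows C A B; g \<in> arrows C B D\<rbrakk>
        \<Longrightarrow> (a \<odot>\<^bsub>Hom C B D\<^esub> g) \<cdot> f = a \<odot>\<^bsub>Hom C A D\<^esub> (g \<cdot> f)"

definition iso_arrow :: "('k, 'o, 'm, 'z) lincat_scheme \<Rightarrow> 'o \<Rightarrow> 'o \<Rightarrow> 'm \<Rightarrow> bool" where
  "iso_arrow C A B f \<longleftrightarrow> f \<in> arrows C A B \<and>
     (\<exists>g \<in> arrows C B A. g \<cdot>\<^bsub>C\<^esub> f = Ident C A \<and> f \<cdot>\<^bsub>C\<^esub> g = Ident C B)"

definition isomorphic_objects :: "('k, 'o, 'm, 'z) lincat_scheme \<Rightarrow> 'o \<Rightarrow> 'o \<Rightarrow> bool" where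
  "isomorphic_objects C A B \<longleftrightarrow> (\<exists>f. iso_arrow C A B f)"

definition zero_object :: "('k, 'o, 'm, 'z) lincat_scheme \<Rightarrow> 'o \<Rightarrow> bool" where
  "zero_object C Z \<longleftrightarrow> Z \<in> Obj C \<and>
     (\<forall>A \<in> Obj C. (\<exists>!f. f \<in> arrows C Z A) \<and> (\<exists>!f. f \<in> arrows C A Z))"

definition is_coproduct ::
  "('k, 'o, 'm, 'z) lincat_scheme \<Rightarrow> 'i set \<Rightarrow> ('i \<Rightarrow> 'o) \<Rightarrow> 'o \<Rightarrow> ('i \<Rightarrow> 'm) \<Rightarrow> bool" where
  "is_coproduct C I X P \<iota> \<longleftrightarrow>
     P \<in> Obj C \<and> (\<forall>i \<in> I. X i \<in> Obj C \<and> \<iota> i \<in> arrows C (X i) P) \<and>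
     (\<forall>Y \<in> Obj C. \<forall>g. (\<forall>i \<in> I. g i \<in> arrows C (X i) Y) \<longrightarrow>
        (\<exists>!u. u \<in> arrows C P Y \<and> (\<forall>i \<in> I. u \<cdot>\<^bsub>C\<^esub> \<iota> i = g i)))"

definition skeleton :: "('k, 'o, 'm, 'z) lincat_scheme \<Rightarrow> 'o set \<Rightarrow> bool" where
  "skeleton C S \<longleftrightarrow> S \<subseteq> Obj C \<and> (\<forall>A \<in> Obj C. \<exists>!B. B \<in> S \<and> isomorphic_objects C A B)"

definition has_countable_skeleton :: "('k, 'o, 'm, 'z) lincat_scheme \<Rightarrow> bool" where
  "has_countable_skeleton C \<longleftrightarrow>
     (\<exists>S. skeleton C S \<and> countable (\<Union>A \<in> S. \<Union>B \<in> S. arrows C A B))"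


section \<open>Linear functors and equivalences\<close>

definition linear_map ::
  "('k, 'r) ring_scheme \<Rightarrow> ('k, 'a) module \<Rightarrow> ('k, 'b) module \<Rightarrow> ('a \<Rightarrow> 'b) \<Rightarrow> bool" where
  "linear_map k M N h \<longleftrightarrow>
     h \<in> carrier M \<rightarrow> carrier N \<and>
     (\<forall>x \<in> carrier M. \<forall>y \<in> carrier M. h (x \<oplus>\<^bsub>M\<^esub> y) = h x \<oplus>\<^bsub>N\<^esub> h y) \<and>
     (\<forall>a \<in> carrier k. \<forall>x \<in> carrier M. h (a \<odot>\<^bsub>M\<^esub> x) = a \<odot>\<^bsub>N\<^esub> h x)"

definition linear_functor ::
  "('k, 'r) ring_scheme \<Rightarrow> ('k, 'o, 'm, 'z) lincat_scheme \<Rightarrow> ('k, 'p, 'n, 'y) lincat_scheme \<Rightarrow>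
   ('o \<Rightarrow> 'p) \<Rightarrow> ('m \<Rightarrow> 'n) \<Rightarrow> bool" where
  "linear_functor k C D Fo Fm \<longleftrightarrow>
     (\<forall>A \<in> Obj C. Fo A \<in> Obj D) \<and>
     (\<forall>A \<in> Obj C. \<forall>B \<in> Obj C. linear_map k (Hom C A B) (Hom D (Fo A) (Fo B)) Fm) \<and>
     (\<forall>A \<in> Obj C. Fm (Ident C A) = Ident D (Fo A)) \<and>
     (\<forall>A \<in> Obj C. \<forall>B \<in> Obj C. \<forall>E \<in> Obj C. \<forall>f \<in> arrows C A B. \<forall>g \<in> arrows C B E.
        Fm (g \<cdot>\<^bsub>C\<^esub> f) = Fm g \<cdot>\<^bsub>D\<^esub> Fm f)"

definition natural_isomorphism ::
  "('k, 'o, 'm, 'z) lincat_scheme \<Rightarrow> ('k, 'p, 'n, 'y) lincat_scheme \<Rightarrow>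
   ('o \<Rightarrow> 'p) \<Rightarrow> ('m \<Rightarrow> 'n) \<Rightarrow> ('o \<Rightarrow> 'p) \<Rightarrow> ('m \<Rightarrow> 'n) \<Rightarrow> ('o \<Rightarrow> 'n) \<Rightarrow> bool" where
  "natural_isomorphism C D Fo Fm Go Gm \<eta> \<longleftrightarrow>
     (\<forall>A \<in> Obj C. iso_arrow D (Fo A) (Go A) (\<eta> A)) \<and>
     (\<forall>A \<in> Obj C. \<forall>B \<in> Obj C. \<forall>f \<in> arrows C A B.
        \<eta> B \<cdot>\<^bsub>D\<^esub> Fm f = Gm f \<cdot>\<^bsub>D\<^esub> \<eta> A)"

definition linear_equivalence ::
  "('k, 'r) ring_scheme \<Rightarrow> ('k, 'o, 'm, 'z) lincat_scheme \<Rightarrow> ('k, 'p, 'n, 'y) lincat_scheme \<Rightarrow>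
   ('o \<Rightarrow> 'p) \<Rightarrow> ('m \<Rightarrow> 'n) \<Rightarrow> bool" where
  "linear_equivalence k C D Fo Fm \<longleftrightarrow> linear_functor k C D Fo Fm \<and>
     (\<exists>Go Gm \<eta> \<epsilon>. linear_functor k D C Go Gm \<and>
        natural_isomorphism C C id id (Go \<circ> Fo) (Gm \<circ> Fm) \<eta> \<and>
        natural_isomorphism D D (Fo \<circ> Go) (Fm \<circ> Gm) id id \<epsilon>)"


section \<open>Triangulated categories\<close>

text \<open>
  \<open>Dist T X Y Z f g h\<close> says that \<open>X \<rightarrow> Y \<rightarrow> Z \<rightarrow> \<Sigma>X\<close>, with maps \<open>f\<close>, \<open>g\<close>, \<open>h\<close>, is a
  distinguished triangle.
\<close>

record ('k, 'o, 'm) tricat = "('k, 'o, 'm) lincat" +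
  ShiftO :: "'o \<Rightarrow> 'o"
  ShiftM :: "'m \<Rightarrow> 'm"
  Dist :: "'o \<Rightarrow> 'o \<Rightarrow> 'o \<Rightarrow> 'm \<Rightarrow> 'm \<Rightarrow> 'm \<Rightarrow> bool"

definition triangle ::
  "('k, 'o, 'm, 'z) tricat_scheme \<Rightarrow> 'o \<Rightarrow> 'o \<Rightarrow> 'o \<Rightarrow> 'm \<Rightarrow> 'm \<Rightarrow> 'm \<Rightarrow> bool" where
  "triangle T X Y Z f g h \<longleftrightarrow>
     X \<in> Obj T \<and> Y \<in> Obj T \<and> Z \<in> Obj T \<and>
     f \<in> arrows T X Y \<and> g \<in> arrows T Y Z \<and> h \<in> arrows T Z (ShiftO T X)"

locale triangulated_category = linear_category k T
  for k :: "('k, 'r) ring_scheme"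
    and T :: "('k, 'o, 'm, 'z) tricat_scheme"  (structure) +
  assumes has_zero_object: "\<exists>Z. zero_object T Z"
    and has_binary_coproducts:
      "\<lbrakk>A \<in> Obj T; B \<in> Obj T\<rbrakk>
        \<Longrightarrow> \<exists>P \<iota>. is_coproduct T (UNIV :: bool set) (\<lambda>b. if b then A else B) P \<iota>"
    and shift_equivalence: "linear_equivalence k T T (ShiftO T) (ShiftM T)"
    and dist_triangle: "Dist T X Y Z f g h \<Longrightarrow> triangle T X Y Z f g h"
    and TR1_iso:
      "\<lbrakk>Dist T X Y Z f g h; triangle T X' Y' Z' f' g' h';
        iso_arrow T X X' a; iso_arrow T Y Y' b; iso_arrow T Z Z' c;
        b \<cdot> f = f' \<cdot> a; c \<cdot> g = g' \<cdot> b; ShiftM T a \<cdot> h = h' \<cdot> c\<rbrakk>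
        \<Longrightarrow> Dist T X' Y' Z' f' g' h'"
    and TR1_ident:
      "\<lbrakk>X \<in> Obj T; zero_object T Z\<rbrakk>
        \<Longrightarrow> Dist T X X Z (Ident T X) \<zero>\<^bsub>Hom T X Z\<^esub> \<zero>\<^bsub>Hom T Z (ShiftO T X)\<^esub>"
    and TR1_cone:
      "\<lbrakk>X \<in> Obj T; Y \<in> Obj T; f \<in> arrows T X Y\<rbrakk> \<Longrightarrow> \<exists>Z g h. Dist T X Y Z f g h"
    and TR2:
      "triangle T X Y Z f g h \<Longrightarrow>
        Dist T X Y Z f g h \<longleftrightarrow>
        Dist T Y Z (ShiftO T X) g h (\<ominus>\<^bsub>Hom T (ShiftO T X) (ShiftO T Y)\<^esub> ShiftM T f)"
    and TR3:
      "\<lbrakk>Dist T X Y Z f g h; Dist T X' Y' Z' f' g' h';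
        a \<in> arrows T X X'; b \<in> arrows T Y Y'; b \<cdot> f = f' \<cdot> a\<rbrakk>
        \<Longrightarrow> \<exists>c \<in> arrows T Z Z'. c \<cdot> g = g' \<cdot> b \<and> ShiftM T a \<cdot> h = h' \<cdot> c"
    and TR4:
      "\<lbrakk>Dist T X Y U f f1 f2; Dist T Y Z W g g1 g2; Dist T X Z V (g \<cdot> f) h1 h2\<rbrakk>
        \<Longrightarrow> \<exists>u v. Dist T U V W u v (ShiftM T f1 \<cdot> g2) \<and>
              u \<cdot> f1 = h1 \<cdot> g \<and> h2 \<cdot> u = f2 \<and> v \<cdot> h1 = g1 \<and> g2 \<cdot> v = ShiftM T f \<cdot> h2"


section \<open>Compact objects and compact generation\<close>

text \<open>
  Index sets of coproducts range over the small subsets of \<open>'u\<close>; every small set is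
  in bijection with one of these.
\<close>

definition has_small_coproducts ::
  "'u itself \<Rightarrow> ('k, 'o, 'm, 'z) lincat_scheme \<Rightarrow> bool" where
  "has_small_coproducts U C \<longleftrightarrow>
     (\<forall>(I :: 'u set) X. small U I \<longrightarrow> (\<forall>i \<in> I. X i \<in> Obj C) \<longrightarrow>
        (\<exists>P \<iota>. is_coproduct C I X P \<iota>))"

definition direct_sum :: "'i set \<Rightarrow> ('i \<Rightarrow> ('k, 'a) module) \<Rightarrow> ('i \<Rightarrow> 'a) set" where
  "direct_sum I M = {x \<in> (\<Pi>\<^sub>E i \<in> I. carrier (M i)). finite {i \<in> I. x i \<noteq> \<zero>\<^bsub>M i\<^esub>}}"

text \<open>
  The canonical map from the direct sum of the \<open>Hom(C, X i)\<close> to \<open>Hom(C, P)\<close> is linear, so it is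
  an isomorphism iff it is bijective.
\<close>

definition compact_object :: "'u itself \<Rightarrow> ('k, 'o, 'm, 'z) lincat_scheme \<Rightarrow> 'o \<Rightarrow> bool" where
  "compact_object U T C \<longleftrightarrow> C \<in> Obj T \<and>
     (\<forall>(I :: 'u set) X P \<iota>. small U I \<longrightarrow> is_coproduct T I X P \<iota> \<longrightarrow>
        bij_betw
          (\<lambda>x. finsum (Hom T C P) (\<lambda>i. \<iota> i \<cdot>\<^bsub>T\<^esub> x i) {i \<in> I. x i \<noteq> \<zero>\<^bsub>Hom T C (X i)\<^esub>})
          (direct_sum I (\<lambda>i. Hom T C (X i)))
          (arrows T C P))"

definition compact_part ::
  "'u itself \<Rightarrow> ('k, 'o, 'm, 'z) tricat_scheme \<Rightarrow> ('k, 'o, 'm, 'z) tricat_scheme" where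
  "compact_part U T = T\<lparr>Obj := {C. compact_object U T C}\<rparr>"

text \<open>
  \<open>G\<close> is not required to be closed under shifts; since shifts and desuspensions of compact
  objects are compact, a set detecting zero objects only together with its shifts can be enlarged
  to one as below.
\<close>

definition compactly_generated ::
  "'u itself \<Rightarrow> ('k, 'r) ring_scheme \<Rightarrow> ('k, 'o, 'm, 'z) tricat_scheme \<Rightarrow> bool" where
  "compactly_generated U k T \<longleftrightarrow>
     triangulated_category k T \<and>
     (\<forall>A \<in> Obj T. \<forall>B \<in> Obj T. small U (arrows T A B)) \<and>
     has_small_coproducts U T \<and>
     (\<exists>G. small U G \<and> (\<forall>C \<in> G. compact_object U T C) \<and>
        (\<forall>X \<in> Obj T. (\<forall>C \<in> G. arrows T C X = {\<zero>\<^bsub>Hom T C X\<^esub>}) \<longrightarrow> zero_object T X))"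


section \<open>Cohomological functors\<close>

text \<open>A contravariant functor to modules; only its values on objects and arrows of the source
  category and on elements of the carriers matter.\<close>

record ('k, 'o, 'm, 'a) modfun =
  FunO :: "'o \<Rightarrow> ('k, 'a) module"
  FunM :: "'m \<Rightarrow> 'a \<Rightarrow> 'a"

definition linear_contravariant_functor ::
  "('k, 'r) ring_scheme \<Rightarrow> ('k, 'o, 'm, 'z) lincat_scheme \<Rightarrow> ('k, 'o, 'm, 'a) modfun \<Rightarrow> bool" where
  "linear_contravariant_functor k C H \<longleftrightarrow>
     (\<forall>A \<in> Obj C. module k (FunO H A)) \<and>
     (\<forall>A \<in> Obj C. \<forall>B \<in> Obj C. \<forall>f \<in> arrows C A B. linear_map k (FunO H B) (FunO H A) (FunM H f)) \<and>
     (\<forall>A \<in> Obj C. \<forall>x \<in> carrier (FunO H A). FunM H (Ident C A) x = x) \<and>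
     (\<forall>A \<in> Obj C. \<forall>B \<in> Obj C. \<forall>D \<in> Obj C. \<forall>f \<in> arrows C A B. \<forall>g \<in> arrows C B D.
        \<forall>x \<in> carrier (FunO H D). FunM H (g \<cdot>\<^bsub>C\<^esub> f) x = FunM H f (FunM H g x)) \<and>
     (\<forall>A \<in> Obj C. \<forall>B \<in> Obj C. \<forall>f \<in> arrows C A B. \<forall>f' \<in> arrows C A B. \<forall>x \<in> carrier (FunO H B).
        FunM H (f \<oplus>\<^bsub>Hom C A B\<^esub> f') x = FunM H f x \<oplus>\<^bsub>FunO H A\<^esub> FunM H f' x) \<and>
     (\<forall>A \<in> Obj C. \<forall>B \<in> Obj C. \<forall>a \<in> carrier k. \<forall>f \<in> arrows C A B. \<forall>x \<in> carrier (FunO H B).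
        FunM H (a \<odot>\<^bsub>Hom C A B\<^esub> f) x = a \<odot>\<^bsub>FunO H A\<^esub> FunM H f x)"

text \<open>
  \<open>Mod k\<close> consists of the small modules; up to isomorphism they are carried by subsets of \<open>'u\<close>.
  Exactness of \<open>H Z \<rightarrow> H Y \<rightarrow> H X\<close> for all triangles gives the long exact sequence by rotation.
\<close>

definition cohomological ::
  "('k, 'r) ring_scheme \<Rightarrow> ('k, 'o, 'm, 'z) tricat_scheme \<Rightarrow> ('k, 'o, 'm, 'u) modfun \<Rightarrow> bool" where
  "cohomological k C H \<longleftrightarrow>
     linear_contravariant_functor k C H \<and>
     (\<forall>A \<in> Obj C. small TYPE('u) (carrier (FunO H A))) \<and>
     (\<forall>X \<in> Obj C. \<forall>Y \<in> Obj C. \<forall>Z \<in> Obj C. \<forall>f g h. Dist C X Y Z f g h \<longrightarrow>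
        FunM H g ` carrier (FunO H Z) =
        {y \<in> carrier (FunO H Y). FunM H f y = \<zero>\<^bsub>FunO H X\<^esub>})"

definition natural_transformation ::
  "('k, 'r) ring_scheme \<Rightarrow> ('k, 'o, 'm, 'z) lincat_scheme \<Rightarrow>
   ('k, 'o, 'm, 'a) modfun \<Rightarrow> ('k, 'o, 'm, 'b) modfun \<Rightarrow> ('o \<Rightarrow> 'a \<Rightarrow> 'b) \<Rightarrow> bool" where
  "natural_transformation k C H H' \<eta> \<longleftrightarrow>
     (\<forall>A \<in> Obj C. linear_map k (FunO H A) (FunO H' A) (\<eta> A)) \<and>
     (\<forall>A \<in> Obj C. \<forall>B \<in> Obj C. \<forall>f \<in> arrows C A B. \<forall>x \<in> carrier (FunO H B).
        \<eta> A (FunM H f x) = FunM H' f (\<eta> B x))"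

definition functor_iso ::
  "('k, 'r) ring_scheme \<Rightarrow> ('k, 'o, 'm, 'z) lincat_scheme \<Rightarrow>
   ('k, 'o, 'm, 'a) modfun \<Rightarrow> ('k, 'o, 'm, 'b) modfun \<Rightarrow> ('o \<Rightarrow> 'a \<Rightarrow> 'b) \<Rightarrow> bool" where
  "functor_iso k C H H' \<phi> \<longleftrightarrow> natural_transformation k C H H' \<phi> \<and>
     (\<forall>A \<in> Obj C. bij_betw (\<phi> A) (carrier (FunO H A)) (carrier (FunO H' A)))"

text \<open>\<open>T(-, X)\<close> and \<open>T(-, f)\<close>; their restrictions to \<open>T\<^sup>c\<close> are obtained by using them over
  \<open>compact_part U T\<close>.\<close>

definition hom_functor :: "('k, 'o, 'm, 'z) lincat_scheme \<Rightarrow> 'o \<Rightarrow> ('k, 'o, 'm, 'm) modfun" where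
  "hom_functor T X = \<lparr>FunO = (\<lambda>A. Hom T A X), FunM = (\<lambda>f g. g \<cdot>\<^bsub>T\<^esub> f)\<rparr>"

definition hom_transformation :: "('k, 'o, 'm, 'z) lincat_scheme \<Rightarrow> 'm \<Rightarrow> 'o \<Rightarrow> 'm \<Rightarrow> 'm" where
  "hom_transformation T f = (\<lambda>A g. f \<cdot>\<^bsub>T\<^esub> g)"

end

theory Submission
  imports Defs
begin

text \<open>
  All functors in this overview are restricted to compact objects.  It suffices to find, for each
  cohomological functor \<open>H\<close>, an exact sequence
  \<open>0 \<rightarrow> T(-, P) \<rightarrow> T(-, P) \<rightarrow> H \<rightarrow> 0\<close>
  in which \<open>P\<close> is a coproduct of compact objects and the first map is induced by an arrow \<open>\<theta>\<close> of \<open>T\<close>.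
  Indeed, let \<open>Q\<close> be the cone of \<open>\<theta>\<close>.  Desuspensions of compact objects are compact and \<open>\<theta>\<close> is injective
  on arrows from compact objects, so \<open>T(-, Q)\<close> is the cokernel of \<open>\<theta>\<close>, that is \<open>H\<close>
  (\<open>realize_functor_iso\<close>).  A transformation \<open>H \<rightarrow> H'\<close> lifts to the resolutions one summand
  of \<open>P\<close> at a time, and the axiom on morphisms of triangles turns the lift into an arrow of cones
  (\<open>realize_natural_transformation\<close>).

  For the resolution, \<open>H\<close> is exhausted by a transfinite chain of subfunctors that are themselves
  cohomological.  Let \<open>G\<close> be one of them and let \<open>x\<close> be an element of \<open>H C\<close>.  There is a tower
  \<open>C = C\<^sub>0 \<rightarrow> C\<^sub>1 \<rightarrow> \<dots>\<close> of compact objects with elements \<open>x\<^sub>n\<close> of \<open>H C\<^sub>n\<close>, starting at \<open>x\<close> and compatible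
  modulo \<open>G\<close>, such that every arrow into \<open>C\<^sub>n\<close> on which \<open>x\<^sub>n\<close> vanishes modulo \<open>G\<close> becomes zero further
  up.  A single arrow is killed by passing to its cone, over which \<open>x\<^sub>n\<close> extends modulo \<open>G\<close> because \<open>H/G\<close> is
  cohomological (\<open>kill_arrow\<close>).  All arrows are killed in countably many steps because the
  skeleton is countable (\<open>block_exists\<close>).  So the tower is a sequence, and the colimit of a sequence has a
  resolution with only two terms.  The subfunctor
  generated by \<open>G\<close> and the \<open>x\<^sub>n\<close> is an extension of the colimit of the \<open>T(-, C\<^sub>n)\<close> by \<open>G\<close>, hence
  cohomological (\<open>exact_block\<close>).  Such steps are repeated along a well-order of the elements of \<open>H\<close>
  (\<open>block_family_exists\<close>).

  Take for \<open>P\<close> the coproduct of all stages of all towers.  For each stage there is one relation: the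
  inclusion of \<open>C\<^sub>n\<close> agrees in \<open>H\<close> with the inclusion of \<open>C\<^sub>n\<^sub>+\<^sub>1\<close> composed with the arrow of the tower, up to a
  correction in earlier towers.  These relations form an arrow \<open>\<theta> : P \<rightarrow> P\<close>.  On the leading tower
  \<open>\<theta>\<close> is the familiar map \<open>1 - shift\<close> of a telescope, which is injective and has the colimit as its
  cokernel; all corrections lie in earlier towers.  An induction on the leading tower, with respect to the well-order,
  yields the same for \<open>\<theta>\<close> itself: it is injective (\<open>\<theta>_mono\<close>) with cokernel \<open>H\<close> (\<open>\<theta>_exact\<close>, \<open>cls_surj\<close>).
\<close>

section \<open>Calculus of arrows in a linear category\<close>

context linear_category
begin

text \<open>
  An arrow determines its source and target, so that source, target, sum and negative can be made
  functions of arrows alone.  Typing side conditions then become equations between sources and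
  targets, which rewriting discharges.
\<close>

definition mor :: "'m \<Rightarrow> 'o \<Rightarrow> 'o \<Rightarrow> bool" where
  "mor f A B \<longleftrightarrow> A \<in> Obj C \<and> B \<in> Obj C \<and> f \<in> arrows C A B"

definition arr :: "'m \<Rightarrow> bool" where
  "arr f \<longleftrightarrow> (\<exists>A B. mor f A B)"

definition dom :: "'m \<Rightarrow> 'o" where
  "dom f = (THE A. \<exists>B. mor f A B)"

definition cod :: "'m \<Rightarrow> 'o" where
  "cod f = (THE B. \<exists>A. mor f A B)"

definition plus_arr :: "'m \<Rightarrow> 'm \<Rightarrow> 'm"  (infixl \<open>\<boxplus>\<close> 65) where
  "f \<boxplus> g = f \<oplus>\<^bsub>Hom C (dom f) (cod f)\<^esub> g"

definition neg :: "'m \<Rightarrow> 'm" where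
  "neg f = \<ominus>\<^bsub>Hom C (dom f) (cod f)\<^esub> f"

abbreviation zer :: "'o \<Rightarrow> 'o \<Rightarrow> 'm" where
  "zer A B \<equiv> \<zero>\<^bsub>Hom C A B\<^esub>"

lemma mor_unique: "mor f A B \<Longrightarrow> mor f A' B' \<Longrightarrow> A = A' \<and> B = B'"
  unfolding mor_def using hom_disjoint by blast

lemma mor_imp: assumes "mor f A B" shows "dom f = A" "cod f = B"
  unfolding dom_def cod_def using assms mor_unique by blast+

lemma mor_iff: "mor f A B \<longleftrightarrow> arr f \<and> dom f = A \<and> cod f = B"
  using mor_imp arr_def by metis

lemma arrow_iff: "A \<in> Obj C \<Longrightarrow> B \<in> Obj C \<Longrightarrow> f \<in> arrows C A B \<longleftrightarrow> arr f \<and> dom f = A \<and> cod f = B"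
  using mor_iff mor_def by metis

lemma arr_obj [simp]: "arr f \<Longrightarrow> dom f \<in> Obj C" "arr f \<Longrightarrow> cod f \<in> Obj C"
  using mor_iff mor_def by metis+

lemma arr_in: "arr f \<Longrightarrow> f \<in> arrows C (dom f) (cod f)"
  using arrow_iff by auto

lemma mor_obj: "mor f A B \<Longrightarrow> A \<in> Obj C" "mor f A B \<Longrightarrow> B \<in> Obj C"
  using mor_def by auto

lemma arr_comp [simp]:
  assumes "arr f" "arr g" "cod f = dom g"
  shows "arr (g \<cdot> f)" "dom (g \<cdot> f) = dom f" "cod (g \<cdot> f) = cod g"
  using comp_arrow[of "dom f" "cod f" "cod g" f g] assms arr_in[OF assms(1)] arr_in[OF assms(2)]
  by (auto simp: arrow_iff)

lemma arr_ident [simp]: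
  assumes "A \<in> Obj C"
  shows "arr (Ident C A)" "dom (Ident C A) = A" "cod (Ident C A) = A"
  using ident_arrow[OF assms] assms by (auto simp: arrow_iff)

lemma comp_ident [simp]:
  "arr f \<Longrightarrow> dom f = A \<Longrightarrow> f \<cdot> Ident C A = f" "arr f \<Longrightarrow> cod f = A \<Longrightarrow> Ident C A \<cdot> f = f"
  using comp_ident_right comp_ident_left arr_in arr_obj by blast+

lemma assoc:
  "arr f \<Longrightarrow> arr g \<Longrightarrow> arr h \<Longrightarrow> cod f = dom g \<Longrightarrow> cod g = dom h \<Longrightarrow> (h \<cdot> g) \<cdot> f = h \<cdot> (g \<cdot> f)"
  using comp_assoc[of "dom f" "cod f" "cod g" "cod h" f g h] arr_in[of f] arr_in[of g] arr_in[of h] by simp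

lemma hom_group: "A \<in> Obj C \<Longrightarrow> B \<in> Obj C \<Longrightarrow> abelian_group (Hom C A B)"
  using hom_module module.axioms by blast

lemma arr_zero [simp]:
  assumes "A \<in> Obj C" "B \<in> Obj C"
  shows "arr (zer A B)" "dom (zer A B) = A" "cod (zer A B) = B"
  using abelian_group.axioms(1)[OF hom_group[OF assms]] assms
  by (auto simp: arrow_iff dest: abelian_monoid.zero_closed)

lemma arr_plus [simp]:
  assumes "arr f" "arr g" "dom f = dom g" "cod f = cod g"
  shows "arr (f \<boxplus> g)" "dom (f \<boxplus> g) = dom g" "cod (f \<boxplus> g) = cod g"
proof -
  interpret abelian_group "Hom C (dom g) (cod g)" using assms hom_group by simp
  have "f \<boxplus> g \<in> arrows C (dom g) (cod g)"
    unfolding plus_arr_def using arr_in[OF assms(1)] arr_in[OF assms(2)] assms by simp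
  then show "arr (f \<boxplus> g)" "dom (f \<boxplus> g) = dom g" "cod (f \<boxplus> g) = cod g"
    using assms by (auto simp: arrow_iff)
qed

lemma arr_neg [simp]:
  assumes "arr f"
  shows "arr (neg f)" "dom (neg f) = dom f" "cod (neg f) = cod f"
proof -
  interpret abelian_group "Hom C (dom f) (cod f)" using assms hom_group by simp
  have "neg f \<in> arrows C (dom f) (cod f)" unfolding neg_def using arr_in[OF assms] by simp
  then show "arr (neg f)" "dom (neg f) = dom f" "cod (neg f) = cod f"
    using assms by (auto simp: arrow_iff)
qed

lemma plus_assoc:
  assumes "arr f" "arr g" "arr h" "dom f = dom g" "cod f = cod g" "dom h = dom g" "cod h = cod g"
  shows "(f \<boxplus> g) \<boxplus> h = f \<boxplus> (g \<boxplus> h)"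
proof -
  interpret abelian_group "Hom C (dom g) (cod g)" using assms hom_group by simp
  have "f \<in> arrows C (dom g) (cod g)" "g \<in> arrows C (dom g) (cod g)" "h \<in> arrows C (dom g) (cod g)"
    using assms arr_in[of f] arr_in[of g] arr_in[of h] by simp_all
  from a_assoc[OF this] show ?thesis using assms arr_plus[of f g] unfolding plus_arr_def by simp
qed

lemma plus_commute:
  assumes "arr f" "arr g" "dom f = dom g" "cod f = cod g"
  shows "f \<boxplus> g = g \<boxplus> f"
proof -
  interpret abelian_group "Hom C (dom g) (cod g)" using assms hom_group by simp
  show ?thesis using assms a_comm arr_in[of f] arr_in[of g]
    by (simp add: plus_arr_def)
qed

lemma plus_left_commute:
  assumes "arr f" "arr g" "arr h" "dom f = dom g" "cod f = cod g" "dom h = dom g" "cod h = cod g"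
  shows "f \<boxplus> (g \<boxplus> h) = g \<boxplus> (f \<boxplus> h)"
  using assms plus_assoc plus_commute by metis

lemmas plus_ac = plus_assoc plus_commute plus_left_commute

lemma plus_zero [simp]:
  assumes "arr f" "dom f = A" "cod f = B"
  shows "f \<boxplus> zer A B = f" "zer A B \<boxplus> f = f"
proof -
  have AB: "A \<in> Obj C" "B \<in> Obj C" using assms by auto
  interpret abelian_group "Hom C A B" using AB hom_group by simp
  show "f \<boxplus> zer A B = f" "zer A B \<boxplus> f = f"
    using assms AB arr_in[of f] by (simp_all add: plus_arr_def)
qed

lemma plus_neg [simp]:
  assumes "arr f"
  shows "f \<boxplus> neg f = zer (dom f) (cod f)" "neg f \<boxplus> f = zer (dom f) (cod f)"
proof -
  interpret abelian_group "Hom C (dom f) (cod f)" using assms hom_group by simp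
  show "f \<boxplus> neg f = zer (dom f) (cod f)" "neg f \<boxplus> f = zer (dom f) (cod f)"
    using r_neg[OF arr_in[OF assms]] l_neg[OF arr_in[OF assms]] arr_neg[OF assms]
    unfolding plus_arr_def neg_def by simp_all
qed

lemma plus_neg_cancel [simp]:
  assumes "arr f" "arr g" "dom f = dom g" "cod f = cod g"
  shows "f \<boxplus> (neg f \<boxplus> g) = g" "neg f \<boxplus> (f \<boxplus> g) = g"
  using assms by (simp_all flip: plus_assoc)

lemma neg_unique:
  assumes "arr f" "arr g" "dom f = dom g" "cod f = cod g" "f \<boxplus> g = zer (dom g) (cod g)"
  shows "g = neg f"
proof -
  have "neg f \<boxplus> (f \<boxplus> g) = neg f" using assms by simp
  then show ?thesis using assms(1-4) by simp
qed

lemma neg_neg [simp]: "arr f \<Longrightarrow> neg (neg f) = f"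
  using neg_unique[of "neg f" f] by simp

lemma neg_zero [simp]: "A \<in> Obj C \<Longrightarrow> B \<in> Obj C \<Longrightarrow> neg (zer A B) = zer A B"
  using neg_unique[of "zer A B" "zer A B"] by simp

lemma minus_eq_zero:
  assumes "arr f" "arr g" "dom f = dom g" "cod f = cod g" "f \<boxplus> neg g = zer (dom g) (cod g)"
  shows "f = g"
  using neg_unique[of f "neg g"] assms by (metis arr_neg neg_neg)

lemma comp_plus:
  "arr f \<Longrightarrow> arr f' \<Longrightarrow> arr g \<Longrightarrow> dom f = dom f' \<Longrightarrow> cod f = cod f' \<Longrightarrow> cod f' = dom g \<Longrightarrow>
     g \<cdot> (f \<boxplus> f') = g \<cdot> f \<boxplus> g \<cdot> f'"
  "arr f \<Longrightarrow> arr g \<Longrightarrow> arr g' \<Longrightarrow> dom g = dom g' \<Longrightarrow> cod g = cod g' \<Longrightarrow> cod f = dom g' \<Longrightarrow>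
     (g \<boxplus> g') \<cdot> f = g \<cdot> f \<boxplus> g' \<cdot> f"
  using comp_add_right[of "dom f" "cod f" "cod g" f f' g] comp_add_left[of "dom f" "cod f" "cod g" f g g']
    arr_in[of f] arr_in[of g] arr_in[of f'] arr_in[of g']
  by (simp_all add: plus_arr_def)

lemma idem_zero:
  assumes "arr f" "f \<boxplus> f = f" shows "f = zer (dom f) (cod f)"
proof -
  have "neg f \<boxplus> (f \<boxplus> f) = neg f \<boxplus> f" using assms by simp
  then show ?thesis using assms(1) plus_neg_cancel(2)[of f f] by simp
qed

lemma comp_zero [simp]:
  assumes "arr g" "A \<in> Obj C"
  shows "dom g = B \<Longrightarrow> g \<cdot> zer A B = zer A (cod g)" "cod g = B \<Longrightarrow> zer B A \<cdot> g = zer (dom g) A"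
proof -
  show "g \<cdot> zer A B = zer A (cod g)" if "dom g = B"
    using idem_zero[of "g \<cdot> zer A B"] comp_plus(1)[of "zer A B" "zer A B" g] assms that by fastforce
  show "zer B A \<cdot> g = zer (dom g) A" if "cod g = B"
    using idem_zero[of "zer B A \<cdot> g"] comp_plus(2)[of g "zer B A" "zer B A"] assms that by fastforce
qed

lemma comp_neg:
  assumes "arr f" "arr g" "cod f = dom g"
  shows "g \<cdot> neg f = neg (g \<cdot> f)" "neg g \<cdot> f = neg (g \<cdot> f)"
proof -
  have "g \<cdot> f \<boxplus> g \<cdot> neg f = zer (dom f) (cod g)" "g \<cdot> f \<boxplus> neg g \<cdot> f = zer (dom f) (cod g)"
    using assms by (simp_all flip: comp_plus)
  then show "g \<cdot> neg f = neg (g \<cdot> f)" "neg g \<cdot> f = neg (g \<cdot> f)"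
    using assms neg_unique[of "g \<cdot> f" "g \<cdot> neg f"] neg_unique[of "g \<cdot> f" "neg g \<cdot> f"]
    by simp_all
qed

lemma neg_plus:
  assumes "arr f" "arr g" "dom f = dom g" "cod f = cod g"
  shows "neg (f \<boxplus> g) = neg f \<boxplus> neg g"
proof -
  have "(f \<boxplus> g) \<boxplus> (neg f \<boxplus> neg g) = (f \<boxplus> neg f) \<boxplus> (g \<boxplus> neg g)"
    using assms by (simp only: plus_ac arr_plus arr_neg)
  then show ?thesis using assms neg_unique[of "f \<boxplus> g" "neg f \<boxplus> neg g"] by simp
qed

lemma iso_arrowE:
  assumes "iso_arrow C A B f" "A \<in> Obj C" "B \<in> Obj C"
  obtains g where "mor f A B" "mor g B A" "g \<cdot> f = Ident C A" "f \<cdot> g = Ident C B"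
  using assms unfolding iso_arrow_def mor_def by blast

lemma iso_arrowI:
  assumes "mor f A B" "mor g B A" "g \<cdot> f = Ident C A" "f \<cdot> g = Ident C B"
  shows "iso_arrow C A B f"
  using assms unfolding iso_arrow_def mor_def by blast

lemma zero_object_arrows:
  assumes "zero_object C Z" "A \<in> Obj C"
  shows "mor f Z A \<Longrightarrow> f = zer Z A" "mor f A Z \<Longrightarrow> f = zer A Z"
  using assms arr_zero unfolding zero_object_def mor_def by (metis arrow_iff)+

lemma zero_objectI:
  assumes "Z \<in> Obj C" "Ident C Z = zer Z Z"
  shows "zero_object C Z"
proof -
  have "f = zer Z A" if "A \<in> Obj C" "f \<in> arrows C Z A" for f A
    using comp_zero(1)[of f Z Z] comp_ident(1)[of f Z] assms that by (auto simp: arrow_iff)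
  moreover have "f = zer A Z" if "A \<in> Obj C" "f \<in> arrows C A Z" for f A
    using comp_zero(2)[of f Z Z] comp_ident(2)[of f Z] assms that by (auto simp: arrow_iff)
  ultimately show ?thesis unfolding zero_object_def using assms
    by (metis abelian_group.axioms(1) abelian_monoid.zero_closed hom_group)
qed

end

section \<open>Coproducts and finite sums of arrows\<close>

context linear_category
begin

text \<open>
  The arrows \<open>A \<rightarrow> P\<close> that are finite sums of arrows through summands of a coproduct \<open>P\<close>.  The
  inductive form lets statements about arrows out of a compact object be proved one summand at
  a time, without bookkeeping of index sets.
\<close>

inductive fin_sum :: "'i set \<Rightarrow> ('i \<Rightarrow> 'o) \<Rightarrow> 'o \<Rightarrow> ('i \<Rightarrow> 'm) \<Rightarrow> 'o \<Rightarrow> 'm \<Rightarrow> bool"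
  for I X P \<iota> A where
  zero: "fin_sum I X P \<iota> A (zer A P)"
| plus: "fin_sum I X P \<iota> A b \<Longrightarrow> i \<in> I \<Longrightarrow> mor f A (X i) \<Longrightarrow> fin_sum I X P \<iota> A (b \<boxplus> \<iota> i \<cdot> f)"

end

locale coproduct = linear_category k C
  for k :: "('k, 'r) ring_scheme"
    and C :: "('k, 'o, 'm, 'z) lincat_scheme"  (structure) +
  fixes I :: "'i set" and X :: "'i \<Rightarrow> 'o" and P :: 'o and \<iota> :: "'i \<Rightarrow> 'm"
  assumes is_coproduct: "is_coproduct C I X P \<iota>"
begin

lemma obj [simp]: "P \<in> Obj C" "i \<in> I \<Longrightarrow> X i \<in> Obj C"
  using is_coproduct unfolding is_coproduct_def by auto

lemma inj [simp]: "i \<in> I \<Longrightarrow> arr (\<iota> i)" "i \<in> I \<Longrightarrow> dom (\<iota> i) = X i" "i \<in> I \<Longrightarrow> cod (\<iota> i) = P"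
  using is_coproduct arrow_iff unfolding is_coproduct_def by blast+

definition copair :: "'o \<Rightarrow> ('i \<Rightarrow> 'm) \<Rightarrow> 'm" where
  "copair Y g = (SOME u. mor u P Y \<and> (\<forall>i \<in> I. u \<cdot> \<iota> i = g i))"

lemma copair:
  assumes "Y \<in> Obj C" "\<And>i. i \<in> I \<Longrightarrow> mor (g i) (X i) Y"
  shows "arr (copair Y g)" "dom (copair Y g) = P" "cod (copair Y g) = Y"
    "i \<in> I \<Longrightarrow> copair Y g \<cdot> \<iota> i = g i"
proof -
  have "\<exists>u. mor u P Y \<and> (\<forall>i \<in> I. u \<cdot> \<iota> i = g i)"
    using is_coproduct assms unfolding is_coproduct_def mor_def by blast
  then have "mor (copair Y g) P Y \<and> (\<forall>i \<in> I. copair Y g \<cdot> \<iota> i = g i)"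
    unfolding copair_def by (rule someI_ex)
  then show "arr (copair Y g)" "dom (copair Y g) = P" "cod (copair Y g) = Y"
    "i \<in> I \<Longrightarrow> copair Y g \<cdot> \<iota> i = g i"
    by (auto simp: mor_iff)
qed

lemma ext:
  assumes "arr u" "arr v" "dom u = P" "dom v = P" "cod u = cod v"
    and "\<And>i. i \<in> I \<Longrightarrow> u \<cdot> \<iota> i = v \<cdot> \<iota> i"
  shows "u = v"
proof -
  have uv: "mor u P (cod v)" "mor v P (cod v)" using assms by (auto simp: mor_iff)
  have "\<forall>i \<in> I. v \<cdot> \<iota> i \<in> arrows C (X i) (cod v)"
    using assms by (simp add: arrow_iff)
  then have "\<exists>!u. u \<in> arrows C P (cod v) \<and> (\<forall>i \<in> I. u \<cdot> \<iota> i = v \<cdot> \<iota> i)"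
    using is_coproduct assms(2) unfolding is_coproduct_def by simp
  then show ?thesis using uv assms(6) unfolding mor_def by blast
qed

text \<open>
  Zero arrows make each summand a retract of the coproduct, with retraction \<open>proj i\<close>.  The
  idempotent \<open>res J\<close> keeps the summands in \<open>J\<close> and annihilates the others.
\<close>

definition proj :: "'i \<Rightarrow> 'm" where
  "proj i = copair (X i) (\<lambda>j. if j = i then Ident C (X i) else zer (X j) (X i))"

definition res :: "'i set \<Rightarrow> 'm" where
  "res J = copair P (\<lambda>j. if j \<in> J then \<iota> j else zer (X j) P)"

lemma proj [simp]:
  assumes "i \<in> I"
  shows "arr (proj i)" "dom (proj i) = P" "cod (proj i) = X i"
  unfolding proj_def using assms by (auto intro!: copair simp: mor_iff)

lemma proj_inj [simp]:
  assumes "i \<in> I" "j \<in> I"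
  shows "proj i \<cdot> \<iota> j = (if j = i then Ident C (X i) else zer (X j) (X i))"
  unfolding proj_def using assms by (subst copair) (auto simp: mor_iff)

lemma res [simp]: "arr (res J)" "dom (res J) = P" "cod (res J) = P"
  unfolding res_def by (auto intro!: copair simp: mor_iff)

lemma res_inj [simp]: "i \<in> I \<Longrightarrow> res J \<cdot> \<iota> i = (if i \<in> J then \<iota> i else zer (X i) P)"
  unfolding res_def by (subst copair) (auto simp: mor_iff)

lemma proj_res [simp]: "i \<in> I \<Longrightarrow> proj i \<cdot> res J = (if i \<in> J then proj i else zer P (X i))"
  by (rule ext) (auto simp: assoc)

lemma res_empty [simp]: "res {} = zer P P"
  by (rule ext) auto

lemma res_insert: "i \<in> I \<Longrightarrow> i \<notin> J \<Longrightarrow> res (insert i J) = res J \<boxplus> \<iota> i \<cdot> proj i"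
  by (rule ext) (auto simp: comp_plus assoc)

lemma proj_inj_comp [simp]:
  assumes "i \<in> I" "j \<in> I" "arr f" "cod f = X j"
  shows "proj i \<cdot> (\<iota> j \<cdot> f) = (if j = i then f else zer (dom f) (X i))"
  using assms by (simp flip: assoc)

lemma res_inj_comp [simp]:
  assumes "i \<in> I" "arr f" "cod f = X i"
  shows "res J \<cdot> (\<iota> i \<cdot> f) = (if i \<in> J then \<iota> i \<cdot> f else zer (dom f) P)"
  using assms by (simp flip: assoc)

lemma proj_res_comp [simp]:
  assumes "i \<in> I" "arr f" "cod f = P"
  shows "proj i \<cdot> (res J \<cdot> f) = (if i \<in> J then proj i \<cdot> f else zer (dom f) (X i))"
  using assms by (simp flip: assoc)

abbreviation fsum :: "'o \<Rightarrow> 'm \<Rightarrow> bool" where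
  "fsum \<equiv> fin_sum I X P \<iota>"

lemma fsum_arr:
  assumes "fsum A b" "A \<in> Obj C"
  shows "arr b" "dom b = A" "cod b = P"
  using assms by (induction) (auto simp: mor_iff)

lemma fsum_plus:
  assumes "fsum A b" "fsum A b'" "A \<in> Obj C"
  shows "fsum A (b \<boxplus> b')"
  using assms(2)
proof induction
  case zero
  show ?case using assms fsum_arr by simp
next
  case (plus b' i f)
  have "b \<boxplus> (b' \<boxplus> \<iota> i \<cdot> f) = (b \<boxplus> b') \<boxplus> \<iota> i \<cdot> f"
    using fsum_arr[OF assms(1)] fsum_arr[OF plus.hyps(1)] plus assms by (simp add: plus_assoc mor_iff)
  then show ?case using plus fin_sum.plus by metis
qed

lemma fsum_comp:
  assumes "fsum A b" "mor h B A"
  shows "fsum B (b \<cdot> h)"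
  using assms(1)
proof induction
  case zero
  show ?case using assms(2) fin_sum.zero mor_obj[OF assms(2)] by (auto simp: mor_iff)
next
  case (plus b i f)
  have "(b \<boxplus> \<iota> i \<cdot> f) \<cdot> h = b \<cdot> h \<boxplus> \<iota> i \<cdot> (f \<cdot> h)"
    using fsum_arr[OF plus.hyps(1)] plus assms(2) mor_obj[OF assms(2)]
    by (simp add: comp_plus assoc mor_iff)
  moreover have "mor (f \<cdot> h) B (X i)" using plus assms(2) by (auto simp: mor_iff)
  ultimately show ?case using plus fin_sum.plus by metis
qed

lemma fsum_neg:
  assumes "fsum A b" "A \<in> Obj C"
  shows "fsum A (neg b)"
  using fsum_comp[OF assms(1), of "neg (Ident C A)" A] fsum_arr[OF assms] assms(2)
  by (simp add: mor_iff comp_neg)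

lemma fsum_res:
  assumes "finite F" "F \<subseteq> I" "mor b A P"
  shows "fsum A (res F \<cdot> b)"
  using assms(1,2)
proof (induction)
  case empty
  show ?case using assms(3) fin_sum.zero by (auto simp: mor_iff)
next
  case (insert i F)
  have "res (insert i F) \<cdot> b = res F \<cdot> b \<boxplus> \<iota> i \<cdot> (proj i \<cdot> b)"
    using insert assms(3) by (simp add: mor_iff res_insert comp_plus assoc)
  moreover have "mor (proj i \<cdot> b) A (X i)" using insert assms(3) by (simp add: mor_iff)
  ultimately show ?case using insert fin_sum.plus by (metis insert_subset)
qed

text \<open>
  A finite sum involves only finitely many summands, so the idempotent of any larger set fixes it.
  The quantification over all larger sets is needed for the induction: the next summand enlarges
  \<open>F\<close>.
\<close>

lemma fsum_eq_res:
  assumes "fsum A b" "A \<in> Obj C"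
  obtains F where "finite F" "F \<subseteq> I" "\<forall>F'. F \<subseteq> F' \<longrightarrow> res F' \<cdot> b = b"
proof -
  have "\<exists>F. finite F \<and> F \<subseteq> I \<and> (\<forall>F'. F \<subseteq> F' \<longrightarrow> res F' \<cdot> b = b)"
    using assms(1)
  proof induction
    case zero
    show ?case using assms(2) by (auto intro!: exI[of _ "{}"])
  next
    case (plus b i f)
    then obtain F where F: "finite F" "F \<subseteq> I" "\<forall>F'. F \<subseteq> F' \<longrightarrow> res F' \<cdot> b = b" by blast
    have "res F' \<cdot> (b \<boxplus> \<iota> i \<cdot> f) = b \<boxplus> \<iota> i \<cdot> f" if "insert i F \<subseteq> F'" for F'
      using F(3) fsum_arr[OF plus.hyps(1) assms(2)] plus that by (simp add: comp_plus mor_iff)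
    then show ?case using F plus by (intro exI[of _ "insert i F"]) auto
  qed
  then show ?thesis using that by blast
qed

lemma fsum_finite_support:
  assumes "fsum A b" "A \<in> Obj C"
  shows "finite {i \<in> I. proj i \<cdot> b \<noteq> zer A (X i)}"
proof -
  obtain F where F: "finite F" "F \<subseteq> I" "\<forall>F'. F \<subseteq> F' \<longrightarrow> res F' \<cdot> b = b"
    using assms by (rule fsum_eq_res)
  have "proj i \<cdot> b = zer A (X i)" if "i \<in> I" "i \<notin> F" for i
    using proj_res_comp[of i b F] F(3) that fsum_arr[OF assms] by simp
  then have "{i \<in> I. proj i \<cdot> b \<noteq> zer A (X i)} \<subseteq> F" by blast
  then show ?thesis using F(1) finite_subset by blast
qed

text \<open>
  Since \<open>res F\<close> is the sum of the \<open>\<iota> i \<cdot> proj i\<close> over the finite set \<open>F\<close>, a finite sum is recovered from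
  its components.
\<close>

lemma fsum_zeroI:
  assumes "fsum A b" "A \<in> Obj C" "\<And>i. i \<in> I \<Longrightarrow> proj i \<cdot> b = zer A (X i)"
  shows "b = zer A P"
proof -
  obtain F where F: "finite F" "F \<subseteq> I" "\<forall>F'. F \<subseteq> F' \<longrightarrow> res F' \<cdot> b = b"
    using assms(1,2) by (rule fsum_eq_res)
  note b = fsum_arr[OF assms(1,2)]
  have "res F \<cdot> b = zer A P" using F(1,2)
  proof induction
    case empty
    show ?case using b by simp
  next
    case (insert i F)
    then show ?case using b assms(2,3) by (simp add: res_insert comp_plus assoc)
  qed
  then show ?thesis using F(3) by simp
qed

lemma fsum_eqI:
  assumes "fsum A b" "fsum A b'" "A \<in> Obj C" "\<And>i. i \<in> I \<Longrightarrow> proj i \<cdot> b = proj i \<cdot> b'"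
  shows "b = b'"
proof -
  note b = fsum_arr[OF assms(1,3)] fsum_arr[OF assms(2,3)]
  have "b \<boxplus> neg b' = zer A P"
    using fsum_plus[OF assms(1) fsum_neg[OF assms(2,3)] assms(3)] assms(3)
    by (rule fsum_zeroI) (use b assms(4) in \<open>simp add: comp_plus comp_neg\<close>)
  then show ?thesis using b minus_eq_zero by simp
qed

text \<open>
  An induction along the construction of \<open>b\<close> could pass through summands whose contributions cancel.
  Replacing \<open>b\<close> by \<open>res F \<cdot> b\<close>, where \<open>F\<close> is the support of \<open>b\<close>, only summands in \<open>J\<close> are met.
\<close>

lemma fsum_support_induct [consumes 3, case_names zero plus]:
  assumes "fsum A b" "A \<in> Obj C" "\<And>i. i \<in> I \<Longrightarrow> i \<notin> J \<Longrightarrow> proj i \<cdot> b = zer A (X i)"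
    and zero: "Q (zer A P)"
    and plus: "\<And>b i f. \<lbrakk>fsum A b; \<And>i. i \<in> I \<Longrightarrow> i \<notin> J \<Longrightarrow> proj i \<cdot> b = zer A (X i); 
      Q b; i \<in> I; i \<in> J; mor f A (X i)\<rbrakk> \<Longrightarrow> Q (b \<boxplus> \<iota> i \<cdot> f)"
  shows "Q b"
proof -
  note b = fsum_arr[OF assms(1,2)]
  define F where "F = {i \<in> I. proj i \<cdot> b \<noteq> zer A (X i)}"
  have F: "finite F" "F \<subseteq> I" "F \<subseteq> J"
    unfolding F_def using fsum_finite_support[OF assms(1,2)] assms(3) by auto
  have "b = res F \<cdot> b" using assms(1) fsum_res[OF F(1,2)] assms(2)
    by (rule fsum_eqI) (use b in \<open>auto simp: mor_iff F_def\<close>)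
  moreover have "Q (res F \<cdot> b)" using F
  proof induction
    case empty
    show ?case using b zero by simp
  next
    case (insert i F)
    have "res (insert i F) \<cdot> b = res F \<cdot> b \<boxplus> \<iota> i \<cdot> (proj i \<cdot> b)"
      using insert b by (simp add: res_insert comp_plus assoc)
    moreover have "Q (res F \<cdot> b \<boxplus> \<iota> i \<cdot> (proj i \<cdot> b))"
      using insert b by (intro plus fsum_res) (auto simp: mor_iff)
    ultimately show ?case by simp
  qed
  ultimately show ?thesis by simp
qed

end

lemma is_coproduct_reindex:
  assumes "is_coproduct C I X P \<iota>" "bij_betw \<sigma> J I"
    and "\<And>j. j \<in> J \<Longrightarrow> X' j = X (\<sigma> j)" "\<And>j. j \<in> J \<Longrightarrow> \<iota>' j = \<iota> (\<sigma> j)"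
  shows "is_coproduct C J X' P \<iota>'"
proof -
  define \<tau> where "\<tau> = inv_into J \<sigma>"
  have \<tau>: "\<And>i. i \<in> I \<Longrightarrow> \<tau> i \<in> J" "\<And>i. i \<in> I \<Longrightarrow> \<sigma> (\<tau> i) = i"
      "\<And>j. j \<in> J \<Longrightarrow> \<tau> (\<sigma> j) = j" "\<And>j. j \<in> J \<Longrightarrow> \<sigma> j \<in> I"
    unfolding \<tau>_def using assms(2) bij_betw_inv_into_left bij_betw_inv_into_right bij_betw_inv_into
      bij_betwE by metis+
  have univ: "\<And>Y g. Y \<in> Obj C \<Longrightarrow> \<forall>i \<in> I. g i \<in> arrows C (X i) Y \<Longrightarrow>
      \<exists>!u. u \<in> arrows C P Y \<and> (\<forall>i \<in> I. u \<cdot>\<^bsub>C\<^esub> \<iota> i = g i)"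
    using assms(1) unfolding is_coproduct_def by simp
  have "\<exists>!u. u \<in> arrows C P Y \<and> (\<forall>j \<in> J. u \<cdot>\<^bsub>C\<^esub> \<iota>' j = g j)"
    if "Y \<in> Obj C" "\<forall>j \<in> J. g j \<in> arrows C (X' j) Y" for Y g
  proof -
    have "\<forall>i \<in> I. g (\<tau> i) \<in> arrows C (X i) Y" using that(2) \<tau> assms(3) by metis
    then have "\<exists>!u. u \<in> arrows C P Y \<and> (\<forall>i \<in> I. u \<cdot>\<^bsub>C\<^esub> \<iota> i = g (\<tau> i))"
      using univ[of Y "\<lambda>i. g (\<tau> i)"] that(1) by simp
    moreover have "(\<forall>i \<in> I. u \<cdot>\<^bsub>C\<^esub> \<iota> i = g (\<tau> i)) \<longleftrightarrow> (\<forall>j \<in> J. u \<cdot>\<^bsub>C\<^esub> \<iota>' j = g j)" for u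
      using \<tau> assms(4) by metis
    ultimately show ?thesis by simp
  qed
  moreover have "\<forall>j \<in> J. X' j \<in> Obj C \<and> \<iota>' j \<in> arrows C (X' j) P"
    using assms(1,3,4) \<tau>(4) unfolding is_coproduct_def by simp
  moreover have "P \<in> Obj C" using assms(1) unfolding is_coproduct_def by simp
  ultimately show ?thesis unfolding is_coproduct_def by simp
qed


section \<open>Compact objects\<close>

context linear_category
begin

text \<open>
  Links the sums in the hom modules, in terms of which compactness is defined, to \<open>fin_sum\<close>.
\<close>

lemma finsum_coproduct:
  assumes "is_coproduct C I X P \<iota>" "A \<in> Obj C"
    and "finite F" "F \<subseteq> I" "\<And>i. i \<in> F \<Longrightarrow> mor (x i) A (X i)"
  shows "fin_sum I X P \<iota> A (finsum (Hom C A P) (\<lambda>i. \<iota> i \<cdot> x i) F)"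
    and "j \<in> I \<Longrightarrow> coproduct.proj C I X P \<iota> j \<cdot> finsum (Hom C A P) (\<lambda>i. \<iota> i \<cdot> x i) F =
      (if j \<in> F then x j else zer A (X j))"
proof -
  interpret coproduct k C I X P \<iota> by unfold_locales (rule assms(1))
  interpret HP: abelian_group "Hom C A P" using hom_group assms(2) by simp
  have "fsum A (finsum (Hom C A P) (\<lambda>i. \<iota> i \<cdot> x i) F) \<and>
    (\<forall>j \<in> I. proj j \<cdot> finsum (Hom C A P) (\<lambda>i. \<iota> i \<cdot> x i) F = (if j \<in> F then x j else zer A (X j)))"
    using assms(3-)
  proof induction
    case empty
    show ?case using fin_sum.zero assms(2) by auto
  next
    case (insert i F)
    let ?s = "finsum (Hom C A P) (\<lambda>i. \<iota> i \<cdot> x i) F"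
    have IH: "fsum A ?s" "\<forall>j \<in> I. proj j \<cdot> ?s = (if j \<in> F then x j else zer A (X j))"
      using insert by auto
    note s = fsum_arr[OF IH(1) assms(2)]
    have x: "arr (x i)" "dom (x i) = A" "cod (x i) = X i" "i \<in> I"
      using insert by (auto simp: mor_iff)
    have "finsum (Hom C A P) (\<lambda>i. \<iota> i \<cdot> x i) (insert i F) = \<iota> i \<cdot> x i \<oplus>\<^bsub>Hom C A P\<^esub> ?s"
      using insert assms(2) by (intro HP.finsum_insert) (auto simp: arrow_iff mor_iff)
    then have eq: "finsum (Hom C A P) (\<lambda>i. \<iota> i \<cdot> x i) (insert i F) = ?s \<boxplus> \<iota> i \<cdot> x i"
      using plus_commute[of "\<iota> i \<cdot> x i" ?s] s x by (simp add: plus_arr_def)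
    have "fsum A (?s \<boxplus> \<iota> i \<cdot> x i)" using IH insert by (intro fin_sum.plus) auto
    moreover have "proj j \<cdot> (?s \<boxplus> \<iota> i \<cdot> x i) = (if j \<in> insert i F then x j else zer A (X j))"
      if "j \<in> I" for j
      using IH(2) that s x insert(2) insert.prems(2)[of j] by (auto simp: comp_plus mor_iff)
    ultimately show ?case unfolding eq by blast
  qed
  then show "fsum A (finsum (Hom C A P) (\<lambda>i. \<iota> i \<cdot> x i) F)"
    and "j \<in> I \<Longrightarrow> proj j \<cdot> finsum (Hom C A P) (\<lambda>i. \<iota> i \<cdot> x i) F = (if j \<in> F then x j else zer A (X j))"
    by auto
qed

text \<open>
  The projections recover the components of a sum, so the canonical map from the direct sum is always
  injective.  Compactness therefore only says that this map is onto.
\<close>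

theorem compact_object_iff:
  "compact_object (U :: 'u itself) C A \<longleftrightarrow> A \<in> Obj C \<and>
     (\<forall>(I :: 'u set) X P \<iota> f. small U I \<longrightarrow> is_coproduct C I X P \<iota> \<longrightarrow> mor f A P \<longrightarrow> fin_sum I X P \<iota> A f)"
proof (cases "A \<in> Obj C")
  case A: True
  have "bij_betw
          (\<lambda>x. finsum (Hom C A P) (\<lambda>i. \<iota> i \<cdot> x i) {i \<in> I. x i \<noteq> zer A (X i)})
          (direct_sum I (\<lambda>i. Hom C A (X i)))
          (arrows C A P) \<longleftrightarrow> (\<forall>f. mor f A P \<longrightarrow> fin_sum I X P \<iota> A f)" (is "?bij \<longleftrightarrow> ?fin")
    if P: "is_coproduct C I X P \<iota>" for I :: "'u set" and X P \<iota>
  proof -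
    interpret coproduct k C I X P \<iota> by unfold_locales (rule P)
    let ?D = "direct_sum I (\<lambda>i. Hom C A (X i))"
    let ?supp = "\<lambda>x. {i \<in> I. x i \<noteq> zer A (X i)}"
    let ?m = "\<lambda>x. finsum (Hom C A P) (\<lambda>i. \<iota> i \<cdot> x i) (?supp x)"
    have D: "finite (?supp x)" "\<And>i. i \<in> I \<Longrightarrow> mor (x i) A (X i)" "x \<in> extensional I" if "x \<in> ?D" for x
      using that A obj by (auto simp: direct_sum_def mor_def PiE_def)
    have fs: "fsum A (?m x)" "\<And>j. j \<in> I \<Longrightarrow> proj j \<cdot> ?m x = x j" if "x \<in> ?D" for x
      using finsum_coproduct[OF P A, of "?supp x" x] D[OF that] by auto
    have inj: "inj_on ?m ?D"
    proof (rule inj_onI)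
      fix x y assume xy: "x \<in> ?D" "y \<in> ?D" "?m x = ?m y"
      then have "x j = y j" if "j \<in> I" for j
        using fs(2)[OF xy(1) that] fs(2)[OF xy(2) that] by simp
      then show "x = y" using D(3)[OF xy(1)] D(3)[OF xy(2)] extensionalityI by metis
    qed
    have sub: "?m ` ?D \<subseteq> {f. fsum A f \<and> mor f A P}"
      using fs(1) fsum_arr[OF _ A] by (auto simp: mor_iff)
    have "{f. fsum A f \<and> mor f A P} \<subseteq> ?m ` ?D"
    proof clarify
      fix f assume f: "fsum A f"
      note f' = fsum_arr[OF f A]
      define x where "x = (\<lambda>i \<in> I. proj i \<cdot> f)"
      have x: "x \<in> ?D"
        using fsum_finite_support[OF f A] f' A
        unfolding direct_sum_def x_def by (auto simp: arrow_iff intro: rev_finite_subset)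
      moreover have "f = ?m x" using f fs(1)[OF x] A
        by (rule fsum_eqI) (use fs(2)[OF x] in \<open>simp add: x_def\<close>)
      ultimately show "f \<in> ?m ` ?D" by blast
    qed
    then have "?m ` ?D = {f. fsum A f \<and> mor f A P}" using sub by blast
    then show ?thesis using inj A obj(1) unfolding bij_betw_def mor_def by blast
  qed
  then show ?thesis using A unfolding compact_object_def by (intro iffI conjI allI impI) blast+
qed (simp add: compact_object_def)

end

lemma small_inj:
  fixes J :: "'j set"
  assumes "small (U :: 'u itself) J"
  obtains \<sigma> :: "'j \<Rightarrow> 'u" where "bij_betw \<sigma> J (\<sigma> ` J)" "small U (\<sigma> ` J)"
proof -
  have "(card_of J, card_of (UNIV :: 'u set)) \<in> ordLeq"
    using assms unfolding small_def by (rule ordLess_imp_ordLeq)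
  then obtain \<sigma> :: "'j \<Rightarrow> 'u" where \<sigma>: "inj_on \<sigma> J" using card_of_ordLeq[of J "UNIV :: 'u set"] by auto
  have "small U (\<sigma> ` J)" using assms card_of_image unfolding small_def by (rule ordLeq_ordLess_trans[rotated])
  then show ?thesis using that inj_on_imp_bij_betw[OF \<sigma>] by blast
qed

context linear_category
begin

lemma compact_obj: "compact_object U C A \<Longrightarrow> A \<in> Obj C"
  by (simp add: compact_object_def)

lemma compact_fin_sum:
  fixes J :: "'j set"
  assumes "compact_object (U :: 'u itself) C A" "small U J" "is_coproduct C J X P \<iota>" "mor f A P"
  shows "fin_sum J X P \<iota> A f"
proof -
  obtain \<sigma> :: "'j \<Rightarrow> 'u" where \<sigma>: "bij_betw \<sigma> J (\<sigma> ` J)" "small U (\<sigma> ` J)"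
    using assms(2) by (rule small_inj)
  define \<tau> where "\<tau> = inv_into J \<sigma>"
  have \<tau>: "bij_betw \<tau> (\<sigma> ` J) J" unfolding \<tau>_def using \<sigma>(1) by (rule bij_betw_inv_into)
  have "is_coproduct C (\<sigma> ` J) (X \<circ> \<tau>) P (\<iota> \<circ> \<tau>)"
    by (rule is_coproduct_reindex[OF assms(3) \<tau>]) auto
  then have "fin_sum (\<sigma> ` J) (X \<circ> \<tau>) P (\<iota> \<circ> \<tau>) A f"
    using assms(1,4) \<sigma>(2) unfolding compact_object_iff by blast
  then show ?thesis
  proof induction
    case zero
    show ?case by (rule fin_sum.zero)
  next
    case (plus b i f)
    then have "\<tau> i \<in> J" using \<tau> bij_betwE by blast
    then show ?case using fin_sum.plus[OF plus.IH] plus.hyps by simp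
  qed
qed

lemma small_coproduct_exists:
  fixes J :: "'j set"
  assumes "has_small_coproducts (U :: 'u itself) C" "small U J" "\<And>j. j \<in> J \<Longrightarrow> X j \<in> Obj C"
  obtains P \<iota> where "is_coproduct C J X P \<iota>"
proof -
  obtain \<sigma> :: "'j \<Rightarrow> 'u" where \<sigma>: "bij_betw \<sigma> J (\<sigma> ` J)" "small U (\<sigma> ` J)"
    using assms(2) by (rule small_inj)
  define \<tau> where "\<tau> = inv_into J \<sigma>"
  have \<tau>: "\<tau> (\<sigma> j) = j" if "j \<in> J" for j
    unfolding \<tau>_def using \<sigma>(1) that by (rule bij_betw_inv_into_left)
  have "\<forall>i \<in> \<sigma> ` J. (X \<circ> \<tau>) i \<in> Obj C" using assms(3) \<tau> by auto
  then obtain P \<iota> where "is_coproduct C (\<sigma> ` J) (X \<circ> \<tau>) P \<iota>"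
    using assms(1) \<sigma>(2) unfolding has_small_coproducts_def by metis
  then have "is_coproduct C J X P (\<iota> \<circ> \<sigma>)"
    by (rule is_coproduct_reindex[OF _ \<sigma>(1)]) (simp_all add: \<tau>)
  then show ?thesis by (rule that)
qed

end

section \<open>Autoequivalences preserve coproducts and compact objects\<close>

locale endofunctor = linear_category k C
  for k :: "('k, 'r) ring_scheme"
    and C :: "('k, 'o, 'm, 'z) lincat_scheme"  (structure) +
  fixes Fo :: "'o \<Rightarrow> 'o" and Fm :: "'m \<Rightarrow> 'm"
  assumes linear_functor: "linear_functor k C C Fo Fm"
begin

lemma functor_obj [simp]: "A \<in> Obj C \<Longrightarrow> Fo A \<in> Obj C"
  using linear_functor unfolding linear_functor_def by blast

lemma functor_linear: "A \<in> Obj C \<Longrightarrow> B \<in> Obj C \<Longrightarrow> linear_map k (Hom C A B) (Hom C (Fo A) (Fo B)) Fm"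
  using linear_functor unfolding linear_functor_def by blast

lemma functor_arr [simp]:
  assumes "arr f"
  shows "arr (Fm f)" "dom (Fm f) = Fo (dom f)" "cod (Fm f) = Fo (cod f)"
proof -
  have "Fm f \<in> arrows C (Fo (dom f)) (Fo (cod f))"
    using functor_linear[of "dom f" "cod f"] arr_in[OF assms] assms unfolding linear_map_def by auto
  then show "arr (Fm f)" "dom (Fm f) = Fo (dom f)" "cod (Fm f) = Fo (cod f)"
    using assms by (simp_all add: arrow_iff)
qed

lemma functor_mor: "mor f A B \<Longrightarrow> mor (Fm f) (Fo A) (Fo B)"
  by (auto simp: mor_iff)

lemma functor_ident [simp]: "A \<in> Obj C \<Longrightarrow> Fm (Ident C A) = Ident C (Fo A)"
  using linear_functor unfolding linear_functor_def by blast

lemma functor_comp: "arr f \<Longrightarrow> arr g \<Longrightarrow> cod f = dom g \<Longrightarrow> Fm (g \<cdot> f) = Fm g \<cdot> Fm f"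
  using linear_functor arr_in[of f] arr_in[of g] arr_obj[of f] arr_obj[of g]
  unfolding linear_functor_def by metis

lemma functor_plus:
  "arr f \<Longrightarrow> arr g \<Longrightarrow> dom f = dom g \<Longrightarrow> cod f = cod g \<Longrightarrow> Fm (f \<boxplus> g) = Fm f \<boxplus> Fm g"
  using functor_linear[of "dom f" "cod f"] arr_in[of f] arr_in[of g]
  by (simp add: linear_map_def plus_arr_def)

lemma functor_zero [simp]:
  assumes "A \<in> Obj C" "B \<in> Obj C"
  shows "Fm (zer A B) = zer (Fo A) (Fo B)"
  using functor_plus[of "zer A B" "zer A B"] idem_zero[of "Fm (zer A B)"] assms by simp

end

lemma (in linear_category) linear_functor_id: "linear_functor k C C id id"
  by (simp add: linear_functor_def linear_map_def)

lemma (in linear_category) linear_functor_comp: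
  assumes "linear_functor k C C Fo Fm" "linear_functor k C C Go Gm"
  shows "linear_functor k C C (Fo \<circ> Go) (Fm \<circ> Gm)"
proof -
  interpret F: endofunctor k C Fo Fm by unfold_locales (rule assms)
  interpret G: endofunctor k C Go Gm by unfold_locales (rule assms)
  have "linear_map k (Hom C A B) (Hom C (Fo (Go A)) (Fo (Go B))) (Fm \<circ> Gm)"
    if "A \<in> Obj C" "B \<in> Obj C" for A B
    using F.functor_linear[of "Go A" "Go B"] G.functor_linear[of A B] that
    by (simp add: linear_map_def Pi_iff)
  then show ?thesis unfolding linear_functor_def
    by (simp add: arrow_iff F.functor_comp G.functor_comp)
qed

lemma (in linear_category) natural_isomorphism_inverse:
  assumes "linear_functor k C C Fo Fm" "linear_functor k C C Go Gm"
    and "natural_isomorphism C C Fo Fm Go Gm \<eta>"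
  obtains \<eta>' where "natural_isomorphism C C Go Gm Fo Fm \<eta>'"
proof -
  interpret F: endofunctor k C Fo Fm by unfold_locales (rule assms)
  interpret G: endofunctor k C Go Gm by unfold_locales (rule assms)
  have "\<exists>g. mor (\<eta> A) (Fo A) (Go A) \<and> mor g (Go A) (Fo A) \<and>
      g \<cdot> \<eta> A = Ident C (Fo A) \<and> \<eta> A \<cdot> g = Ident C (Go A)" if "A \<in> Obj C" for A
    using assms(3) that F.functor_obj G.functor_obj iso_arrowE[of "Fo A" "Go A" "\<eta> A"]
    unfolding natural_isomorphism_def by metis
  then obtain \<eta>' where \<eta>': "\<And>A. A \<in> Obj C \<Longrightarrow> mor (\<eta> A) (Fo A) (Go A) \<and> mor (\<eta>' A) (Go A) (Fo A) \<and>
      \<eta>' A \<cdot> \<eta> A = Ident C (Fo A) \<and> \<eta> A \<cdot> \<eta>' A = Ident C (Go A)" by metis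
  have "\<eta>' (cod f) \<cdot> Gm f = Fm f \<cdot> \<eta>' (dom f)" if f: "arr f" for f
  proof -
    have A: "mor (\<eta> (dom f)) (Fo (dom f)) (Go (dom f))" "mor (\<eta>' (dom f)) (Go (dom f)) (Fo (dom f))"
      "\<eta> (dom f) \<cdot> \<eta>' (dom f) = Ident C (Go (dom f))" using \<eta>'[of "dom f"] f by auto
    have B: "mor (\<eta> (cod f)) (Fo (cod f)) (Go (cod f))" "mor (\<eta>' (cod f)) (Go (cod f)) (Fo (cod f))"
      "\<eta>' (cod f) \<cdot> \<eta> (cod f) = Ident C (Fo (cod f))" using \<eta>'[of "cod f"] f by auto
    have nat: "\<eta> (cod f) \<cdot> Fm f = Gm f \<cdot> \<eta> (dom f)"
      using assms(3) f arr_in[OF f] unfolding natural_isomorphism_def by simp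
    have "\<eta>' (cod f) \<cdot> Gm f = \<eta>' (cod f) \<cdot> (Gm f \<cdot> (\<eta> (dom f) \<cdot> \<eta>' (dom f)))"
      using A B f by (simp add: mor_iff)
    also have "\<dots> = \<eta>' (cod f) \<cdot> ((\<eta> (cod f) \<cdot> Fm f) \<cdot> \<eta>' (dom f))"
      using A(1,2) B(1,2) f unfolding nat by (simp add: mor_iff assoc)
    also have "\<dots> = (\<eta>' (cod f) \<cdot> \<eta> (cod f)) \<cdot> (Fm f \<cdot> \<eta>' (dom f))"
      using A(1,2) B(1,2) f by (simp add: mor_iff assoc)
    also have "\<dots> = Fm f \<cdot> \<eta>' (dom f)" using A B f by (simp add: mor_iff)
    finally show ?thesis .
  qed
  then have "natural_isomorphism C C Go Gm Fo Fm \<eta>'"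
    unfolding natural_isomorphism_def using \<eta>' by (auto intro!: iso_arrowI simp: arrow_iff)
  then show ?thesis by (rule that)
qed

locale autoequivalence = linear_category k C + F: endofunctor k C Fo Fm + G: endofunctor k C Go Gm
  for k :: "('k, 'r) ring_scheme"
    and C :: "('k, 'o, 'm, 'z) lincat_scheme"  (structure) and Fo Fm Go Gm +
  fixes \<eta> \<epsilon> :: "'o \<Rightarrow> 'm"
  assumes unit: "natural_isomorphism C C id id (Go \<circ> Fo) (Gm \<circ> Fm) \<eta>"
    and counit: "natural_isomorphism C C (Fo \<circ> Go) (Fm \<circ> Gm) id id \<epsilon>"
begin

lemma unitE:
  assumes "A \<in> Obj C"
  obtains h where "mor (\<eta> A) A (Go (Fo A))" "mor h (Go (Fo A)) A"
    "h \<cdot> \<eta> A = Ident C A" "\<eta> A \<cdot> h = Ident C (Go (Fo A))"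
  using unit assms iso_arrowE[of A "Go (Fo A)" "\<eta> A"] unfolding natural_isomorphism_def by auto

lemma counitE:
  assumes "A \<in> Obj C"
  obtains h where "mor (\<epsilon> A) (Fo (Go A)) A" "mor h A (Fo (Go A))"
    "h \<cdot> \<epsilon> A = Ident C (Fo (Go A))" "\<epsilon> A \<cdot> h = Ident C A"
  using counit assms iso_arrowE[of "Fo (Go A)" A "\<epsilon> A"] unfolding natural_isomorphism_def by auto

lemma unit_natural: "arr f \<Longrightarrow> \<eta> (cod f) \<cdot> f = Gm (Fm f) \<cdot> \<eta> (dom f)"
  using unit arr_in[of f] unfolding natural_isomorphism_def by simp

lemma counit_natural: "arr f \<Longrightarrow> \<epsilon> (cod f) \<cdot> Fm (Gm f) = f \<cdot> \<epsilon> (dom f)"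
  using counit arr_in[of f] unfolding natural_isomorphism_def by simp

text \<open>
  Inverting the unit and the counit exchanges the roles of the two functors.  Facts about \<open>Fo\<close> thus
  also hold for its inverse.
\<close>

lemma inverse_equivalence:
  obtains \<eta>' \<epsilon>' where "autoequivalence k C Go Gm Fo Fm \<eta>' \<epsilon>'"
proof -
  have lf: "linear_functor k C C id id" "linear_functor k C C (Fo \<circ> Go) (Fm \<circ> Gm)"
    "linear_functor k C C (Go \<circ> Fo) (Gm \<circ> Fm)"
    using linear_functor_id linear_functor_comp F.linear_functor G.linear_functor by blast+
  obtain \<eta>' where "natural_isomorphism C C id id (Fo \<circ> Go) (Fm \<circ> Gm) \<eta>'"
    using lf(2,1) counit by (rule natural_isomorphism_inverse)
  moreover obtain \<epsilon>' where "natural_isomorphism C C (Go \<circ> Fo) (Gm \<circ> Fm) id id \<epsilon>'"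
    using lf(1,3) unit by (rule natural_isomorphism_inverse)
  ultimately have "autoequivalence k C Go Gm Fo Fm \<eta>' \<epsilon>'"
    by unfold_locales
  then show ?thesis by (rule that)
qed

lemma faithful:
  assumes "arr f" "arr g" "dom f = dom g" "cod f = cod g" "Fm f = Fm g"
  shows "f = g"
proof -
  obtain h where h: "mor (\<eta> (cod g)) (cod g) (Go (Fo (cod g)))" "mor h (Go (Fo (cod g))) (cod g)"
    "h \<cdot> \<eta> (cod g) = Ident C (cod g)" using assms(2) unitE arr_obj by metis
  have "\<eta> (cod g) \<cdot> f = \<eta> (cod g) \<cdot> g" using unit_natural[of f] unit_natural[of g] assms by simp
  then have "(h \<cdot> \<eta> (cod g)) \<cdot> f = (h \<cdot> \<eta> (cod g)) \<cdot> g" using assms h(1,2) by (simp add: assoc mor_iff)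
  then show ?thesis using assms h by simp
qed

text \<open>
  The candidate is \<open>Gm h\<close> conjugated by the unit.  Its image under \<open>Gm \<circ> Fm\<close> is \<open>Gm h\<close> by naturality,
  and \<open>Gm\<close> is faithful.
\<close>

lemma full:
  assumes "A \<in> Obj C" "B \<in> Obj C" "mor h (Fo A) (Fo B)"
  obtains f where "mor f A B" "Fm f = h"
proof -
  obtain \<eta>' \<epsilon>' where "autoequivalence k C Go Gm Fo Fm \<eta>' \<epsilon>'" by (rule inverse_equivalence)
  then interpret inv: autoequivalence k C Go Gm Fo Fm \<eta>' \<epsilon>' .
  obtain a where a: "mor (\<eta> A) A (Go (Fo A))" "mor a (Go (Fo A)) A" "\<eta> A \<cdot> a = Ident C (Go (Fo A))"
    using unitE assms(1) by blast
  obtain b where b: "mor (\<eta> B) B (Go (Fo B))" "mor b (Go (Fo B)) B" "\<eta> B \<cdot> b = Ident C (Go (Fo B))"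
    using unitE assms(2) by blast
  define f where "f = b \<cdot> (Gm h \<cdot> \<eta> A)"
  have f: "mor f A B" unfolding f_def using assms(3) a b by (auto simp: mor_iff)
  have "Gm (Fm f) = Gm (Fm f) \<cdot> (\<eta> A \<cdot> a)" using f a by (simp add: mor_iff)
  also have "\<dots> = (Gm (Fm f) \<cdot> \<eta> A) \<cdot> a" using f a(1,2) by (simp add: mor_iff assoc)
  also have "\<dots> = (\<eta> B \<cdot> f) \<cdot> a" using unit_natural[of f] f by (simp add: mor_iff)
  also have "\<dots> = (\<eta> B \<cdot> b) \<cdot> (Gm h \<cdot> (\<eta> A \<cdot> a))"
    unfolding f_def using a(1,2) b(1,2) assms(3) by (auto simp: mor_iff assoc)
  also have "\<dots> = Gm h" using a b assms(3) by (auto simp: mor_iff)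
  finally have "Gm (Fm f) = Gm h" .
  then have "Fm f = h" using inv.faithful[of "Fm f" h] f assms(3) by (auto simp: mor_iff)
  then show ?thesis using f that by blast
qed

text \<open>
  Arrows \<open>Fo P \<rightarrow> Y\<close> are, up to the counit, the images of arrows \<open>P \<rightarrow> Go Y\<close>.
\<close>

theorem preserves_coproduct:
  assumes "is_coproduct C I X P \<iota>"
  shows "is_coproduct C I (Fo \<circ> X) (Fo P) (Fm \<circ> \<iota>)"
proof -
  interpret coproduct k C I X P \<iota> by unfold_locales (rule assms)
  have "\<exists>!u. u \<in> arrows C (Fo P) Y \<and> (\<forall>i \<in> I. u \<cdot> (Fm \<circ> \<iota>) i = g i)"
    if Y: "Y \<in> Obj C" and g: "\<forall>i \<in> I. g i \<in> arrows C ((Fo \<circ> X) i) Y" for Y g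
  proof -
    have g': "arr (g i)" "dom (g i) = Fo (X i)" "cod (g i) = Y" if "i \<in> I" for i
      using g Y that by (simp_all add: arrow_iff)
    obtain e where e: "mor (\<epsilon> Y) (Fo (Go Y)) Y" "mor e Y (Fo (Go Y))"
      "e \<cdot> \<epsilon> Y = Ident C (Fo (Go Y))" "\<epsilon> Y \<cdot> e = Ident C Y" using Y by (rule counitE)
    note e' = e(1,2)[unfolded mor_iff]
    have "\<exists>h. mor h (X i) (Go Y) \<and> Fm h = e \<cdot> g i" if "i \<in> I" for i
    proof -
      have "mor (e \<cdot> g i) (Fo (X i)) (Fo (Go Y))" using g'[OF that] e' by (simp add: mor_iff)
      then show ?thesis using full[of "X i" "Go Y"] that Y by (metis obj(2) G.functor_obj)
    qed
    then obtain h where h: "\<And>i. i \<in> I \<Longrightarrow> mor (h i) (X i) (Go Y)" "\<And>i. i \<in> I \<Longrightarrow> Fm (h i) = e \<cdot> g i"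
      by metis
    note v = copair[of "Go Y" h, OF G.functor_obj[OF Y] h(1)]
    define u where "u = \<epsilon> Y \<cdot> Fm (copair (Go Y) h)"
    have u: "arr u" "dom u = Fo P" "cod u = Y" using v e' unfolding u_def by simp_all
    have ui: "u \<cdot> Fm (\<iota> i) = g i" if "i \<in> I" for i
    proof -
      have "u \<cdot> Fm (\<iota> i) = \<epsilon> Y \<cdot> Fm (copair (Go Y) h \<cdot> \<iota> i)"
        unfolding u_def using v(1-3) e' that by (simp add: assoc F.functor_comp)
      also have "\<dots> = \<epsilon> Y \<cdot> (e \<cdot> g i)" using v(4) h(2) that by simp
      also have "\<dots> = (\<epsilon> Y \<cdot> e) \<cdot> g i" using e' g'[OF that] by (simp add: assoc)
      also have "\<dots> = g i" using e g'[OF that] by simp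
      finally show ?thesis .
    qed
    have "u' = u" if u': "u' \<in> arrows C (Fo P) Y" "\<forall>i \<in> I. u' \<cdot> (Fm \<circ> \<iota>) i = g i" for u'
    proof -
      have u'': "arr u'" "dom u' = Fo P" "cod u' = Y" using u' Y by (simp_all add: arrow_iff)
      have "mor (e \<cdot> u') (Fo P) (Fo (Go Y))" "mor (e \<cdot> u) (Fo P) (Fo (Go Y))"
        using u u'' e' by (simp_all add: mor_iff)
      then obtain w w' where w: "mor w P (Go Y)" "Fm w = e \<cdot> u" "mor w' P (Go Y)" "Fm w' = e \<cdot> u'"
        using full[of P "Go Y"] Y by (metis obj(1) G.functor_obj)
      have "w' = w"
      proof (rule ext)
        fix i assume i: "i \<in> I"
        have "Fm (w' \<cdot> \<iota> i) = Fm (w \<cdot> \<iota> i)"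
          using w i u' ui u u'' e' by (simp add: F.functor_comp mor_iff assoc)
        then show "w' \<cdot> \<iota> i = w \<cdot> \<iota> i"
          using faithful[of "w' \<cdot> \<iota> i" "w \<cdot> \<iota> i"] w(1,3) i by (simp add: mor_iff)
      qed (use w in \<open>simp_all add: mor_iff\<close>)
      then have "\<epsilon> Y \<cdot> (e \<cdot> u') = \<epsilon> Y \<cdot> (e \<cdot> u)" using w by simp
      then have "(\<epsilon> Y \<cdot> e) \<cdot> u' = (\<epsilon> Y \<cdot> e) \<cdot> u" using e' u u'' by (simp add: assoc)
      then show ?thesis using e u u'' by simp
    qed
    then have uniq: "u' = u" if "u' \<in> arrows C (Fo P) Y \<and> (\<forall>i \<in> I. u' \<cdot> (Fm \<circ> \<iota>) i = g i)" for u'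
      using that by simp
    have ex: "u \<in> arrows C (Fo P) Y \<and> (\<forall>i \<in> I. u \<cdot> (Fm \<circ> \<iota>) i = g i)"
      using u Y ui by (simp add: arrow_iff)
    show ?thesis using ex uniq by (rule ex1I)
  qed
  moreover have "\<forall>i \<in> I. (Fm \<circ> \<iota>) i \<in> arrows C ((Fo \<circ> X) i) (Fo P)"
    by (simp add: arrow_iff)
  ultimately show ?thesis unfolding is_coproduct_def by simp
qed

text \<open>
  An arrow \<open>Fo A \<rightarrow> P\<close> is, up to the counit, the image of an arrow \<open>A \<rightarrow> Go P\<close>.  The latter is a finite
  sum, because \<open>Go P\<close> is again a coproduct.
\<close>

theorem preserves_compact:
  assumes "compact_object (U :: 'u itself) C A"
  shows "compact_object U C (Fo A)"
proof -
  have A: "A \<in> Obj C" using assms by (rule compact_obj)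
  obtain \<eta>' \<epsilon>' where "autoequivalence k C Go Gm Fo Fm \<eta>' \<epsilon>'" by (rule inverse_equivalence)
  then interpret inv: autoequivalence k C Go Gm Fo Fm \<eta>' \<epsilon>' .
  have "fin_sum I X P \<iota> (Fo A) f"
    if I: "small U I" and P: "is_coproduct C I X P \<iota>" and f: "mor f (Fo A) P" for I :: "'u set" and X P \<iota> f
  proof -
    interpret coproduct k C I X P \<iota> by unfold_locales (rule P)
    obtain e where e: "mor (\<epsilon> P) (Fo (Go P)) P" "mor e P (Fo (Go P))" "\<epsilon> P \<cdot> e = Ident C P"
      using obj(1) by (rule counitE)
    have \<epsilon>X: "mor (\<epsilon> (X i)) (Fo (Go (X i))) (X i)" if "i \<in> I" for i
      using that obj(2) counitE by metis
    have "mor (e \<cdot> f) (Fo A) (Fo (Go P))" using e f by (simp add: mor_iff)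
    then obtain h where h: "mor h A (Go P)" "Fm h = e \<cdot> f"
      using full[of A "Go P"] A obj(1) G.functor_obj by metis
    have GP: "is_coproduct C I (Go \<circ> X) (Go P) (Gm \<circ> \<iota>)" using P by (rule inv.preserves_coproduct)
    then have "fin_sum I (Go \<circ> X) (Go P) (Gm \<circ> \<iota>) A h"
      using assms I h(1) unfolding compact_object_iff by blast
    then have "fsum (Fo A) (\<epsilon> P \<cdot> Fm h)"
    proof induction
      case zero
      show ?case using e(1) A fin_sum.zero by (auto simp: mor_iff)
    next
      case (plus b i g)
      interpret GP: coproduct k C I "Go \<circ> X" "Go P" "Gm \<circ> \<iota>" by unfold_locales (rule GP)
      note b = GP.fsum_arr[OF plus.hyps(1) A]
      have "\<epsilon> P \<cdot> Fm (b \<boxplus> (Gm \<circ> \<iota>) i \<cdot> g) = \<epsilon> P \<cdot> Fm b \<boxplus> (\<epsilon> P \<cdot> Fm (Gm (\<iota> i))) \<cdot> Fm g"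
        using b e(1) plus.hyps by (simp add: mor_iff F.functor_plus F.functor_comp comp_plus assoc)
      also have "\<dots> = \<epsilon> P \<cdot> Fm b \<boxplus> \<iota> i \<cdot> (\<epsilon> (X i) \<cdot> Fm g)"
        using counit_natural[of "\<iota> i"] \<epsilon>X[of i] plus.hyps by (simp add: mor_iff assoc)
      finally show ?case using plus \<epsilon>X[of i] by (auto intro!: fin_sum.plus simp: mor_iff)
    qed
    moreover have "\<epsilon> P \<cdot> Fm h = f" using e f h(2) by (simp add: mor_iff flip: assoc)
    ultimately show ?thesis by simp
  qed
  then show ?thesis unfolding compact_object_iff using A by simp
qed

end

section \<open>Exactness of distinguished triangles\<close>

sublocale triangulated_category \<subseteq> shift: endofunctor k T "ShiftO T" "ShiftM T"
  using shift_equivalence unfolding linear_equivalence_def by unfold_locales blast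

context triangulated_category
begin

notation plus_arr  (infixl \<open>\<boxplus>\<close> 65)

abbreviation \<Sigma>\<^sub>o where "\<Sigma>\<^sub>o \<equiv> ShiftO T"
abbreviation \<Sigma>\<^sub>m where "\<Sigma>\<^sub>m \<equiv> ShiftM T"

lemma shift_autoequivalence:
  obtains Go Gm \<eta> \<epsilon> where "autoequivalence k T \<Sigma>\<^sub>o \<Sigma>\<^sub>m Go Gm \<eta> \<epsilon>"
proof -
  obtain Go Gm \<eta> \<epsilon> where G: "linear_functor k T T Go Gm"
      "natural_isomorphism T T id id (Go \<circ> \<Sigma>\<^sub>o) (Gm \<circ> \<Sigma>\<^sub>m) \<eta>"
      "natural_isomorphism T T (\<Sigma>\<^sub>o \<circ> Go) (\<Sigma>\<^sub>m \<circ> Gm) id id \<epsilon>"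
    using shift_equivalence unfolding linear_equivalence_def by blast
  then have "autoequivalence k T \<Sigma>\<^sub>o \<Sigma>\<^sub>m Go Gm \<eta> \<epsilon>"
    by unfold_locales
  then show ?thesis by (rule that)
qed

lemma triangle_iff:
  "triangle T X Y Z f g h \<longleftrightarrow> mor f X Y \<and> mor g Y Z \<and> mor h Z (\<Sigma>\<^sub>o X)"
  unfolding triangle_def mor_def by auto

lemma dist_mor:
  assumes "Dist T X Y Z f g h"
  shows "mor f X Y" "mor g Y Z" "mor h Z (\<Sigma>\<^sub>o X)" "X \<in> Obj T" "Y \<in> Obj T" "Z \<in> Obj T"
  using dist_triangle[OF assms] unfolding triangle_def mor_def by auto

lemma rotate_iff:
  assumes "mor f X Y" "mor g Y Z" "mor h Z (\<Sigma>\<^sub>o X)"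
  shows "Dist T X Y Z f g h \<longleftrightarrow> Dist T Y Z (\<Sigma>\<^sub>o X) g h (neg (\<Sigma>\<^sub>m f))"
  using TR2[of X Y Z f g h] assms unfolding triangle_iff by (simp add: neg_def mor_iff)

lemma rotate: "Dist T X Y Z f g h \<Longrightarrow> Dist T Y Z (\<Sigma>\<^sub>o X) g h (neg (\<Sigma>\<^sub>m f))"
  using rotate_iff dist_mor by metis

lemma shift_zero_object:
  assumes "zero_object T N"
  shows "zero_object T (\<Sigma>\<^sub>o N)"
proof (rule zero_objectI)
  have N: "N \<in> Obj T" using assms by (simp add: zero_object_def)
  then show "\<Sigma>\<^sub>o N \<in> Obj T" by simp
  have "Ident T N = zer N N" using zero_object_arrows(1)[OF assms N] N by (simp add: mor_iff)
  then show "Ident T (\<Sigma>\<^sub>o N) = zer (\<Sigma>\<^sub>o N) (\<Sigma>\<^sub>o N)"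
    using shift.functor_ident[OF N] shift.functor_zero[OF N N] by simp
qed

lemma dist_fill:
  assumes "Dist T X Y Z f g h" "Dist T X' Y' Z' f' g' h'" "mor a X X'" "mor b Y Y'" "b \<cdot> f = f' \<cdot> a"
  obtains c where "mor c Z Z'" "c \<cdot> g = g' \<cdot> b" "\<Sigma>\<^sub>m a \<cdot> h = h' \<cdot> c"
  using TR3[OF assms(1,2) _ _ assms(5)] assms(3,4) dist_mor(6)[OF assms(1)] dist_mor(6)[OF assms(2)]
  unfolding mor_def by blast

text \<open>
  By fill-in from the triangle on the identity of \<open>X\<close>, the composite factors through a zero object.
\<close>

lemma dist_comp_zero:
  assumes "Dist T X Y Z f g h"
  shows "g \<cdot> f = zer X Z"
proof -
  note d = dist_mor[OF assms]
  obtain N where N: "zero_object T N" using has_zero_object by blast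
  then have N': "N \<in> Obj T" by (simp add: zero_object_def)
  have "Dist T X X N (Ident T X) (zer X N) (zer N (\<Sigma>\<^sub>o X))" using TR1_ident d(4) N by simp
  moreover have "mor (Ident T X) X X" "f \<cdot> Ident T X = f \<cdot> Ident T X" using d(4) by (simp_all add: mor_iff)
  ultimately obtain c where "mor c N Z" "c \<cdot> zer X N = g \<cdot> f" using assms d(1) dist_fill by metis
  then show ?thesis using N' d by (simp add: mor_iff)
qed

text \<open>
  An arrow \<open>y\<close> with \<open>y \<cdot> f = 0\<close> is the first half of a morphism to the distinguished triangle
  \<open>0 \<rightarrow> W \<rightarrow> W \<rightarrow> \<Sigma>0\<close>.
\<close>

lemma weak_cokernel:
  assumes "Dist T X Y Z f g h" "mor y Y W" "y \<cdot> f = zer X W"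
  obtains z where "mor z Z W" "z \<cdot> g = y"
proof -
  note d = dist_mor[OF assms(1)]
  note W = mor_obj(2)[OF assms(2)]
  obtain N where N: "zero_object T N" using has_zero_object by blast
  then have N': "N \<in> Obj T" by (simp add: zero_object_def)
  have "Dist T W W (\<Sigma>\<^sub>o N) (Ident T W) (zer W (\<Sigma>\<^sub>o N)) (zer (\<Sigma>\<^sub>o N) (\<Sigma>\<^sub>o W))"
    using TR1_ident W shift_zero_object N by simp
  then have "Dist T N W W (zer N W) (Ident T W) (zer W (\<Sigma>\<^sub>o N))"
    using rotate_iff[of "zer N W" N W "Ident T W" W "zer W (\<Sigma>\<^sub>o N)"] W N' by (simp add: mor_iff)
  moreover have "mor (zer X N) X N" "y \<cdot> f = zer N W \<cdot> zer X N"
    using N' W d assms(3) by (simp_all add: mor_iff)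
  ultimately obtain c where "mor c Z W" "c \<cdot> g = Ident T W \<cdot> y" using assms(1,2) dist_fill by metis
  then show ?thesis using that[of c] assms(2) by (simp add: mor_iff)
qed

text \<open>
  An arrow \<open>c\<close> with \<open>g \<cdot> c = 0\<close> is the first half of a morphism from the rotated triangle
  \<open>A \<rightarrow> 0 \<rightarrow> \<Sigma>A \<rightarrow> \<Sigma>A\<close> to the rotation of the given one.  The fill-in \<open>\<Sigma>A \<rightarrow> \<Sigma>X\<close> is a suspension, since
  the shift is full.
\<close>

lemma weak_kernel:
  assumes "Dist T X Y Z f g h" "mor c A Y" "g \<cdot> c = zer A Z"
  obtains x where "mor x A X" "f \<cdot> x = c"
proof -
  note d = dist_mor[OF assms(1)]
  note A = mor_obj(1)[OF assms(2)]
  obtain Go Gm \<eta> \<epsilon> where "autoequivalence k T \<Sigma>\<^sub>o \<Sigma>\<^sub>m Go Gm \<eta> \<epsilon>" by (rule shift_autoequivalence)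
  then interpret S: autoequivalence k T \<Sigma>\<^sub>o \<Sigma>\<^sub>m Go Gm \<eta> \<epsilon> .
  obtain N where N: "zero_object T N" using has_zero_object by blast
  then have N': "N \<in> Obj T" by (simp add: zero_object_def)
  have "Dist T A N (\<Sigma>\<^sub>o A) (zer A N) (zer N (\<Sigma>\<^sub>o A)) (neg (Ident T (\<Sigma>\<^sub>o A)))"
    using rotate[OF TR1_ident[OF A N]] A by simp
  moreover have "mor (zer N Z) N Z" "zer N Z \<cdot> zer A N = g \<cdot> c"
    using N' A d assms(2,3) by (simp_all add: mor_iff)
  ultimately obtain e where e: "mor e (\<Sigma>\<^sub>o A) (\<Sigma>\<^sub>o X)"
      "\<Sigma>\<^sub>m c \<cdot> neg (Ident T (\<Sigma>\<^sub>o A)) = neg (\<Sigma>\<^sub>m f) \<cdot> e"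
    using rotate[OF assms(1)] assms(2) dist_fill by metis
  then obtain x where x: "mor x A X" "\<Sigma>\<^sub>m x = e" using e(1) S.full A d(4) by metis
  have "neg (\<Sigma>\<^sub>m c) = neg (\<Sigma>\<^sub>m (f \<cdot> x))"
    using e(2) x assms(2) d A by (auto simp: mor_iff comp_neg shift.functor_comp)
  then have "neg (neg (\<Sigma>\<^sub>m c)) = neg (neg (\<Sigma>\<^sub>m (f \<cdot> x)))" by (rule arg_cong)
  then have "\<Sigma>\<^sub>m (f \<cdot> x) = \<Sigma>\<^sub>m c" using x assms(2) d by (simp add: mor_iff)
  then have "f \<cdot> x = c" using S.faithful[of "f \<cdot> x" c] x assms(2) d by (simp add: mor_iff)
  then show ?thesis using that x by blast
qed


section \<open>Compact objects and triangles\<close>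

lemma compact_shift: "compact_object U T A \<Longrightarrow> compact_object U T (\<Sigma>\<^sub>o A)"
  using shift_autoequivalence autoequivalence.preserves_compact by metis

lemma compact_desuspension:
  assumes "compact_object U T A"
  obtains W c c' where "compact_object U T W" "mor c A (\<Sigma>\<^sub>o W)" "mor c' (\<Sigma>\<^sub>o W) A"
    "c' \<cdot> c = Ident T A" "c \<cdot> c' = Ident T (\<Sigma>\<^sub>o W)"
proof -
  obtain Go Gm \<eta> \<epsilon> where "autoequivalence k T \<Sigma>\<^sub>o \<Sigma>\<^sub>m Go Gm \<eta> \<epsilon>" by (rule shift_autoequivalence)
  then interpret S: autoequivalence k T \<Sigma>\<^sub>o \<Sigma>\<^sub>m Go Gm \<eta> \<epsilon> .
  obtain \<eta>' \<epsilon>' where "autoequivalence k T Go Gm \<Sigma>\<^sub>o \<Sigma>\<^sub>m \<eta>' \<epsilon>'" by (rule S.inverse_equivalence)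
  then interpret inv: autoequivalence k T Go Gm \<Sigma>\<^sub>o \<Sigma>\<^sub>m \<eta>' \<epsilon>' .
  show ?thesis using S.counitE[OF compact_obj[OF assms]] inv.preserves_compact[OF assms] that by metis
qed

text \<open>
  A five lemma, carried out on arrows.  Let \<open>a : Z \<rightarrow> P\<close>.  The components of \<open>a \<cdot> g\<close> vanish on \<open>f\<close> and so
  extend over \<open>Z\<close>.  As \<open>Y\<close> is compact, there are finitely many of them, and they sum to some \<open>z\<close> with
  \<open>(a - z) \<cdot> g = 0\<close>.  Hence \<open>a - z\<close> factors through the compact object \<open>\<Sigma>X\<close>.
\<close>

theorem compact_cone:
  assumes "Dist T X Y Z f g h" "compact_object (U :: 'u itself) T X" "compact_object U T Y"
  shows "compact_object U T Z"
proof -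
  note d = dist_mor[OF assms(1)] and d' = dist_mor(1-3)[OF assms(1), unfolded mor_iff]
  have "fin_sum I F P \<iota> Z a"
    if I: "small U I" and P: "is_coproduct T I F P \<iota>" and a: "mor a Z P" for I :: "'u set" and F P \<iota> a
  proof -
    interpret coproduct k T I F P \<iota> by unfold_locales (rule P)
    have a': "arr a" "dom a = Z" "cod a = P" using a by (simp_all add: mor_iff)
    have ag: "mor (a \<cdot> g) Y P" using a' d' by (simp add: mor_iff)
    have "fsum Y (a \<cdot> g)" using assms(3) I P ag by (rule compact_fin_sum)
    then obtain J where J: "finite J" "J \<subseteq> I" "\<forall>J'. J \<subseteq> J' \<longrightarrow> res J' \<cdot> (a \<cdot> g) = a \<cdot> g"
      using d(5) by (rule fsum_eq_res)
    have "\<exists>z. fsum Z z \<and> z \<cdot> g = res J \<cdot> (a \<cdot> g)" using J(1,2)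
    proof induction
      case empty
      have "zer Z P \<cdot> g = res {} \<cdot> (a \<cdot> g)" using d d' a' by simp
      then show ?case using fin_sum.zero by metis
    next
      case (insert i J)
      then obtain z where z: "fsum Z z" "z \<cdot> g = res J \<cdot> (a \<cdot> g)" by auto
      note z' = fsum_arr[OF z(1) d(6)]
      have "mor (proj i \<cdot> (a \<cdot> g)) Y (F i)" using insert d' a' by (simp add: mor_iff)
      moreover have "(proj i \<cdot> (a \<cdot> g)) \<cdot> f = zer X (F i)"
        using insert d d' a' dist_comp_zero[OF assms(1)] by (simp add: assoc)
      ultimately obtain y where y: "mor y Z (F i)" "y \<cdot> g = proj i \<cdot> (a \<cdot> g)"
        using weak_cokernel[OF assms(1)] by metis
      have "(z \<boxplus> \<iota> i \<cdot> y) \<cdot> g = z \<cdot> g \<boxplus> \<iota> i \<cdot> (y \<cdot> g)"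
        using z' d' y(1) insert by (simp add: mor_iff comp_plus assoc)
      also have "\<dots> = res (insert i J) \<cdot> (a \<cdot> g)"
        using z(2) y(2) insert a' d' by (simp add: res_insert comp_plus assoc)
      finally show ?case using fin_sum.plus[OF z(1) _ y(1)] insert by auto
    qed
    then obtain z where z: "fsum Z z" "z \<cdot> g = a \<cdot> g" using J(3) by auto
    note z' = fsum_arr[OF z(1) d(6)]
    have "mor (a \<boxplus> neg z) Z P" using a' z' by (simp add: mor_iff)
    moreover have "(a \<boxplus> neg z) \<cdot> g = zer Y P" using a' z' d' z(2) by (simp add: comp_plus comp_neg)
    ultimately obtain w where w: "mor w (\<Sigma>\<^sub>o X) P" "w \<cdot> h = a \<boxplus> neg z"
      using weak_cokernel[OF rotate[OF assms(1)]] by metis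
    have "fsum (\<Sigma>\<^sub>o X) w" using compact_shift[OF assms(2)] I P w(1) by (rule compact_fin_sum)
    then have "fsum Z (a \<boxplus> neg z)" using fsum_comp d(3) w(2) by metis
    then have "fsum Z ((a \<boxplus> neg z) \<boxplus> z)" using z(1) d(6) by (rule fsum_plus)
    then show ?thesis using a' z' by (simp add: plus_assoc)
  qed
  then show ?thesis unfolding compact_object_iff using d by simp
qed

text \<open>
  \<open>W\<close> is a desuspension of the cone of \<open>f\<close>.
\<close>

theorem compact_cocone:
  assumes "mor f A B" "compact_object (U :: 'u itself) T A" "compact_object U T B"
  obtains W s t where "compact_object U T W" "Dist T W A B s f t"
proof -
  have AB: "A \<in> Obj T" "B \<in> Obj T" "f \<in> arrows T A B" using assms(1) by (simp_all add: mor_def)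
  then obtain Z g h where Z: "Dist T A B Z f g h" using TR1_cone by blast
  note d = dist_mor[OF Z] and d' = dist_mor(1-3)[OF Z, unfolded mor_iff]
  obtain W c c' where W: "compact_object U T W" and c: "mor c Z (\<Sigma>\<^sub>o W)" "mor c' (\<Sigma>\<^sub>o W) Z"
    "c' \<cdot> c = Ident T Z" "c \<cdot> c' = Ident T (\<Sigma>\<^sub>o W)"
    using compact_cone[OF Z assms(2,3)] by (rule compact_desuspension)
  note c' = c(1,2)[unfolded mor_iff]
  have W': "W \<in> Obj T" using W by (rule compact_obj)
  obtain Go Gm \<eta> \<epsilon> where "autoequivalence k T \<Sigma>\<^sub>o \<Sigma>\<^sub>m Go Gm \<eta> \<epsilon>" by (rule shift_autoequivalence)
  then interpret S: autoequivalence k T \<Sigma>\<^sub>o \<Sigma>\<^sub>m Go Gm \<eta> \<epsilon> .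
  have "mor (neg (h \<cdot> c')) (\<Sigma>\<^sub>o W) (\<Sigma>\<^sub>o A)" using c' d' by (simp add: mor_iff)
  then obtain s where s: "mor s W A" "\<Sigma>\<^sub>m s = neg (h \<cdot> c')" using S.full W' AB(1) by metis
  have "Dist T A B (\<Sigma>\<^sub>o W) f (c \<cdot> g) (h \<cdot> c')"
  proof (rule TR1_iso[OF Z])
    show "triangle T A B (\<Sigma>\<^sub>o W) f (c \<cdot> g) (h \<cdot> c')" using c' d' by (simp add: triangle_iff mor_iff)
    show "iso_arrow T A A (Ident T A)" "iso_arrow T B B (Ident T B)"
      using AB iso_arrowI[of "Ident T A" A A "Ident T A"] iso_arrowI[of "Ident T B" B B "Ident T B"]
      by (simp_all add: mor_iff)
    show "iso_arrow T Z (\<Sigma>\<^sub>o W) c" using c by (rule iso_arrowI)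
    show "Ident T B \<cdot> f = f \<cdot> Ident T A" using d' by simp
    show "c \<cdot> g = (c \<cdot> g) \<cdot> Ident T B" using d' c' by simp
    have "(h \<cdot> c') \<cdot> c = h \<cdot> (c' \<cdot> c)" using c' d' by (intro assoc) simp_all
    then show "\<Sigma>\<^sub>m (Ident T A) \<cdot> h = (h \<cdot> c') \<cdot> c" using c(3) d' AB by simp
  qed
  then have "Dist T W A B s f (c \<cdot> g)"
    using rotate_iff[of s W A f B "c \<cdot> g"] s d' c' by (simp add: mor_iff)
  then show ?thesis using W that by blast
qed

end

section \<open>Cohomological functors and their exact subfunctors\<close>

locale cohomological_functor = triangulated_category k T
  for k :: "('k, 'r) ring_scheme"
    and T :: "('k, 'o, 'm, 'z) tricat_scheme"  (structure) +
  fixes U :: "'u itself" and H :: "('k, 'o, 'm, 'u) modfun"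
  assumes cohomological: "cohomological k (compact_part U T) H"
begin

abbreviation cpt :: "'o \<Rightarrow> bool" where "cpt \<equiv> compact_object U T"
abbreviation el :: "'o \<Rightarrow> 'u set" where "el A \<equiv> carrier (FunO H A)"
abbreviation act :: "'m \<Rightarrow> 'u \<Rightarrow> 'u" where "act \<equiv> FunM H"

lemma contravariant_functor: "linear_contravariant_functor k (compact_part U T) H"
  using cohomological unfolding cohomological_def by blast

lemma H_module: "cpt A \<Longrightarrow> module k (FunO H A)"
  using contravariant_functor unfolding linear_contravariant_functor_def compact_part_def by simp

lemma H_group: "cpt A \<Longrightarrow> abelian_group (FunO H A)"
  using H_module module.axioms(2) by blast

lemma H_zero [simp]: "cpt A \<Longrightarrow> \<zero>\<^bsub>FunO H A\<^esub> \<in> el A"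
  by (rule abelian_monoid.zero_closed[OF abelian_group.axioms(1)[OF H_group]])

lemma H_plus [simp]: "cpt A \<Longrightarrow> x \<in> el A \<Longrightarrow> y \<in> el A \<Longrightarrow> x \<oplus>\<^bsub>FunO H A\<^esub> y \<in> el A"
  by (rule abelian_monoid.a_closed[OF abelian_group.axioms(1)[OF H_group]])

lemma act_linear:
  assumes "arr f" "cpt (dom f)" "cpt (cod f)"
  shows "linear_map k (FunO H (cod f)) (FunO H (dom f)) (act f)"
  using contravariant_functor assms arr_in[OF assms(1)]
  unfolding linear_contravariant_functor_def compact_part_def by simp

lemma act_el [simp]:
  "arr f \<Longrightarrow> cpt (dom f) \<Longrightarrow> cod f = B \<Longrightarrow> cpt B \<Longrightarrow> x \<in> el B \<Longrightarrow> dom f = A \<Longrightarrow> act f x \<in> el A"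
  using act_linear[of f] unfolding linear_map_def by auto

lemma act_plus:
  "arr f \<Longrightarrow> cpt (dom f) \<Longrightarrow> cod f = B \<Longrightarrow> cpt B \<Longrightarrow> x \<in> el B \<Longrightarrow> y \<in> el B \<Longrightarrow>
    act f (x \<oplus>\<^bsub>FunO H B\<^esub> y) = act f x \<oplus>\<^bsub>FunO H (dom f)\<^esub> act f y"
  using act_linear[of f] unfolding linear_map_def by auto

lemma act_ident [simp]: "cpt A \<Longrightarrow> x \<in> el A \<Longrightarrow> act (Ident T A) x = x"
  using contravariant_functor unfolding linear_contravariant_functor_def compact_part_def by simp

lemma act_comp:
  assumes "arr f" "arr g" "cod f = dom g" "cpt (dom f)" "cpt (dom g)" "cpt (cod g)" "x \<in> el (cod g)"
  shows "act (g \<cdot> f) x = act f (act g x)"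
proof -
  have "\<forall>A B D. cpt A \<longrightarrow> cpt B \<longrightarrow> cpt D \<longrightarrow> (\<forall>f \<in> arrows T A B. \<forall>g \<in> arrows T B D.
        \<forall>x \<in> el D. act (g \<cdot> f) x = act f (act g x))"
    using contravariant_functor unfolding linear_contravariant_functor_def compact_part_def by simp
  then show ?thesis using assms arr_in[of f] arr_in[of g] by metis
qed

lemma act_plus_arr:
  assumes "arr f" "arr g" "dom f = dom g" "cod f = cod g" "cpt (dom g)" "cpt (cod g)" "x \<in> el (cod g)"
  shows "act (f \<boxplus> g) x = act f x \<oplus>\<^bsub>FunO H (dom g)\<^esub> act g x"
proof -
  have "\<forall>A B. cpt A \<longrightarrow> cpt B \<longrightarrow> (\<forall>f \<in> arrows T A B. \<forall>g \<in> arrows T A B.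
        \<forall>x \<in> el B. act (f \<oplus>\<^bsub>Hom T A B\<^esub> g) x = act f x \<oplus>\<^bsub>FunO H A\<^esub> act g x)"
    using contravariant_functor unfolding linear_contravariant_functor_def compact_part_def by simp
  then show ?thesis using assms arr_in[of f] arr_in[of g] unfolding plus_arr_def by simp
qed

lemma act_smult_arr:
  assumes "a \<in> carrier k" "arr f" "dom f = A" "cod f = B" "cpt A" "cpt B" "x \<in> el B"
  shows "act (a \<odot>\<^bsub>Hom T A B\<^esub> f) x = a \<odot>\<^bsub>FunO H A\<^esub> act f x"
  using contravariant_functor assms arr_in[of f]
  unfolding linear_contravariant_functor_def compact_part_def by simp

lemma H_idem_zero:
  assumes "cpt A" "x \<in> el A" "x \<oplus>\<^bsub>FunO H A\<^esub> x = x"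
  shows "x = \<zero>\<^bsub>FunO H A\<^esub>"
  using abelian_group.r_neg[OF H_group] abelian_group.r_neg1[OF H_group] abelian_group.l_neg[OF H_group] assms
  by metis

lemma act_zero [simp]:
  "arr f \<Longrightarrow> cpt (dom f) \<Longrightarrow> cod f = B \<Longrightarrow> cpt B \<Longrightarrow> act f (\<zero>\<^bsub>FunO H B\<^esub>) = \<zero>\<^bsub>FunO H (dom f)\<^esub>"
  using act_plus[of f B "\<zero>\<^bsub>FunO H B\<^esub>" "\<zero>\<^bsub>FunO H B\<^esub>"] H_idem_zero[of "dom f" "act f (\<zero>\<^bsub>FunO H B\<^esub>)"]
    abelian_monoid.l_zero[OF abelian_group.axioms(1)[OF H_group]] by simp

lemma act_zero_arr [simp]:
  "cpt A \<Longrightarrow> cpt B \<Longrightarrow> x \<in> el B \<Longrightarrow> act (zer A B) x = \<zero>\<^bsub>FunO H A\<^esub>"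
  using act_plus_arr[of "zer A B" "zer A B" x] H_idem_zero[of A "act (zer A B) x"]
  by (simp add: compact_obj)

lemma act_neg_arr:
  assumes "arr f" "cpt (dom f)" "cpt (cod f)" "x \<in> el (cod f)"
  shows "act f x \<oplus>\<^bsub>FunO H (dom f)\<^esub> act (neg f) x = \<zero>\<^bsub>FunO H (dom f)\<^esub>"
  using act_plus_arr[of f "neg f" x] assms by simp

lemma H_exact:
  assumes "Dist T X Y Z f g h" "cpt X" "cpt Y" "cpt Z" "y \<in> el Y" "act f y = \<zero>\<^bsub>FunO H X\<^esub>"
  obtains z where "z \<in> el Z" "act g z = y"
proof -
  have "\<forall>X \<in> Obj (compact_part U T). \<forall>Y \<in> Obj (compact_part U T). \<forall>Z \<in> Obj (compact_part U T). \<forall>f g h.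
      Dist (compact_part U T) X Y Z f g h \<longrightarrow>
        FunM H g ` el Z = {y \<in> el Y. FunM H f y = \<zero>\<^bsub>FunO H X\<^esub>}"
    using cohomological unfolding cohomological_def by blast
  from this[rule_format, of X Y Z f g h] assms(1-4)
  have "FunM H g ` el Z = {y \<in> el Y. FunM H f y = \<zero>\<^bsub>FunO H X\<^esub>}"
    by (simp add: compact_part_def)
  then have "y \<in> FunM H g ` el Z" using assms(5,6) by simp
  then show ?thesis using that by (elim imageE) simp
qed

definition elements :: "('o \<times> 'u) set" where
  "elements = {(A, x). cpt A \<and> x \<in> el A}"

lemma elementsD: "S \<subseteq> elements \<Longrightarrow> (A, x) \<in> S \<Longrightarrow> cpt A \<and> x \<in> el A"
  unfolding elements_def by blast

text \<open>
  The subfunctor of \<open>H\<close> generated by a set of elements.  Negatives and scalar multiples of \<open>act f x\<close> are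
  again of this form, so sums suffice.
\<close>

inductive_set gen :: "('o \<times> 'u) set \<Rightarrow> 'o \<Rightarrow> 'u set" for S A where
  zero: "\<zero>\<^bsub>FunO H A\<^esub> \<in> gen S A"
| plus: "\<lbrakk>y \<in> gen S A; (D, x) \<in> S; mor f A D\<rbrakk> \<Longrightarrow> y \<oplus>\<^bsub>FunO H A\<^esub> act f x \<in> gen S A"

lemma gen_el:
  assumes "S \<subseteq> elements" "cpt A" "y \<in> gen S A"
  shows "y \<in> el A"
  using assms(3)
proof induction
  case zero
  show ?case using assms by simp
next
  case (plus y D x f)
  then show ?case using assms elementsD[OF assms(1) plus.hyps(2)] by (simp add: mor_iff)
qed

lemma gen_mono: "S \<subseteq> S' \<Longrightarrow> y \<in> gen S A \<Longrightarrow> y \<in> gen S' A"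
  by (rotate_tac, induction rule: gen.induct) (auto intro: gen.intros)

lemma gen_plus:
  assumes "S \<subseteq> elements" "cpt A" "y \<in> gen S A" "y' \<in> gen S A"
  shows "y \<oplus>\<^bsub>FunO H A\<^esub> y' \<in> gen S A"
  using assms(4)
proof induction
  interpret abelian_group "FunO H A" by (rule H_group[OF assms(2)])
  case zero
  show ?case using assms(3) gen_el[OF assms(1-3)] by simp
next
  interpret abelian_group "FunO H A" by (rule H_group[OF assms(2)])
  case (plus y' D x f)
  have "act f x \<in> el A" using plus assms elementsD[OF assms(1) plus.hyps(2)] by (simp add: mor_iff)
  then have "y \<oplus>\<^bsub>FunO H A\<^esub> (y' \<oplus>\<^bsub>FunO H A\<^esub> act f x) = (y \<oplus>\<^bsub>FunO H A\<^esub> y') \<oplus>\<^bsub>FunO H A\<^esub> act f x"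
    using gen_el[OF assms(1-3)] gen_el[OF assms(1,2) plus.hyps(1)] by (simp add: a_assoc)
  then show ?case using plus by (simp add: gen.plus)
qed

lemma gen_single:
  assumes "S \<subseteq> elements" "cpt A" "(D, x) \<in> S" "mor f A D"
  shows "act f x \<in> gen S A"
proof -
  interpret abelian_group "FunO H A" by (rule H_group[OF assms(2)])
  have "act f x \<in> el A" using assms elementsD[OF assms(1,3)] by (simp add: mor_iff)
  then show ?thesis using gen.plus[OF gen.zero assms(3,4)] by simp
qed

lemma gen_act:
  assumes "S \<subseteq> elements" "cpt A" "cpt B" "y \<in> gen S A" "mor h B A"
  shows "act h y \<in> gen S B"
  using assms(4)
proof induction
  case zero
  show ?case using assms gen.zero[of B S] by (auto simp: mor_iff)
next
  case (plus y D x f)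
  have D: "cpt D" "x \<in> el D" using elementsD[OF assms(1) plus.hyps(2)] by auto
  have "act h (y \<oplus>\<^bsub>FunO H A\<^esub> act f x) = act h y \<oplus>\<^bsub>FunO H B\<^esub> act (f \<cdot> h) x"
    using act_plus[of h A y "act f x"] act_comp[of h f x] plus assms D gen_el[OF assms(1,2) plus.hyps(1)]
    by (simp add: mor_iff)
  moreover have "mor (f \<cdot> h) B D" using plus assms(5) by (simp add: mor_iff)
  ultimately show ?case using plus gen.plus by metis
qed

lemma gen_neg:
  assumes "S \<subseteq> elements" "cpt A" "y \<in> gen S A"
  obtains y' where "y' \<in> gen S A" "y \<oplus>\<^bsub>FunO H A\<^esub> y' = \<zero>\<^bsub>FunO H A\<^esub>"
  using act_neg_arr[of "Ident T A" y] gen_act[OF assms(1,2,2,3), of "neg (Ident T A)"]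
    gen_el[OF assms] assms(2) that compact_obj[of U A]
  by (simp add: mor_iff)

text \<open>
  Membership in a generated subfunctor involves finitely many generators.
\<close>

lemma gen_chain:
  assumes "y \<in> gen (\<Union>j \<in> J. S j) A" "\<And>i j. i \<in> J \<Longrightarrow> j \<in> J \<Longrightarrow> S i \<subseteq> S j \<or> S j \<subseteq> S i"
  shows "y = \<zero>\<^bsub>FunO H A\<^esub> \<or> (\<exists>j \<in> J. y \<in> gen (S j) A)"
  using assms(1)
proof induction
  case (plus y D x f)
  from plus.hyps obtain i where i: "i \<in> J" "(D, x) \<in> S i" by blast
  from plus.IH show ?case
  proof
    assume "y = \<zero>\<^bsub>FunO H A\<^esub>"
    then show ?thesis using gen.plus[OF gen.zero i(2) plus.hyps(3)] i(1) by blast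
  next
    assume "\<exists>j \<in> J. y \<in> gen (S j) A"
    then obtain j where j: "j \<in> J" "y \<in> gen (S j) A" by blast
    obtain l where l: "l \<in> J" "S i \<subseteq> S l" "S j \<subseteq> S l" using assms(2)[OF i(1) j(1)] i(1) j(1) by blast
    then have "(D, x) \<in> S l" "y \<in> gen (S l) A" using i(2) gen_mono[OF l(3) j(2)] by auto
    then show ?thesis using gen.plus plus.hyps(3) l(1) by metis
  qed
qed simp

text \<open>
  The subfunctor generated by \<open>S\<close> is itself cohomological.  By the long exact sequence, the
  quotient of \<open>H\<close> by it is then cohomological too; this enters through \<open>kill_arrow\<close>, where no
  quotient has to be formed.
\<close>

definition exact :: "('o \<times> 'u) set \<Rightarrow> bool" where
  "exact S \<longleftrightarrow> S \<subseteq> elements \<and> (\<forall>X Y Z f g h. \<forall>y \<in> gen S Y.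
     Dist T X Y Z f g h \<longrightarrow> cpt X \<longrightarrow> cpt Y \<longrightarrow> cpt Z \<longrightarrow> act f y = \<zero>\<^bsub>FunO H X\<^esub> \<longrightarrow>
     (\<exists>z \<in> gen S Z. act g z = y))"

lemma exactD:
  assumes "exact S" "y \<in> gen S Y" "Dist T X Y Z f g h" "cpt X" "cpt Y" "cpt Z" "act f y = \<zero>\<^bsub>FunO H X\<^esub>"
  obtains z where "z \<in> gen S Z" "act g z = y"
  using assms unfolding exact_def by blast

lemma exact_chain:
  assumes "\<And>j. j \<in> J \<Longrightarrow> exact (S j)" "\<And>i j. i \<in> J \<Longrightarrow> j \<in> J \<Longrightarrow> S i \<subseteq> S j \<or> S j \<subseteq> S i"
  shows "exact (\<Union>j \<in> J. S j)"
proof -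
  have "\<exists>z \<in> gen (\<Union>j \<in> J. S j) Z. act g z = y"
    if y: "y \<in> gen (\<Union>j \<in> J. S j) Y" and d: "Dist T X Y Z f g h" and c: "cpt X" "cpt Y" "cpt Z"
      and f: "act f y = \<zero>\<^bsub>FunO H X\<^esub>" for X Y Z f g h y
    using gen_chain[OF y assms(2)]
  proof
    assume "y = \<zero>\<^bsub>FunO H Y\<^esub>"
    then have "act g (\<zero>\<^bsub>FunO H Z\<^esub>) = y" using dist_mor[OF d] c by (simp add: mor_iff)
    then show ?thesis using gen.zero by blast
  next
    assume "\<exists>j \<in> J. y \<in> gen (S j) Y"
    then obtain j where j: "j \<in> J" "y \<in> gen (S j) Y" by blast
    obtain z where z: "z \<in> gen (S j) Z" "act g z = y" using assms(1)[OF j(1)] j(2) d c f by (rule exactD)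
    have "S j \<subseteq> (\<Union>j \<in> J. S j)" using j(1) by blast
    then show ?thesis using gen_mono z by blast
  qed
  moreover have "(\<Union>j \<in> J. S j) \<subseteq> elements" using assms(1) unfolding exact_def by blast
  ultimately show ?thesis unfolding exact_def by blast
qed

text \<open>
  Congruence modulo the subfunctor generated by \<open>S\<close>.
\<close>

definition cong :: "('o \<times> 'u) set \<Rightarrow> 'o \<Rightarrow> 'u \<Rightarrow> 'u \<Rightarrow> bool" where
  "cong S A x y \<longleftrightarrow> y \<in> el A \<and> (\<exists>m \<in> gen S A. x = m \<oplus>\<^bsub>FunO H A\<^esub> y)"

lemma cong_refl:
  assumes "cpt A" "y \<in> el A"
  shows "cong S A y y"
  using assms abelian_monoid.l_zero[OF abelian_group.axioms(1)[OF H_group]] gen.zero unfolding cong_def by metis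

lemma cong_trans:
  assumes "S \<subseteq> elements" "cpt A" "cong S A x y" "cong S A y z"
  shows "cong S A x z"
proof -
  interpret abelian_group "FunO H A" by (rule H_group[OF assms(2)])
  obtain m n where mn: "m \<in> gen S A" "n \<in> gen S A" "x = m \<oplus>\<^bsub>FunO H A\<^esub> (n \<oplus>\<^bsub>FunO H A\<^esub> z)" "z \<in> el A"
    using assms unfolding cong_def by blast
  then have "x = (m \<oplus>\<^bsub>FunO H A\<^esub> n) \<oplus>\<^bsub>FunO H A\<^esub> z" using gen_el[OF assms(1,2)] by (simp add: a_assoc)
  then show ?thesis using gen_plus[OF assms(1,2) mn(1,2)] mn(4) unfolding cong_def by blast
qed

lemma cong_plus:
  assumes "S \<subseteq> elements" "cpt A" "cong S A x y" "cong S A x' y'"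
  shows "cong S A (x \<oplus>\<^bsub>FunO H A\<^esub> x') (y \<oplus>\<^bsub>FunO H A\<^esub> y')"
proof -
  interpret abelian_group "FunO H A" by (rule H_group[OF assms(2)])
  obtain m n where mn: "m \<in> gen S A" "n \<in> gen S A" "x = m \<oplus>\<^bsub>FunO H A\<^esub> y" "y \<in> el A"
      "x' = n \<oplus>\<^bsub>FunO H A\<^esub> y'" "y' \<in> el A"
    using assms unfolding cong_def by blast
  then have "x \<oplus>\<^bsub>FunO H A\<^esub> x' = (m \<oplus>\<^bsub>FunO H A\<^esub> n) \<oplus>\<^bsub>FunO H A\<^esub> (y \<oplus>\<^bsub>FunO H A\<^esub> y')"
    using gen_el[OF assms(1,2)] by (simp add: a_ac)
  then show ?thesis using gen_plus[OF assms(1,2) mn(1,2)] mn(4,6) unfolding cong_def by blast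
qed

lemma cong_act:
  assumes "S \<subseteq> elements" "cpt A" "cpt B" "cong S A x y" "mor h B A"
  shows "cong S B (act h x) (act h y)"
proof -
  obtain m where m: "m \<in> gen S A" "x = m \<oplus>\<^bsub>FunO H A\<^esub> y" "y \<in> el A"
    using assms unfolding cong_def by blast
  then have "act h x = act h m \<oplus>\<^bsub>FunO H B\<^esub> act h y"
    using act_plus[of h A m y] gen_el[OF assms(1,2)] assms by (simp add: mor_iff)
  moreover have "act h y \<in> el B" using m assms by (auto simp: mor_iff)
  ultimately show ?thesis using gen_act[OF assms(1-3) m(1) assms(5)] unfolding cong_def by blast
qed

lemma cong_gen:
  assumes "S \<subseteq> elements" "cpt A" "cong S A x y" "x \<in> gen S A"
  shows "y \<in> gen S A"
proof -
  interpret abelian_group "FunO H A" by (rule H_group[OF assms(2)])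
  obtain m where m: "m \<in> gen S A" "x = m \<oplus>\<^bsub>FunO H A\<^esub> y" "y \<in> el A"
    using assms unfolding cong_def by blast
  obtain n where n: "n \<in> gen S A" "m \<oplus>\<^bsub>FunO H A\<^esub> n = \<zero>\<^bsub>FunO H A\<^esub>" using assms(1,2) m(1) by (rule gen_neg)
  have "x \<oplus>\<^bsub>FunO H A\<^esub> n = (m \<oplus>\<^bsub>FunO H A\<^esub> n) \<oplus>\<^bsub>FunO H A\<^esub> y"
    using m n(1) gen_el[OF assms(1,2)] by (simp add: a_ac)
  then have "x \<oplus>\<^bsub>FunO H A\<^esub> n = y" using m n(2) by simp
  then show ?thesis using gen_plus[OF assms(1,2,4) n(1)] by simp
qed


end


section \<open>Towers that enlarge an exact subfunctor\<close>

text \<open>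
  Entry \<open>n\<close> of a tower consists of an object \<open>C\<^sub>n\<close>, an element of \<open>H C\<^sub>n\<close> and an arrow \<open>C\<^sub>n \<rightarrow> C\<^sub>n\<^sub>+\<^sub>1\<close>.
\<close>

type_synonym ('o, 'u, 'm) tower = "nat \<Rightarrow> 'o \<times> 'u \<times> 'm"

definition stage :: "('o, 'u, 'm) tower \<Rightarrow> nat \<Rightarrow> 'o" where "stage b n = fst (b n)"
definition point :: "('o, 'u, 'm) tower \<Rightarrow> nat \<Rightarrow> 'u" where "point b n = fst (snd (b n))"
definition step :: "('o, 'u, 'm) tower \<Rightarrow> nat \<Rightarrow> 'm" where "step b n = snd (snd (b n))"

definition points :: "('o, 'u, 'm) tower \<Rightarrow> ('o \<times> 'u) set" where
  "points b = range (\<lambda>n. (stage b n, point b n))"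

context cohomological_functor
begin

text \<open>
  In the quotient of \<open>H\<close> by \<open>S\<close> the element \<open>x\<close> vanishes on \<open>f\<close>, so it extends to the cone of \<open>f\<close>.  To
  see this inside \<open>H\<close>, let \<open>s : W \<rightarrow> D\<close> be the cocone of \<open>f\<close>.  As \<open>act f x\<close> is generated by \<open>S\<close> and
  vanishes on \<open>s\<close>, exactness of \<open>S\<close> gives \<open>m\<close> generated by \<open>S\<close> with \<open>act f m = act f x\<close>.  Then \<open>x - m\<close>
  vanishes on \<open>f\<close> and extends to the cone by exactness of \<open>H\<close>.
\<close>

lemma kill_arrow:
  assumes "exact S" "cpt A" "x \<in> el A" "mor f D A" "cpt D" "act f x \<in> gen S D"
  obtains A' x' t where "cpt A'" "x' \<in> el A'" "mor t A A'" "t \<cdot> f = zer D A'" "cong S A x (act t x')"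
proof -
  have S: "S \<subseteq> elements" using assms(1) unfolding exact_def by blast
  interpret HA: abelian_group "FunO H A" by (rule H_group[OF assms(2)])
  interpret HD: abelian_group "FunO H D" by (rule H_group[OF assms(5)])
  obtain W s t where W: "cpt W" "Dist T W D A s f t" using assms(4,5,2) by (rule compact_cocone)
  note s = dist_mor[OF W(2)]
  have "act s (act f x) = \<zero>\<^bsub>FunO H W\<^esub>"
    using act_comp[of s f x] dist_comp_zero[OF W(2)] s assms W by (simp add: mor_iff)
  then obtain m where m: "m \<in> gen S A" "act f m = act f x"
    using exactD[OF assms(1,6) W(2,1) assms(5,2)] by blast
  obtain n where n: "n \<in> gen S A" "m \<oplus>\<^bsub>FunO H A\<^esub> n = \<zero>\<^bsub>FunO H A\<^esub>" using S assms(2) m(1) by (rule gen_neg)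
  note mn = gen_el[OF S assms(2) m(1)] gen_el[OF S assms(2) n(1)]
  have f: "arr f" "dom f = D" "cod f = A" "D \<in> Obj T" "A \<in> Obj T" "f \<in> arrows T D A"
    using assms(4) by (simp_all add: mor_iff mor_obj[OF assms(4)] arr_in mor_def[of f D A] arrow_iff)
  have "act f (x \<oplus>\<^bsub>FunO H A\<^esub> n) = act f (m \<oplus>\<^bsub>FunO H A\<^esub> n)"
    using f assms m mn by (simp add: act_plus)
  then have z: "act f (x \<oplus>\<^bsub>FunO H A\<^esub> n) = \<zero>\<^bsub>FunO H D\<^esub>" using n f assms by simp
  obtain A' g h where A': "Dist T D A A' f g h" using TR1_cone f by blast
  note g = dist_mor[OF A'] dist_comp_zero[OF A']
  have cA': "cpt A'" using A' assms(5,2) by (rule compact_cone)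
  have "x \<oplus>\<^bsub>FunO H A\<^esub> n \<in> el A" using assms(3) mn by simp
  then obtain x' where x': "x' \<in> el A'" "act g x' = x \<oplus>\<^bsub>FunO H A\<^esub> n"
    using H_exact[OF A' assms(5,2) cA' _ z] by blast
  have "m \<oplus>\<^bsub>FunO H A\<^esub> (x \<oplus>\<^bsub>FunO H A\<^esub> n) = (m \<oplus>\<^bsub>FunO H A\<^esub> n) \<oplus>\<^bsub>FunO H A\<^esub> x"
    using assms(3) mn by (simp add: HA.a_ac)
  then have "x = m \<oplus>\<^bsub>FunO H A\<^esub> act g x'" using assms(3) n(2) x'(2) by simp
  then have "cong S A x (act g x')" unfolding cong_def using m(1) x' assms(3) mn by auto
  then show ?thesis using that cA' x'(1) g by blast
qed

primrec transition :: "('o, 'u, 'm) tower \<Rightarrow> nat \<Rightarrow> nat \<Rightarrow> 'm" where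
  "transition b n 0 = Ident T (stage b n)"
| "transition b n (Suc m) = step b (n + m) \<cdot> transition b n m"

text \<open>
  The points of the tower define a natural transformation from the colimit of the functors
  \<open>T(-, stage b n)\<close> to the quotient of \<open>H\<close> by \<open>S\<close>.
\<close>

definition coherent :: "('o \<times> 'u) set \<Rightarrow> ('o, 'u, 'm) tower \<Rightarrow> bool" where
  "coherent S b \<longleftrightarrow> (\<forall>n. cpt (stage b n) \<and> point b n \<in> el (stage b n) \<and>
     mor (step b n) (stage b n) (stage b (Suc n)) \<and>
     cong S (stage b n) (point b n) (act (step b n) (point b (Suc n))))"

text \<open>
  Coherence together with the injectivity of the transformation just described.
\<close>

definition block :: "('o \<times> 'u) set \<Rightarrow> ('o, 'u, 'm) tower \<Rightarrow> bool" where
  "block S b \<longleftrightarrow> coherent S b \<and> (\<forall>n D f. cpt D \<longrightarrow> mor f D (stage b n) \<longrightarrow>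
     act f (point b n) \<in> gen S D \<longrightarrow> (\<exists>m. transition b n m \<cdot> f = zer D (stage b (n + m))))"

lemma coherentD:
  assumes "coherent S b"
  shows "cpt (stage b n)" "point b n \<in> el (stage b n)"
    "arr (step b n)" "dom (step b n) = stage b n" "cod (step b n) = stage b (Suc n)"
    "cong S (stage b n) (point b n) (act (step b n) (point b (Suc n)))"
    "stage b n \<in> Obj T"
  using assms compact_obj unfolding coherent_def mor_iff by auto

lemma blockD:
  "block S b \<Longrightarrow> cpt D \<Longrightarrow> mor f D (stage b n) \<Longrightarrow> act f (point b n) \<in> gen S D \<Longrightarrow>
    \<exists>m. transition b n m \<cdot> f = zer D (stage b (n + m))"
  unfolding block_def by blast

lemma transition_mor:
  assumes "coherent S b"
  shows "arr (transition b n m)" "dom (transition b n m) = stage b n" "cod (transition b n m) = stage b (n + m)"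
proof (induction m)
  case 0
  { case 1 show ?case using coherentD[OF assms] by simp }
  { case 2 show ?case using coherentD[OF assms] by simp }
  { case 3 show ?case using coherentD[OF assms] by simp }
next
  case (Suc m)
  { case 1 show ?case using Suc coherentD[OF assms] by simp }
  { case 2 show ?case using Suc coherentD[OF assms] by simp }
  { case 3 show ?case using Suc coherentD[OF assms] by simp }
qed

lemma transition_cong:
  assumes "S \<subseteq> elements" "coherent S b"
  shows "cong S (stage b n) (point b n) (act (transition b n m) (point b (n + m)))"
proof (induction m)
  case 0
  show ?case using coherentD[OF assms(2)] by (simp add: cong_refl)
next
  case (Suc m)
  note d = coherentD[OF assms(2)] and t = transition_mor[OF assms(2)]
  have "cong S (stage b n) (act (transition b n m) (point b (n + m)))
      (act (transition b n m) (act (step b (n + m)) (point b (Suc (n + m)))))"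
    using cong_act[OF assms(1) d(1,1,6)] t by (simp add: mor_iff)
  moreover have "act (transition b n m) (act (step b (n + m)) (point b (Suc (n + m)))) =
      act (transition b n (Suc m)) (point b (n + Suc m))"
    using d t by (simp add: act_comp)
  ultimately show ?case using cong_trans[OF assms(1) d(1) Suc] by simp
qed

lemma cong_push:
  assumes "S \<subseteq> elements" "coherent S b" "cpt A" "mor g A (stage b n)"
  shows "cong S A (act g (point b n)) (act (transition b n m \<cdot> g) (point b (n + m)))"
  using cong_act[OF assms(1) coherentD(1)[OF assms(2)] assms(3) transition_cong[OF assms(1,2)] assms(4)]
    coherentD[OF assms(2)] transition_mor[OF assms(2)] assms(3,4)
  by (simp add: act_comp mor_iff)

text \<open>
  Elements that come from different stages can be moved to a common later stage, so that modulo \<open>S\<close> one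
  stage suffices.
\<close>

lemma gen_block:
  assumes "S \<subseteq> elements" "coherent S b" "cpt A" "y \<in> gen (S \<union> points b) A"
  shows "\<exists>n g. mor g A (stage b n) \<and> cong S A y (act g (point b n))"
  using assms(4)
proof induction
  note d = coherentD[OF assms(2)]
  case zero
  have "mor (zer A (stage b 0)) A (stage b 0)" using d assms(3) by (simp add: mor_iff compact_obj)
  moreover have "cong S A (\<zero>\<^bsub>FunO H A\<^esub>) (act (zer A (stage b 0)) (point b 0))"
    using d assms(3) by (simp add: cong_refl)
  ultimately show ?case by blast
next
  note d = coherentD[OF assms(2)] and t = transition_mor[OF assms(2)]
  interpret HA: abelian_group "FunO H A" by (rule H_group[OF assms(3)])
  case (plus y D x f)
  then obtain n g where g: "mor g A (stage b n)" "cong S A y (act g (point b n))" by blast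
  note g' = g(1)[unfolded mor_iff]
  consider "(D, x) \<in> S" | j where "D = stage b j" "x = point b j"
    using plus.hyps(2) unfolding points_def by blast
  then show ?case
  proof cases
    case 1
    have fx: "act f x \<in> gen S A" using assms(1,3) 1 plus.hyps(3) by (rule gen_single)
    have "cong S A (act f x) (\<zero>\<^bsub>FunO H A\<^esub>)"
      unfolding cong_def using fx gen_el[OF assms(1,3) fx] assms(3) by (auto intro!: bexI[of _ "act f x"])
    then have "cong S A (y \<oplus>\<^bsub>FunO H A\<^esub> act f x) (act g (point b n) \<oplus>\<^bsub>FunO H A\<^esub> \<zero>\<^bsub>FunO H A\<^esub>)"
      using cong_plus[OF assms(1,3) g(2)] by blast
    moreover have "act g (point b n) \<in> el A" using g' d assms(3) by auto
    ultimately show ?thesis using g(1) by auto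
  next
    case 2
    have f: "mor f A (stage b j)" using plus.hyps 2 by simp
    note f' = f[unfolded mor_iff]
    let ?u = "transition b n j \<cdot> g" and ?v = "transition b j n \<cdot> f"
    have u: "arr ?u" "dom ?u = A" "cod ?u = stage b (n + j)" using g' t by auto
    have v: "arr ?v" "dom ?v = A" "cod ?v = stage b (n + j)" using f' t by (auto simp: add.commute)
    have "cong S A y (act ?u (point b (n + j)))"
      using cong_trans[OF assms(1,3) g(2) cong_push[OF assms(1-3) g(1)]] .
    moreover have "cong S A (act f x) (act ?v (point b (n + j)))"
      using cong_push[OF assms(1-3) f, of n] 2 by (simp add: add.commute)
    ultimately have "cong S A (y \<oplus>\<^bsub>FunO H A\<^esub> act f x)
        (act ?u (point b (n + j)) \<oplus>\<^bsub>FunO H A\<^esub> act ?v (point b (n + j)))"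
      by (rule cong_plus[OF assms(1,3)])
    then have "cong S A (y \<oplus>\<^bsub>FunO H A\<^esub> act f x) (act (?u \<boxplus> ?v) (point b (n + j)))"
      using act_plus_arr[of ?u ?v "point b (n + j)"] u v d assms(3) by simp
    moreover have "mor (?u \<boxplus> ?v) A (stage b (n + j))" using u v by (simp add: mor_iff)
    ultimately show ?thesis by blast
  qed
qed

lemma points_elements: "coherent S b \<Longrightarrow> points b \<subseteq> elements"
  using coherentD unfolding points_def elements_def by auto

text \<open>
  Modulo \<open>S\<close> the enlarged subfunctor is a sequential colimit of representable functors, and those are
  exact.  Concretely, an element \<open>y\<close> vanishing on \<open>f\<close> is \<open>act a (point b n)\<close> modulo \<open>S\<close>, with
  \<open>a \<cdot> f = 0\<close> after moving up the tower, by injectivity.  So \<open>a\<close> factors through \<open>g\<close>, and the part of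
  \<open>y\<close> generated by \<open>S\<close> lifts along \<open>g\<close> because \<open>S\<close> is exact.
\<close>

lemma exact_block:
  assumes "exact S" "block S b"
  shows "exact (S \<union> points b)"
proof -
  have S: "S \<subseteq> elements" using assms(1) unfolding exact_def by blast
  have b: "coherent S b" using assms(2) unfolding block_def by blast
  note d = coherentD[OF b] and t = transition_mor[OF b]
  have SB: "S \<union> points b \<subseteq> elements" using S points_elements[OF b] by blast
  have "\<exists>z \<in> gen (S \<union> points b) Z. act g z = y"
    if y: "y \<in> gen (S \<union> points b) Y" and di: "Dist T X Y Z f g h" and c: "cpt X" "cpt Y" "cpt Z"
      and f: "act f y = \<zero>\<^bsub>FunO H X\<^esub>" for X Y Z f g h y
  proof -
    note fg = dist_mor[OF di] and fg' = dist_mor(1-2)[OF di, unfolded mor_iff]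
    interpret HX: abelian_group "FunO H X" by (rule H_group[OF c(1)])
    interpret HY: abelian_group "FunO H Y" by (rule H_group[OF c(2)])
    obtain n a where a: "mor a Y (stage b n)" "cong S Y y (act a (point b n))"
      using gen_block[OF S b c(2) y] by blast
    note a' = a(1)[unfolded mor_iff]
    have "cong S X (act f y) (act f (act a (point b n)))" using S c(2,1) a(2) fg(1) by (rule cong_act)
    then have "act f (act a (point b n)) \<in> gen S X" using cong_gen[OF S c(1)] f gen.zero[of X S] by metis
    then have "act (a \<cdot> f) (point b n) \<in> gen S X" using act_comp[of f a "point b n"] a' fg' c d by simp
    moreover have "mor (a \<cdot> f) X (stage b n)" using a' fg' by (simp add: mor_iff)
    ultimately obtain m where m: "transition b n m \<cdot> (a \<cdot> f) = zer X (stage b (n + m))"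
      using assms(2) c(1) unfolding block_def by blast
    define a2 where "a2 = transition b n m \<cdot> a"
    have a2: "mor a2 Y (stage b (n + m))" unfolding a2_def using t a' by (simp add: mor_iff)
    note a2' = a2[unfolded mor_iff]
    have "a2 \<cdot> f = zer X (stage b (n + m))" unfolding a2_def using m t a' fg' by (simp add: assoc)
    then obtain w where w: "mor w Z (stage b (n + m))" "w \<cdot> g = a2" using weak_cokernel[OF di a2] by blast
    have "cong S Y y (act a2 (point b (n + m)))"
      unfolding a2_def using cong_trans[OF S c(2) a(2) cong_push[OF S b c(2) a(1)]] .
    then obtain u where u: "u \<in> gen S Y" "y = u \<oplus>\<^bsub>FunO H Y\<^esub> act a2 (point b (n + m))" 
      unfolding cong_def by blast
    note u' = gen_el[OF S c(2) u(1)]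
    have a2p: "act a2 (point b (n + m)) \<in> el Y" using a2' d c(2) by auto
    have "act f (act a2 (point b (n + m))) = \<zero>\<^bsub>FunO H X\<^esub>"
      using act_comp[of f a2 "point b (n + m)"] \<open>a2 \<cdot> f = _\<close> a2' fg' c d by simp
    then have "act f u = \<zero>\<^bsub>FunO H X\<^esub>"
      using f act_plus[of f Y u "act a2 (point b (n + m))"] u u' a2p fg' c by simp
    then obtain v where v: "v \<in> gen S Z" "act g v = u" using exactD[OF assms(1) u(1) di c] by blast
    have v2: "v \<in> gen (S \<union> points b) Z" using v(1) gen_mono[of S] by blast
    have "(stage b (n + m), point b (n + m)) \<in> S \<union> points b" unfolding points_def by blast
    then have "v \<oplus>\<^bsub>FunO H Z\<^esub> act w (point b (n + m)) \<in> gen (S \<union> points b) Z"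
      using gen.plus[OF v2 _ w(1)] by blast
    moreover have "act g (v \<oplus>\<^bsub>FunO H Z\<^esub> act w (point b (n + m))) = y"
      using act_plus[of g Z v "act w (point b (n + m))"] act_comp[of g w "point b (n + m)"] v
        gen_el[OF S c(3) v(1)] u(2) w fg' c d by (simp add: mor_iff)
    ultimately show ?thesis by blast
  qed
  then show ?thesis unfolding exact_def using SB by blast
qed

end

section \<open>Towers from a countable skeleton\<close>

locale countable_cohomological_functor = cohomological_functor k T U H
  for k :: "('k, 'r) ring_scheme"
    and T :: "('k, 'o, 'm, 'z) tricat_scheme"  (structure)
    and U :: "'u itself" and H :: "('k, 'o, 'm, 'u) modfun" +
  fixes K :: "'o set"
  assumes skeleton: "skeleton (compact_part U T) K"
    and countable_arrows: "countable (\<Union>A \<in> K. \<Union>B \<in> K. arrows T A B)"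
begin

lemma skeleton_compact: "A \<in> K \<Longrightarrow> cpt A"
  using skeleton unfolding skeleton_def compact_part_def by auto

lemma skeleton_iso:
  assumes "cpt A"
  obtains B c c' where "B \<in> K" "mor c A B" "mor c' B A" "c' \<cdot> c = Ident T A" "c \<cdot> c' = Ident T B"
proof -
  have "\<exists>B. B \<in> K \<and> isomorphic_objects (compact_part U T) A B"
    using skeleton assms unfolding skeleton_def compact_part_def by auto
  then obtain B c where B: "B \<in> K" "iso_arrow T A B c"
    unfolding isomorphic_objects_def iso_arrow_def compact_part_def by auto
  show ?thesis using B(2) compact_obj[OF assms] compact_obj[OF skeleton_compact[OF B(1)]]
    by (rule iso_arrowE) (rule that[OF B(1)])
qed

text \<open>
  Staying inside the skeleton keeps the number of arrows into the stages of a tower countable.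
\<close>

lemma kill_arrow_in_skeleton:
  assumes "exact S" "A \<in> K" "x \<in> el A" "D \<in> K" "mor f D A" "act f x \<in> gen S D"
  obtains A' x' t where "A' \<in> K" "x' \<in> el A'" "mor t A A'" "t \<cdot> f = zer D A'" "cong S A x (act t x')"
proof -
  note A = skeleton_compact[OF assms(2)] and D = skeleton_compact[OF assms(4)]
  obtain B y t where B: "cpt B" "y \<in> el B" "mor t A B" "t \<cdot> f = zer D B" "cong S A x (act t y)"
    using assms(1) A assms(3,5) D assms(6) by (rule kill_arrow)
  obtain A' c c' where A': "A' \<in> K" "mor c B A'" "mor c' A' B" "c' \<cdot> c = Ident T B" 
    using B(1) by (rule skeleton_iso)
  note cA' = skeleton_compact[OF A'(1)]
  have "act c' y \<in> el A'" using A' B cA' by (simp add: mor_iff)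
  moreover have "mor (c \<cdot> t) A A'" using A' B by (simp add: mor_iff)
  moreover have "(c \<cdot> t) \<cdot> f = zer D A'"
    using A' B assms(5) compact_obj[OF D] by (simp add: mor_iff assoc)
  moreover have "act (c \<cdot> t) (act c' y) = act t y"
  proof -
    have "act (c \<cdot> t) (act c' y) = act t (act c (act c' y))"
      using A' B cA' A by (simp add: mor_iff act_comp)
    also have "act c (act c' y) = act (c' \<cdot> c) y"
      using A'(2,3) B cA' A act_comp[of c c' y] by (simp add: mor_iff)
    finally show ?thesis using A'(4) B by simp
  qed
  ultimately show ?thesis using that[OF A'(1)] B(5) by metis
qed

text \<open>
  The tower starts at the given element and kills, one at a time, the arrows into its stages on which
  the point vanishes modulo \<open>S\<close>.  There are only countably many of these, so each one gets its turn.
\<close>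

lemma block_exists:
  assumes "exact S" "A \<in> K" "x \<in> el A"
  obtains b where "block S b" "\<And>n. stage b n \<in> K" "stage b 0 = A" "point b 0 = x"
proof -
  have S: "S \<subseteq> elements" using assms(1) unfolding exact_def by blast
  let ?\<A> = "\<Union>A \<in> K. \<Union>B \<in> K. arrows T A B"
  have "Ident T A \<in> ?\<A>" using assms(2) compact_obj[OF skeleton_compact] ident_arrow by blast
  then obtain \<alpha> :: "nat \<Rightarrow> 'm" where \<alpha>: "?\<A> = range \<alpha>"
    using countable_arrows uncountable_def by (metis empty_iff)
  \<comment> \<open>Task \<open>n\<close> encodes a pair \<open>(i, j)\<close>: kill the arrow \<open>\<alpha> i\<close> into stage \<open>j\<close>, moved to stage \<open>n\<close> by \<open>\<tau> j\<close>.\<close>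
  define kills :: "nat \<Rightarrow> 'o \<Rightarrow> 'u \<Rightarrow> (nat \<Rightarrow> 'm) \<Rightarrow> 'm \<Rightarrow> bool" where
    "kills n B y \<tau> t \<longleftrightarrow> (\<forall>D \<in> K. let f = \<tau> (snd (prod_decode n)) \<cdot> \<alpha> (fst (prod_decode n)) in
       mor f D B \<longrightarrow> act f y \<in> gen S D \<longrightarrow> t \<cdot> f = zer D (cod t))" for n B y \<tau> t
  \<comment> \<open>The state carries, along with a stage and its point, the transitions \<open>\<tau>\<close> from all earlier stages.\<close>
  define P where "P n s = (case s of (B, y, \<tau>) \<Rightarrow> B \<in> K \<and> y \<in> el B \<and>
      (n = 0 \<longrightarrow> B = A \<and> y = x) \<and> \<tau> n = Ident T B)" for n :: nat and s :: "'o \<times> 'u \<times> (nat \<Rightarrow> 'm)"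
  define Q where "Q n s s' = (case (s, s') of ((B, y, \<tau>), (B', y', \<tau>')) \<Rightarrow>
      \<exists>t. mor t B B' \<and> cong S B y (act t y') \<and> (\<forall>j \<le> n. \<tau>' j = t \<cdot> \<tau> j) \<and> kills n B y \<tau> t)"
    for n :: nat and s s' :: "'o \<times> 'u \<times> (nat \<Rightarrow> 'm)"
  have "\<exists>F. \<forall>n. P n (F n) \<and> Q n (F n) (F (Suc n))"
  proof (rule dependent_nat_choice)
    show "\<exists>s. P 0 s" unfolding P_def using assms by (intro exI[of _ "(A, x, \<lambda>_. Ident T A)"]) simp
  next
    fix s n assume "P n s"
    then obtain B y \<tau> where s: "s = (B, y, \<tau>)" and B: "B \<in> K" "y \<in> el B" unfolding P_def by (cases s) auto
    note cB = skeleton_compact[OF B(1)]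
    define f where "f = \<tau> (snd (prod_decode n)) \<cdot> \<alpha> (fst (prod_decode n))"
    have "\<exists>B' y' t. B' \<in> K \<and> y' \<in> el B' \<and> mor t B B' \<and> cong S B y (act t y') \<and> kills n B y \<tau> t"
    proof (cases "\<exists>D \<in> K. mor f D B \<and> act f y \<in> gen S D")
      case True
      then obtain D where D: "D \<in> K" "mor f D B" "act f y \<in> gen S D" by blast
      obtain B' y' t where B': "B' \<in> K" "y' \<in> el B'" "mor t B B'" "t \<cdot> f = zer D B'" "cong S B y (act t y')"
        using assms(1) B D by (rule kill_arrow_in_skeleton)
      have "kills n B y \<tau> t" unfolding kills_def Let_def f_def[symmetric]
        using D(2) B'(3,4) by (auto simp: mor_iff)
      then show ?thesis using B' by blast
    next
      case False
      then have "kills n B y \<tau> (Ident T B)" unfolding kills_def Let_def f_def[symmetric] by blast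
      moreover have "cong S B y (act (Ident T B) y)" using cB B by (simp add: cong_refl)
      moreover have "mor (Ident T B) B B" using compact_obj[OF cB] by (simp add: mor_iff)
      ultimately show ?thesis using B by blast
    qed
    then obtain B' y' t where B': "B' \<in> K" "y' \<in> el B'" "mor t B B'" "cong S B y (act t y')" "kills n B y \<tau> t"
      by blast
    show "\<exists>s'. P (Suc n) s' \<and> Q n s s'" unfolding s P_def Q_def
      by (rule exI[of _ "(B', y', \<lambda>j. if j \<le> n then t \<cdot> \<tau> j else Ident T B')"]) (use B' in auto)
  qed
  then obtain F where F: "\<And>n. P n (F n)" "\<And>n. Q n (F n) (F (Suc n))" by blast
  define B where "B n = fst (F n)" for n
  define y where "y n = fst (snd (F n))" for n
  define \<tau> where "\<tau> n = snd (snd (F n))" for n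
  have F': "F n = (B n, y n, \<tau> n)" for n unfolding B_def y_def \<tau>_def by simp
  have PF: "B n \<in> K" "y n \<in> el (B n)" "\<tau> n n = Ident T (B n)" for n
    using F(1)[of n] unfolding F' P_def by auto
  have P0: "B 0 = A" "y 0 = x" using F(1)[of 0] unfolding F' P_def by auto
  have "\<exists>t. mor t (B n) (B (Suc n)) \<and> cong S (B n) (y n) (act t (y (Suc n))) \<and>
      (\<forall>j \<le> n. \<tau> (Suc n) j = t \<cdot> \<tau> n j) \<and> kills n (B n) (y n) (\<tau> n) t" for n
    using F(2)[of n] unfolding F' Q_def by simp
  then obtain t where t: "\<And>n. mor (t n) (B n) (B (Suc n))" "\<And>n. cong S (B n) (y n) (act (t n) (y (Suc n)))"
      "\<And>n j. j \<le> n \<Longrightarrow> \<tau> (Suc n) j = t n \<cdot> \<tau> n j" "\<And>n. kills n (B n) (y n) (\<tau> n) (t n)"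
    by metis
  define b where "b n = (B n, y n, t n)" for n
  have b: "stage b n = B n" "point b n = y n" "step b n = t n" for n
    unfolding b_def stage_def point_def step_def by simp_all
  have pre: "coherent S b" unfolding coherent_def b using PF t skeleton_compact by blast
  note d = coherentD[OF pre, unfolded b] and tr = transition_mor[OF pre, unfolded b]
  have \<tau>: "\<tau> (n + m) n = transition b n m" for n m
    by (induction m) (simp_all add: b PF t(3))
  have killed: "\<exists>m. transition b n m \<cdot> f = zer D (B (n + m))"
    if D: "D \<in> K" and f: "mor f D (B n)" "act f (y n) \<in> gen S D" for n D f
  proof -
    note cD = skeleton_compact[OF D] and f' = f(1)[unfolded mor_iff]
    have "f \<in> arrows T D (B n)" using f(1) unfolding mor_def by simp
    then have "f \<in> ?\<A>" using D PF(1) by blast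
    then obtain i where i: "f = \<alpha> i" using \<alpha> by auto
    \<comment> \<open>The code of a pair is at least its second component, so the task for \<open>f\<close> comes up only when stage \<open>n\<close> already exists.\<close>
    define N where "N = prod_encode (i, n)"
    then have N: "prod_decode N = (i, n)" "n \<le> N" using le_prod_encode_2 by auto
    then obtain m where m: "N = n + m" using le_Suc_ex by blast
    define g where "g = transition b n m \<cdot> f"
    have g: "mor g D (B N)" unfolding g_def m using tr f' by (simp add: mor_iff)
    have "cong S D (act f (y n)) (act g (y N))"
      using cong_push[OF S pre cD, of f n m] f(1) unfolding b g_def m by simp
    then have "act g (y N) \<in> gen S D" using cong_gen[OF S cD] f(2) by blast
    moreover have "\<tau> N (snd (prod_decode N)) \<cdot> \<alpha> (fst (prod_decode N)) = g"
      unfolding N(1) g_def i using \<tau> m by simp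
    ultimately have "t N \<cdot> g = zer D (cod (t N))"
      using t(4)[of N] D g unfolding kills_def Let_def by simp
    then have "transition b n (Suc m) \<cdot> f = zer D (B (n + Suc m))"
      using d tr f' unfolding g_def m by (simp add: b assoc)
    then show ?thesis by blast
  qed
  have "\<exists>m. transition b n m \<cdot> f = zer D (B (n + m))"
    if D: "cpt D" and f: "mor f D (B n)" "act f (y n) \<in> gen S D" for n D f
  proof -
    obtain D' c c' where D': "D' \<in> K" "mor c D D'" "mor c' D' D" "c' \<cdot> c = Ident T D"
      using D by (rule skeleton_iso)
    note cD' = skeleton_compact[OF D'(1)]
    note mo = f(1)[unfolded mor_iff] D'(2,3)[unfolded mor_iff]
    have "act (f \<cdot> c') (y n) = act c' (act f (y n))" using mo D cD' d by (simp add: act_comp)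
    then have "act (f \<cdot> c') (y n) \<in> gen S D'" using gen_act[OF S D cD' f(2) D'(3)] by simp
    moreover have "mor (f \<cdot> c') D' (B n)" using mo by (simp add: mor_iff)
    ultimately obtain m where m: "transition b n m \<cdot> (f \<cdot> c') = zer D' (B (n + m))" using killed D'(1) by blast
    have "transition b n m \<cdot> f = (transition b n m \<cdot> (f \<cdot> c')) \<cdot> c"
      using mo tr D'(4) by (simp add: assoc)
    also have "\<dots> = zer D (B (n + m))" unfolding m using mo d by simp
    finally show ?thesis by blast
  qed
  then have "block S b" unfolding block_def b using pre by blast
  then show ?thesis using that[of b] P0 PF(1) by (simp add: b)
qed

end

section \<open>Natural transformations out of a coproduct of compact objects\<close>

text \<open>
  By the Yoneda lemma and compactness, a family of elements \<open>x j\<close> of \<open>H (X j)\<close> amounts to a natural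
  transformation from \<open>T(-, P)\<close> to \<open>H\<close> on compact objects.
\<close>

locale classified_coproduct = cohomological_functor k T U H + coproduct k T J X P \<iota>
  for k :: "('k, 'r) ring_scheme"
    and T :: "('k, 'o, 'm, 'z) tricat_scheme"  (structure)
    and U :: "'u itself" and H :: "('k, 'o, 'm, 'u) modfun"
    and J :: "'j set" and X P \<iota> +
  fixes x :: "'j \<Rightarrow> 'u"
  assumes index_small: "small U J"
    and summand_compact: "j \<in> J \<Longrightarrow> cpt (X j)"
    and x_el: "j \<in> J \<Longrightarrow> x j \<in> el (X j)"
begin

lemma all_fsum: "cpt A \<Longrightarrow> mor b A P \<Longrightarrow> fsum A b"
  using compact_fin_sum[OF _ index_small is_coproduct] by blast

text \<open>
  The value of this transformation at \<open>b\<close>.  For \<open>b\<close> out of a compact object the sum is finite.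
\<close>

definition cls :: "'m \<Rightarrow> 'u" where
  "cls b = finsum (FunO H (dom b)) (\<lambda>j. act (proj j \<cdot> b) (x j)) {j \<in> J. proj j \<cdot> b \<noteq> zer (dom b) (X j)}"

lemma summand_el:
  assumes "cpt (dom b)" "arr b" "cod b = P" "j \<in> J"
  shows "act (proj j \<cdot> b) (x j) \<in> el (dom b)"
  using assms summand_compact x_el by simp

lemma cls_eq:
  assumes "cpt A" "mor b A P" "finite F" "F \<subseteq> J" "\<And>j. j \<in> J \<Longrightarrow> j \<notin> F \<Longrightarrow> proj j \<cdot> b = zer A (X j)"
  shows "cls b = finsum (FunO H A) (\<lambda>j. act (proj j \<cdot> b) (x j)) F"
proof -
  interpret HA: abelian_group "FunO H A" by (rule H_group[OF assms(1)])
  have b: "arr b" "dom b = A" "cod b = P" using assms(2) by (simp_all add: mor_iff)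
  show ?thesis unfolding cls_def b(2)
  proof (rule HA.add.finprod_mono_neutral_cong_left)
    show "finite F" by fact
    show "{j \<in> J. proj j \<cdot> b \<noteq> zer A (X j)} \<subseteq> F" using assms(5) by blast
    show "act (proj j \<cdot> b) (x j) = \<zero>\<^bsub>FunO H A\<^esub>" if "j \<in> F - {j \<in> J. proj j \<cdot> b \<noteq> zer A (X j)}" for j
      using that assms(1,4) summand_compact[of j] x_el[of j] by auto
    show "(\<lambda>j. act (proj j \<cdot> b) (x j)) \<in> F \<rightarrow> el A"
      using summand_el[of b] b assms(1,4) by auto
  qed simp
qed

lemma finite_support:
  assumes "cpt A" "mor b A P"
  shows "finite {j \<in> J. proj j \<cdot> b \<noteq> zer A (X j)}"
  using fsum_finite_support[OF all_fsum[OF assms] compact_obj[OF assms(1)]] .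

lemma cls_el: "cpt A \<Longrightarrow> mor b A P \<Longrightarrow> cls b \<in> el A"
proof -
  assume A: "cpt A" "mor b A P"
  interpret HA: abelian_group "FunO H A" by (rule H_group[OF A(1)])
  show "cls b \<in> el A" unfolding cls_def
    using A summand_el[of b] by (auto intro!: HA.finsum_closed simp: mor_iff)
qed

lemma cls_zero: "cpt A \<Longrightarrow> cls (zer A P) = \<zero>\<^bsub>FunO H A\<^esub>"
  using cls_eq[of A "zer A P" "{}"] abelian_monoid.finsum_empty[OF abelian_group.axioms(1)[OF H_group]]
  by (simp add: mor_iff compact_obj)

lemma cls_plus:
  assumes "cpt A" "mor b A P" "mor b' A P"
  shows "cls (b \<boxplus> b') = cls b \<oplus>\<^bsub>FunO H A\<^esub> cls b'"
proof -
  interpret HA: abelian_group "FunO H A" by (rule H_group[OF assms(1)])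
  note b = assms(2,3)[unfolded mor_iff]
  let ?F = "{j \<in> J. proj j \<cdot> b \<noteq> zer A (X j)} \<union> {j \<in> J. proj j \<cdot> b' \<noteq> zer A (X j)}"
  have F: "finite ?F" "?F \<subseteq> J" using finite_support assms by auto
  have A: "A \<in> Obj T" using compact_obj assms by blast
  have "cls (b \<boxplus> b') = finsum (FunO H A) (\<lambda>j. act (proj j \<cdot> (b \<boxplus> b')) (x j)) ?F"
    using b A by (intro cls_eq[OF assms(1) _ F]) (auto simp: mor_iff comp_plus)
  also have "\<dots> = finsum (FunO H A) (\<lambda>j. act (proj j \<cdot> b) (x j) \<oplus>\<^bsub>FunO H A\<^esub> act (proj j \<cdot> b') (x j)) ?F"
  proof (rule HA.finsum_cong')
    show "(\<lambda>j. act (proj j \<cdot> b) (x j) \<oplus>\<^bsub>FunO H A\<^esub> act (proj j \<cdot> b') (x j)) \<in> ?F \<rightarrow> el A"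
      using summand_el[of b] summand_el[of b'] b assms(1) by auto
    show "act (proj j \<cdot> (b \<boxplus> b')) (x j) = act (proj j \<cdot> b) (x j) \<oplus>\<^bsub>FunO H A\<^esub> act (proj j \<cdot> b') (x j)"
      if "j \<in> ?F" for j
    proof -
      have "j \<in> J" using that by blast
      then show ?thesis using b assms(1) summand_compact[of j] x_el[of j] by (simp add: comp_plus act_plus_arr)
    qed
  qed simp
  also have "\<dots> = finsum (FunO H A) (\<lambda>j. act (proj j \<cdot> b) (x j)) ?F \<oplus>\<^bsub>FunO H A\<^esub>
      finsum (FunO H A) (\<lambda>j. act (proj j \<cdot> b') (x j)) ?F"
    using summand_el[of b] summand_el[of b'] b assms(1) by (intro HA.finsum_addf) auto
  also have "\<dots> = cls b \<oplus>\<^bsub>FunO H A\<^esub> cls b'"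
    using cls_eq[OF assms(1,2) F] cls_eq[OF assms(1,3) F] by auto
  finally show ?thesis .
qed

lemma cls_inj:
  assumes "cpt A" "j \<in> J" "mor f A (X j)"
  shows "cls (\<iota> j \<cdot> f) = act f (x j)"
proof -
  interpret HA: abelian_group "FunO H A" by (rule H_group[OF assms(1)])
  note f = assms(3)[unfolded mor_iff]
  have "cls (\<iota> j \<cdot> f) = finsum (FunO H A) (\<lambda>i. act (proj i \<cdot> (\<iota> j \<cdot> f)) (x i)) {j}"
    using f assms by (intro cls_eq) (auto simp: mor_iff)
  also have "\<dots> = act (proj j \<cdot> (\<iota> j \<cdot> f)) (x j) \<oplus>\<^bsub>FunO H A\<^esub> finsum (FunO H A) (\<lambda>i. act (proj i \<cdot> (\<iota> j \<cdot> f)) (x i)) {}"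
    using f assms summand_compact[of j] x_el[of j] by (intro HA.finsum_insert) auto
  also have "\<dots> = act f (x j)" using f assms summand_compact[of j] x_el[of j] by simp
  finally show ?thesis .
qed

lemma cls_comp:
  assumes "cpt A" "cpt B" "mor b A P" "mor h B A"
  shows "cls (b \<cdot> h) = act h (cls b)"
  using all_fsum[OF assms(1,3)]
proof induction
  note h = assms(4)[unfolded mor_iff]
  case zero
  show ?case using h assms cls_zero by simp
next
  note h = assms(4)[unfolded mor_iff]
  case (plus b i f)
  note b = fsum_arr[OF plus.hyps(1) compact_obj[OF assms(1)]] and f = plus.hyps(3)[unfolded mor_iff]
  have "(b \<boxplus> \<iota> i \<cdot> f) \<cdot> h = b \<cdot> h \<boxplus> \<iota> i \<cdot> (f \<cdot> h)"
    using b f h plus.hyps(2) by (simp add: comp_plus assoc)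
  moreover have "cls (b \<cdot> h \<boxplus> \<iota> i \<cdot> (f \<cdot> h)) = cls (b \<cdot> h) \<oplus>\<^bsub>FunO H B\<^esub> cls (\<iota> i \<cdot> (f \<cdot> h))"
    using b f h plus.hyps(2) by (intro cls_plus[OF assms(2)]) (auto simp: mor_iff)
  moreover have "cls (\<iota> i \<cdot> (f \<cdot> h)) = act h (act f (x i))"
    using cls_inj[OF assms(2) plus.hyps(2), of "f \<cdot> h"] f h plus.hyps(2) summand_compact[of i] x_el[of i] assms
    by (simp add: mor_iff act_comp)
  moreover have "cls (b \<boxplus> \<iota> i \<cdot> f) = cls b \<oplus>\<^bsub>FunO H A\<^esub> act f (x i)"
    using cls_plus[OF assms(1), of b "\<iota> i \<cdot> f"] cls_inj[OF assms(1) plus.hyps(2,3)] b f plus.hyps(2)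
    by (simp add: mor_iff)
  moreover have "act h (cls b \<oplus>\<^bsub>FunO H A\<^esub> act f (x i)) = act h (cls b) \<oplus>\<^bsub>FunO H B\<^esub> act h (act f (x i))"
    using h assms f plus.hyps(2) summand_compact[of i] x_el[of i] cls_el[OF assms(1), of b] b
    by (simp add: act_plus mor_iff)
  ultimately show ?case using plus.IH by simp
qed

lemma cls_neg:
  assumes "cpt A" "mor b A P"
  shows "cls b \<oplus>\<^bsub>FunO H A\<^esub> cls (neg b) = \<zero>\<^bsub>FunO H A\<^esub>"
  using cls_plus[OF assms(1,2), of "neg b"] cls_zero[OF assms(1)] assms(2) by (simp add: mor_iff)

definition supported :: "'j set \<Rightarrow> 'm \<Rightarrow> bool" where
  "supported S b \<longleftrightarrow> (\<forall>j \<in> J. j \<notin> S \<longrightarrow> proj j \<cdot> b = zer (dom b) (X j))"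

lemma supported_zero: "A \<in> Obj T \<Longrightarrow> supported S (zer A P)"
  unfolding supported_def by simp

lemma supported_plus: "mor b A P \<Longrightarrow> mor b' A P \<Longrightarrow> supported S b \<Longrightarrow> supported S b' \<Longrightarrow> supported S (b \<boxplus> b')"
  unfolding supported_def using mor_obj by (auto simp: mor_iff comp_plus)

lemma supported_comp: "mor b A P \<Longrightarrow> mor h B A \<Longrightarrow> supported S b \<Longrightarrow> supported S (b \<cdot> h)"
  unfolding supported_def using mor_obj by (auto simp: mor_iff simp flip: assoc)

lemma supported_neg: "mor b A P \<Longrightarrow> supported S b \<Longrightarrow> supported S (neg b)"
  unfolding supported_def by (auto simp: mor_iff comp_neg)

lemma supported_inj: "j \<in> J \<Longrightarrow> j \<in> S \<Longrightarrow> mor f A (X j) \<Longrightarrow> supported S (\<iota> j \<cdot> f)"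
  unfolding supported_def by (auto simp: mor_iff)

lemma supported_mono: "supported S b \<Longrightarrow> S \<subseteq> S' \<Longrightarrow> supported S' b"
  unfolding supported_def by blast

lemma supported_induct [consumes 3, case_names zero plus]:
  assumes "cpt A" "mor b A P" "supported S b" "Q (zer A P)"
    "\<And>b j f. \<lbrakk>mor b A P; supported S b; Q b; j \<in> J; j \<in> S; mor f A (X j)\<rbrakk> \<Longrightarrow> Q (b \<boxplus> \<iota> j \<cdot> f)"
  shows "Q b"
  using all_fsum[OF assms(1,2)] compact_obj[OF assms(1)]
proof (rule fsum_support_induct[where J = S])
  show "proj i \<cdot> b = zer A (X i)" if "i \<in> J" "i \<notin> S" for i
    using assms(2,3) that unfolding supported_def by (simp add: mor_iff)
  show "Q (zer A P)" by fact
  show "Q (b \<boxplus> \<iota> i \<cdot> f)" if "fsum A b" "\<And>i. i \<in> J \<Longrightarrow> i \<notin> S \<Longrightarrow> proj i \<cdot> b = zer A (X i)"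
      "Q b" "i \<in> J" "i \<in> S" "mor f A (X i)" for b i f
    using assms(5)[of b i f] that fsum_arr[OF that(1) compact_obj[OF assms(1)]]
    unfolding supported_def by (simp add: mor_iff)
qed

lemma supported_chain:
  assumes "cpt A" "mor b A P" "supported (\<Union>i \<in> I. S i) b"
    and "\<And>i j. i \<in> I \<Longrightarrow> j \<in> I \<Longrightarrow> S i \<subseteq> S j \<or> S j \<subseteq> S i"
  shows "b = zer A P \<or> (\<exists>i \<in> I. supported (S i) b)"
  using assms(1-3)
proof (induction rule: supported_induct)
  case (plus b j f)
  then obtain i where i: "i \<in> I" "j \<in> S i" by blast
  have jf: "mor (\<iota> j \<cdot> f) A P" using plus by (simp add: mor_iff)
  from plus.IH show ?case
  proof
    assume "b = zer A P"
    then have "b \<boxplus> \<iota> j \<cdot> f = \<iota> j \<cdot> f" using jf by (simp add: mor_iff)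
    then show ?thesis using supported_inj[OF plus.hyps(3) i(2) plus.hyps(5)] i(1) by auto
  next
    assume "\<exists>i \<in> I. supported (S i) b"
    then obtain l where l: "l \<in> I" "supported (S l) b" by blast
    obtain n where n: "n \<in> I" "S i \<subseteq> S n" "S l \<subseteq> S n" using assms(4)[OF i(1) l(1)] i(1) l(1) by blast
    then have "supported (S n) (b \<boxplus> \<iota> j \<cdot> f)"
      using supported_plus[OF plus.hyps(1) jf] supported_mono[OF l(2)] supported_inj[OF plus.hyps(3) _ plus.hyps(5)] i(2)
      by blast
    then show ?thesis using n(1) by blast
  qed
qed simp

text \<open>
  Together with the next lemma: the arrows supported in \<open>S\<close> map onto the subfunctor generated by
  the elements with index in \<open>S\<close>.
\<close>

lemma cls_gen:
  assumes "cpt A" "mor b A P" "supported S b" "S \<subseteq> J"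
  shows "cls b \<in> gen ((\<lambda>j. (X j, x j)) ` S) A"
  using assms(1-3)
proof (induction rule: supported_induct)
  case zero
  show ?case using cls_zero[OF assms(1)] gen.zero by metis
next
  case (plus b j f)
  have "cls (b \<boxplus> \<iota> j \<cdot> f) = cls b \<oplus>\<^bsub>FunO H A\<^esub> act f (x j)"
    using cls_plus[OF assms(1) plus.hyps(1), of "\<iota> j \<cdot> f"] cls_inj[OF assms(1) plus.hyps(3,5)] plus.hyps
    by (simp add: mor_iff)
  moreover have "(X j, x j) \<in> (\<lambda>j. (X j, x j)) ` S" using plus.hyps by blast
  ultimately show ?case using gen.plus[OF plus.IH _ plus.hyps(5)] by metis
qed

lemma gen_cls:
  assumes "cpt A" "y \<in> gen ((\<lambda>j. (X j, x j)) ` S) A" "S \<subseteq> J"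
  obtains b where "mor b A P" "supported S b" "cls b = y"
proof -
  have "\<exists>b. mor b A P \<and> supported S b \<and> cls b = y" using assms(2)
  proof induction
    case zero
    show ?case using cls_zero[OF assms(1)] supported_zero compact_obj[OF assms(1)]
      by (intro exI[of _ "zer A P"]) (simp add: mor_iff)
  next
    case (plus y D x' f)
    then obtain b j where b: "mor b A P" "supported S b" "cls b = y" "j \<in> S" "D = X j" "x' = x j" by blast
    have j: "j \<in> J" "mor f A (X j)" using b assms(3) plus.hyps by auto
    have jf: "mor (\<iota> j \<cdot> f) A P" using j by (simp add: mor_iff)
    have "cls (b \<boxplus> \<iota> j \<cdot> f) = y \<oplus>\<^bsub>FunO H A\<^esub> act f x'"
      using cls_plus[OF assms(1) b(1) jf] cls_inj[OF assms(1) j] b by simp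
    moreover have "mor (b \<boxplus> \<iota> j \<cdot> f) A P" using b(1) jf by (simp add: mor_iff)
    ultimately show ?case using supported_plus[OF b(1) jf b(2) supported_inj[OF j(1) b(4) j(2)]] by blast
  qed
  then show ?thesis using that by blast
qed

end

section \<open>A two-term resolution by coproducts of compact objects\<close>

text \<open>
  A well-ordered family of towers, each of which enlarges the exact subfunctor generated by its
  predecessors, and which together exhaust \<open>H\<close>.  The coproduct \<open>P\<close> has one summand for each
  stage of each tower.
\<close>

locale block_family = cohomological_functor k T U H
  for k :: "('k, 'r) ring_scheme"
    and T :: "('k, 'o, 'm, 'z) tricat_scheme"  (structure)
    and U :: "'u itself" and H :: "('k, 'o, 'm, 'u) modfun" +
  fixes E :: "'e set" and R :: "('e \<times> 'e) set" and B :: "'e \<Rightarrow> ('o, 'u, 'm) tower"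
    and P :: 'o and \<iota> :: "'e \<times> nat \<Rightarrow> 'm"
  assumes wf_R: "wf R" and trans_R: "trans R"
    and total_R: "\<lbrakk>d \<in> E; e \<in> E; d \<noteq> e\<rbrakk> \<Longrightarrow> (d, e) \<in> R \<or> (e, d) \<in> R"
    and blocks: "e \<in> E \<Longrightarrow> block (\<Union>d \<in> {d \<in> E. (d, e) \<in> R}. points (B d)) (B e)"
    and generates: "\<lbrakk>cpt A; y \<in> el A\<rbrakk> \<Longrightarrow> y \<in> gen (\<Union>e \<in> E. points (B e)) A"
    and family_small: "small U (E \<times> (UNIV :: nat set))"
    and family_coproduct: "is_coproduct T (E \<times> UNIV) (\<lambda>j. stage (B (fst j)) (snd j)) P \<iota>"

sublocale block_family \<subseteq> classified_coproduct k T U H "E \<times> UNIV" "\<lambda>j. stage (B (fst j)) (snd j)" P \<iota>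
    "\<lambda>j. point (B (fst j)) (snd j)"
proof
  show "is_coproduct T (E \<times> UNIV) (\<lambda>j. stage (B (fst j)) (snd j)) P \<iota>" by (rule family_coproduct)
  show "small U (E \<times> (UNIV :: nat set))" by (rule family_small)
  show "cpt (stage (B (fst j)) (snd j))" if "j \<in> E \<times> UNIV" for j
    using blocks[of "fst j"] that unfolding block_def coherent_def by auto
  show "point (B (fst j)) (snd j) \<in> el (stage (B (fst j)) (snd j))" if "j \<in> E \<times> UNIV" for j
    using blocks[of "fst j"] that unfolding block_def coherent_def by auto
qed

context block_family
begin

definition below :: "'e \<Rightarrow> 'e set" where
  "below e = {d \<in> E. (d, e) \<in> R}"

definition upto :: "'e \<Rightarrow> 'e set" where
  "upto e = insert e (below e)"

abbreviation on :: "'e set \<Rightarrow> ('e \<times> nat) set" where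
  "on D \<equiv> D \<times> UNIV"

lemma below_E: "below e \<subseteq> E" "e \<in> E \<Longrightarrow> upto e \<subseteq> E"
  unfolding below_def upto_def by auto

lemma not_below_self: "e \<notin> below e"
  using wf_R unfolding below_def by auto

lemma below_mono: "d \<in> below e \<Longrightarrow> upto d \<subseteq> below e"
  using trans_R unfolding below_def upto_def by (auto dest: transD)

lemma upto_chain: "d \<in> E \<Longrightarrow> e \<in> E \<Longrightarrow> upto d \<subseteq> upto e \<or> upto e \<subseteq> upto d"
  using total_R[of d e] below_mono[of d e] below_mono[of e d]
  unfolding upto_def below_def by blast

lemma below_eq: "below e = (\<Union>d \<in> below e. upto d)"
  using below_mono unfolding upto_def by blast

lemma E_eq: "E = (\<Union>e \<in> E. upto e)"
  using below_E unfolding upto_def by blast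

lemma points_on: "(\<lambda>j. (stage (B (fst j)) (snd j), point (B (fst j)) (snd j))) ` on D = (\<Union>d \<in> D. points (B d))"
  unfolding points_def by force

lemma block_below: "e \<in> E \<Longrightarrow> block (\<Union>d \<in> below e. points (B d)) (B e)"
  using blocks unfolding below_def .

lemma coherent_below: "e \<in> E \<Longrightarrow> coherent (\<Union>d \<in> below e. points (B d)) (B e)"
  using block_below unfolding block_def by blast

lemmas stageD = coherentD(1-5,7)[OF coherent_below]
lemmas stage_cong = coherentD(6)[OF coherent_below]
lemmas transitionD = transition_mor[OF coherent_below]

text \<open>
  A point and its successor agree up to an element generated by earlier towers, and such elements
  lift to arrows into \<open>P\<close> supported on these towers.
\<close>

lemma correction_exists:
  assumes "e \<in> E"
  shows "\<exists>r. mor r (stage (B e) n) P \<and> supported (on (below e)) r \<and>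
     point (B e) n = cls r \<oplus>\<^bsub>FunO H (stage (B e) n)\<^esub> act (step (B e) n) (point (B e) (Suc n))"
proof -
  obtain m where m: "m \<in> gen (\<Union>d \<in> below e. points (B d)) (stage (B e) n)"
    "point (B e) n = m \<oplus>\<^bsub>FunO H (stage (B e) n)\<^esub> act (step (B e) n) (point (B e) (Suc n))"
    using stage_cong[OF assms, of n] unfolding cong_def by blast
  have "on (below e) \<subseteq> E \<times> UNIV" using below_E by blast
  then obtain r where "mor r (stage (B e) n) P" "supported (on (below e)) r" "cls r = m"
    using gen_cls[OF stageD(1)[OF assms]] m(1) unfolding points_on[symmetric] by blast
  then show ?thesis using m(2) by blast
qed

definition correction :: "'e \<Rightarrow> nat \<Rightarrow> 'm" where
  "correction e n = (SOME r. mor r (stage (B e) n) P \<and> supported (on (below e)) r \<and>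
     point (B e) n = cls r \<oplus>\<^bsub>FunO H (stage (B e) n)\<^esub> act (step (B e) n) (point (B e) (Suc n)))"

lemma correction:
  assumes "e \<in> E"
  shows "arr (correction e n)" "dom (correction e n) = stage (B e) n" "cod (correction e n) = P"
    "supported (on (below e)) (correction e n)"
  and correction_eq: "point (B e) n = cls (correction e n) \<oplus>\<^bsub>FunO H (stage (B e) n)\<^esub> act (step (B e) n) (point (B e) (Suc n))"
  using someI_ex[OF correction_exists[OF assms, of n]] unfolding correction_def[symmetric] unfolding mor_iff by blast+

text \<open>
  In \<open>H\<close> the summand inclusion \<open>\<iota> (e, n)\<close> and \<open>tail e n\<close> represent the same element, so their difference
  is a relation.  These relations, one for each summand, make up \<open>\<theta>\<close>.
\<close>

definition tail :: "'e \<Rightarrow> nat \<Rightarrow> 'm" where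
  "tail e n = \<iota> (e, Suc n) \<cdot> step (B e) n \<boxplus> correction e n"

lemma inj' [simp]:
  "e \<in> E \<Longrightarrow> arr (\<iota> (e, n))" "e \<in> E \<Longrightarrow> dom (\<iota> (e, n)) = stage (B e) n" "e \<in> E \<Longrightarrow> cod (\<iota> (e, n)) = P"
  using inj[of "(e, n)"] by auto

lemma tail:
  assumes "e \<in> E"
  shows "arr (tail e n)" "dom (tail e n) = stage (B e) n" "cod (tail e n) = P"
  using stageD(3-5)[OF assms, of n] correction(1-3)[OF assms, of n] assms unfolding tail_def by simp_all

definition \<theta> :: 'm where
  "\<theta> = copair P (\<lambda>(e, n). \<iota> (e, n) \<boxplus> neg (tail e n))"

lemma \<theta>:
  shows "arr \<theta>" "dom \<theta> = P" "cod \<theta> = P"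
    and "e \<in> E \<Longrightarrow> \<theta> \<cdot> \<iota> (e, n) = \<iota> (e, n) \<boxplus> neg (tail e n)"
proof -
  have *: "mor (case j of (e, n) \<Rightarrow> \<iota> (e, n) \<boxplus> neg (tail e n)) (stage (B (fst j)) (snd j)) P"
    if "j \<in> E \<times> UNIV" for j
    using that tail by (cases j) (simp add: mor_iff)
  show "arr \<theta>" "dom \<theta> = P" "cod \<theta> = P" unfolding \<theta>_def using copair(1-3) * by auto
  show "e \<in> E \<Longrightarrow> \<theta> \<cdot> \<iota> (e, n) = \<iota> (e, n) \<boxplus> neg (tail e n)"
    unfolding \<theta>_def using copair(4)[OF obj(1) *, of "(e, n)"] by simp
qed

lemma \<theta>_inj_comp:
  assumes "e \<in> E" "mor f A (stage (B e) n)"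
  shows "\<iota> (e, n) \<cdot> f = \<theta> \<cdot> (\<iota> (e, n) \<cdot> f) \<boxplus> tail e n \<cdot> f"
proof -
  note f = assms(2)[unfolded mor_iff]
  have "\<theta> \<cdot> (\<iota> (e, n) \<cdot> f) = (\<theta> \<cdot> \<iota> (e, n)) \<cdot> f" using assms(1) f \<theta>(1-3) by (simp add: assoc)
  also have "\<dots> = \<iota> (e, n) \<cdot> f \<boxplus> neg (tail e n \<cdot> f)"
    using assms(1) f \<theta>(4) tail by (simp add: comp_plus comp_neg)
  finally show ?thesis using assms(1) f tail by (simp add: plus_assoc)
qed

lemma cls_tail:
  assumes "e \<in> E" "cpt A" "mor f A (stage (B e) n)"
  shows "cls (tail e n \<cdot> f) = act f (point (B e) n)"
proof -
  note d = stageD[OF assms(1)] and c = correction[OF assms(1)]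
  interpret HS: abelian_group "FunO H (stage (B e) n)" by (rule H_group[OF d(1)])
  have t: "mor (tail e n) (stage (B e) n) P" using tail[OF assms(1)] by (simp add: mor_iff)
  have "cls (tail e n) = cls (\<iota> (e, Suc n) \<cdot> step (B e) n) \<oplus>\<^bsub>FunO H (stage (B e) n)\<^esub> cls (correction e n)"
    unfolding tail_def using d(3-5)[of n] c(1-3)[of n] assms(1) by (intro cls_plus[OF d(1)]) (simp_all add: mor_iff)
  also have "cls (\<iota> (e, Suc n) \<cdot> step (B e) n) = act (step (B e) n) (point (B e) (Suc n))"
    using cls_inj[OF d(1), of "(e, Suc n)" "step (B e) n" n] d assms(1) by (simp add: mor_iff)
  also have "\<dots> \<oplus>\<^bsub>FunO H (stage (B e) n)\<^esub> cls (correction e n) =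
      cls (correction e n) \<oplus>\<^bsub>FunO H (stage (B e) n)\<^esub> act (step (B e) n) (point (B e) (Suc n))"
  proof (rule HS.a_comm)
    show "act (step (B e) n) (point (B e) (Suc n)) \<in> el (stage (B e) n)"
      using d(1)[of n] d(1,2)[of "Suc n"] d(3-5)[of n] by simp
    show "cls (correction e n) \<in> el (stage (B e) n)"
      using cls_el[OF d(1), of "correction e n" n] c(1-3)[of n] by (simp add: mor_iff)
  qed
  also have "\<dots> = point (B e) n" by (rule correction_eq[OF assms(1), symmetric])
  finally show ?thesis using cls_comp[OF d(1) assms(2) t assms(3)] by simp
qed

theorem cls_\<theta>:
  assumes "cpt A" "mor b A P"
  shows "cls (\<theta> \<cdot> b) = \<zero>\<^bsub>FunO H A\<^esub>"
  using all_fsum[OF assms]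
proof induction
  case zero
  show ?case using \<theta>(1-3) cls_zero[OF assms(1)] compact_obj[OF assms(1)] by simp
next
  interpret HA: abelian_group "FunO H A" by (rule H_group[OF assms(1)])
  case (plus b j f)
  obtain e n where j: "j = (e, n)" "e \<in> E" using plus.hyps(2) by (cases j) auto
  note b = fsum_arr[OF plus.hyps(1) compact_obj[OF assms(1)]]
  have f: "mor f A (stage (B e) n)" using plus.hyps(3) j by simp
  note f' = f[unfolded mor_iff]
  let ?i = "\<iota> (e, n) \<cdot> f"
  have m: "mor ?i A P" "mor (\<theta> \<cdot> ?i) A P" "mor (tail e n \<cdot> f) A P" "mor (\<theta> \<cdot> b) A P"
    using f' \<theta>(1-3) tail j(2) b by (simp_all add: mor_iff)
  have "cls ?i = cls (\<theta> \<cdot> ?i) \<oplus>\<^bsub>FunO H A\<^esub> cls (tail e n \<cdot> f)"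
    using cls_plus[OF assms(1) m(2,3)] \<theta>_inj_comp[OF j(2) f] by simp
  moreover have "cls ?i = act f (point (B e) n)" using cls_inj[OF assms(1), of "(e, n)" f] j f by simp
  ultimately have "act f (point (B e) n) = cls (\<theta> \<cdot> ?i) \<oplus>\<^bsub>FunO H A\<^esub> act f (point (B e) n)"
    using cls_tail[OF j(2) assms(1) f] by simp
  moreover have "act f (point (B e) n) \<in> el A" using f' stageD[OF j(2)] assms(1) by auto
  ultimately have "cls (\<theta> \<cdot> ?i) = \<zero>\<^bsub>FunO H A\<^esub>"
    using cls_el[OF assms(1) m(2)] HA.add.r_cancel_one'[of "act f (point (B e) n)" "cls (\<theta> \<cdot> ?i)"] by simp
  moreover have "\<theta> \<cdot> (b \<boxplus> \<iota> j \<cdot> f) = \<theta> \<cdot> b \<boxplus> \<theta> \<cdot> ?i"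
    using b f' \<theta>(1-3) j by (simp add: comp_plus)
  ultimately show ?case using cls_plus[OF assms(1) m(4,2)] plus.IH by simp
qed

text \<open>
  Congruence modulo the image of \<open>\<theta>\<close>.
\<close>

definition equiv :: "'m \<Rightarrow> 'm \<Rightarrow> bool" where
  "equiv b b' \<longleftrightarrow> arr b' \<and> cod b' = P \<and> (\<exists>c. mor c (dom b') P \<and> b = \<theta> \<cdot> c \<boxplus> b')"

lemma equiv_refl: "mor b A P \<Longrightarrow> equiv b b"
  unfolding equiv_def using \<theta>(1-3) mor_obj by (intro conjI exI[of _ "zer A P"]) (auto simp: mor_iff)

lemma equiv_arr: "equiv b b' \<Longrightarrow> arr b \<and> dom b = dom b' \<and> cod b = P"
  unfolding equiv_def using \<theta>(1-3) by (auto simp: mor_iff)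

lemma equiv_trans:
  assumes "equiv b b'" "equiv b' b''"
  shows "equiv b b''"
proof -
  obtain c c' where c: "mor c (dom b'') P" "b = \<theta> \<cdot> c \<boxplus> b'" "mor c' (dom b'') P" "b' = \<theta> \<cdot> c' \<boxplus> b''"
    and b'': "arr b''" "cod b'' = P"
    using assms equiv_arr[OF assms(2)] unfolding equiv_def by auto
  have "b = \<theta> \<cdot> (c \<boxplus> c') \<boxplus> b''"
    using c(1,3) b'' \<theta>(1-3) unfolding c(2,4) by (simp add: mor_iff comp_plus plus_assoc)
  moreover have "mor (c \<boxplus> c') (dom b'') P" using c by (simp add: mor_iff)
  ultimately show ?thesis unfolding equiv_def using b'' by blast
qed

lemma equiv_plus:
  assumes "equiv b b'" "equiv a a'" "dom a' = dom b'"
  shows "equiv (b \<boxplus> a) (b' \<boxplus> a')"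
proof -
  obtain c c' where c: "mor c (dom b') P" "b = \<theta> \<cdot> c \<boxplus> b'" "mor c' (dom b') P" "a = \<theta> \<cdot> c' \<boxplus> a'"
    and b: "arr b'" "cod b' = P" "arr a'" "cod a' = P"
    using assms unfolding equiv_def by auto
  have "b \<boxplus> a = \<theta> \<cdot> (c \<boxplus> c') \<boxplus> (b' \<boxplus> a')"
    using c(1,3) b assms(3) \<theta>(1-3) unfolding c(2,4) by (simp add: mor_iff comp_plus plus_assoc plus_left_commute)
  moreover have "mor (c \<boxplus> c') (dom b') P" using c by (simp add: mor_iff)
  ultimately show ?thesis unfolding equiv_def using b assms(3) by auto
qed

text \<open>
  Modulo the image of \<open>\<theta>\<close>, a summand may be traded for a later stage of the same tower, at the
  cost of terms in earlier towers.
\<close>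

lemma equiv_raise:
  assumes "e \<in> E" "mor g A (stage (B e) n)"
  shows "\<exists>r. mor r A P \<and> supported (on (below e)) r \<and>
    equiv (\<iota> (e, n) \<cdot> g) (\<iota> (e, n + m) \<cdot> (transition (B e) n m \<cdot> g) \<boxplus> r)"
proof (induction m)
  note g = assms(2)[unfolded mor_iff] and A = mor_obj(1)[OF assms(2)]
  case 0
  have m: "mor (\<iota> (e, n) \<cdot> g) A P" using g assms(1) by (simp add: mor_iff)
  have "\<iota> (e, n + 0) \<cdot> (transition (B e) n 0 \<cdot> g) \<boxplus> zer A P = \<iota> (e, n) \<cdot> g"
    using g assms(1) by simp
  then show ?case using equiv_refl[OF m] supported_zero[OF A] A
    by (intro exI[of _ "zer A P"]) (simp add: mor_iff)
next
  note g = assms(2)[unfolded mor_iff] and A = mor_obj(1)[OF assms(2)]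
  case (Suc m)
  then obtain r where r: "mor r A P" "supported (on (below e)) r"
    "equiv (\<iota> (e, n) \<cdot> g) (\<iota> (e, n + m) \<cdot> (transition (B e) n m \<cdot> g) \<boxplus> r)" by blast
  let ?h = "transition (B e) n m \<cdot> g"
  have h: "mor ?h A (stage (B e) (n + m))" using g transitionD[OF assms(1)] by (simp add: mor_iff)
  note h' = h[unfolded mor_iff] and c = correction[OF assms(1), of "n + m"] and t = tail[OF assms(1)]
    and s = stageD[OF assms(1)]
  let ?c = "correction e (n + m) \<cdot> ?h"
  have c': "mor ?c A P" "supported (on (below e)) ?c"
    using supported_comp[of "correction e (n + m)" "stage (B e) (n + m)" ?h A] c h h' by (simp_all add: mor_iff)
  have ti: "tail e (n + m) \<cdot> ?h = \<iota> (e, n + Suc m) \<cdot> (transition (B e) n (Suc m) \<cdot> g) \<boxplus> ?c"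
    unfolding tail_def using c h' s assms(1) g transitionD[OF assms(1)] by (simp add: comp_plus assoc)
  have "equiv (\<iota> (e, n + m) \<cdot> ?h) (tail e (n + m) \<cdot> ?h)"
    unfolding equiv_def
  proof (intro conjI exI)
    show "\<iota> (e, n + m) \<cdot> ?h = \<theta> \<cdot> (\<iota> (e, n + m) \<cdot> ?h) \<boxplus> tail e (n + m) \<cdot> ?h"
      using \<theta>_inj_comp[OF assms(1) h] .
  qed (use h' t assms(1) in \<open>auto simp: mor_iff\<close>)
  then have "equiv (\<iota> (e, n + m) \<cdot> ?h \<boxplus> r) ((\<iota> (e, n + Suc m) \<cdot> (transition (B e) n (Suc m) \<cdot> g) \<boxplus> ?c) \<boxplus> r)"
    using equiv_plus[OF _ equiv_refl[OF r(1)], of "\<iota> (e, n + m) \<cdot> ?h" "tail e (n + m) \<cdot> ?h"] r(1) h' t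
    unfolding ti[symmetric] by (simp add: mor_iff)
  moreover have "(\<iota> (e, n + Suc m) \<cdot> (transition (B e) n (Suc m) \<cdot> g) \<boxplus> ?c) \<boxplus> r =
      \<iota> (e, n + Suc m) \<cdot> (transition (B e) n (Suc m) \<cdot> g) \<boxplus> (?c \<boxplus> r)"
    using r(1) c'(1) g transitionD[OF assms(1), of n "Suc m"] assms(1) 
    by (intro plus_assoc) (simp_all add: mor_iff del: transition.simps)
  ultimately have "equiv (\<iota> (e, n) \<cdot> g) (\<iota> (e, n + Suc m) \<cdot> (transition (B e) n (Suc m) \<cdot> g) \<boxplus> (?c \<boxplus> r))"
    using equiv_trans[OF r(3)] by simp
  moreover have "mor (?c \<boxplus> r) A P" using r(1) c'(1) by (simp add: mor_iff)
  ultimately show ?case using supported_plus[OF c'(1) r(1) c'(2) r(2)] by blast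
qed

text \<open>
  Moving everything in the leading tower \<open>e\<close> to a common stage leaves a single leading term.
\<close>

lemma equiv_normal_form:
  assumes "e \<in> E" "cpt A" "mor b A P" "supported (on (upto e)) b"
  shows "\<exists>n g r. mor g A (stage (B e) n) \<and> mor r A P \<and> supported (on (below e)) r \<and>
    equiv b (\<iota> (e, n) \<cdot> g \<boxplus> r)"
  using assms(2-4)
proof (induction rule: supported_induct)
  note A = compact_obj[OF assms(2)] and s = stageD[OF assms(1)]
  case zero
  have z: "mor (zer A P) A P" using A by (simp add: mor_iff)
  have "equiv (zer A P) (\<iota> (e, 0) \<cdot> zer A (stage (B e) 0) \<boxplus> zer A P)"
    using equiv_refl[OF z] assms(1) A by simp
  moreover have "mor (zer A (stage (B e) 0)) A (stage (B e) 0)" using A s by (simp add: mor_iff)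
  ultimately show ?case using z supported_zero[OF A] by blast
next
  note A = compact_obj[OF assms(2)] and s = stageD[OF assms(1)] and tr = transitionD[OF assms(1)]
  case (plus b j f)
  then obtain n g r where g: "mor g A (stage (B e) n)" and r: "mor r A P" "supported (on (below e)) r"
    and eq: "equiv b (\<iota> (e, n) \<cdot> g \<boxplus> r)" by blast
  note g' = g[unfolded mor_iff] and r' = r(1)[unfolded mor_iff]
  obtain d l where j: "j = (d, l)" "d \<in> E" "d = e \<or> d \<in> below e"
    using plus.hyps(3,4) unfolding upto_def by (cases j) auto
  have f: "mor f A (stage (B d) l)" using plus.hyps(5) j by simp
  note f' = f[unfolded mor_iff]
  have jf: "mor (\<iota> j \<cdot> f) A P" using f' j by (simp add: mor_iff)
  note jf' = jf[unfolded mor_iff]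
  have ig: "arr (\<iota> (e, n) \<cdot> g)" "dom (\<iota> (e, n) \<cdot> g) = A" "cod (\<iota> (e, n) \<cdot> g) = P"
    using g' assms(1) by simp_all
  show ?case
  proof (cases "d = e")
    case False
    then have "supported (on (below e)) (\<iota> j \<cdot> f)"
      using j supported_inj[OF plus.hyps(3) _ plus.hyps(5)] by auto
    then have "supported (on (below e)) (r \<boxplus> \<iota> j \<cdot> f)" using supported_plus[OF r(1) jf r(2)] by blast
    moreover have "equiv (b \<boxplus> \<iota> j \<cdot> f) (\<iota> (e, n) \<cdot> g \<boxplus> (r \<boxplus> \<iota> j \<cdot> f))"
      using equiv_plus[OF eq equiv_refl[OF jf]] ig r' jf' by (simp add: plus_assoc)
    moreover have "mor (r \<boxplus> \<iota> j \<cdot> f) A P" using r' jf' by (simp add: mor_iff)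
    ultimately show ?thesis using g by blast
  next
    case True
    note f = f[unfolded True] and f' = f'[unfolded True]
    let ?u = "transition (B e) n l \<cdot> g" and ?v = "transition (B e) l n \<cdot> f" and ?i = "\<iota> (e, n + l)"
    obtain p where p: "mor p A P" "supported (on (below e)) p"
      "equiv (\<iota> (e, n) \<cdot> g) (?i \<cdot> ?u \<boxplus> p)" using equiv_raise[OF assms(1) g] by blast
    obtain q where q: "mor q A P" "supported (on (below e)) q"
      "equiv (\<iota> (e, l) \<cdot> f) (\<iota> (e, l + n) \<cdot> ?v \<boxplus> q)" using equiv_raise[OF assms(1) f] by blast
    note p' = p(1)[unfolded mor_iff] and q' = q(1)[unfolded mor_iff]
    have u: "arr ?u" "dom ?u = A" "cod ?u = stage (B e) (n + l)" using g' tr by simp_all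
    have v: "arr ?v" "dom ?v = A" "cod ?v = stage (B e) (n + l)" using f' tr by (simp_all add: add.commute)
    have i: "arr ?i" "dom ?i = stage (B e) (n + l)" "cod ?i = P" using assms(1) by simp_all
    have "equiv (\<iota> (e, n) \<cdot> g \<boxplus> r) ((?i \<cdot> ?u \<boxplus> p) \<boxplus> r)"
      using equiv_plus[OF p(3) equiv_refl[OF r(1)]] u i p' r' by simp
    then have "equiv b ((?i \<cdot> ?u \<boxplus> p) \<boxplus> r)" using equiv_trans[OF eq] by simp
    then have "equiv (b \<boxplus> \<iota> j \<cdot> f) (((?i \<cdot> ?u \<boxplus> p) \<boxplus> r) \<boxplus> (?i \<cdot> ?v \<boxplus> q))"
      using equiv_plus[of b _ "\<iota> j \<cdot> f" "?i \<cdot> ?v \<boxplus> q"] q(3) j True u v i p' q' r' 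
      by (simp add: add.commute)
    also have "((?i \<cdot> ?u \<boxplus> p) \<boxplus> r) \<boxplus> (?i \<cdot> ?v \<boxplus> q) = ?i \<cdot> (?u \<boxplus> ?v) \<boxplus> (p \<boxplus> (r \<boxplus> q))"
      using u v i p' q' r' by (simp add: comp_plus plus_assoc plus_left_commute)
    finally have "equiv (b \<boxplus> \<iota> j \<cdot> f) (?i \<cdot> (?u \<boxplus> ?v) \<boxplus> (p \<boxplus> (r \<boxplus> q)))" .
    moreover have "mor (?u \<boxplus> ?v) A (stage (B e) (n + l))" using u v by (simp add: mor_iff)
    moreover have rq: "mor (r \<boxplus> q) A P" using r' q' by (simp add: mor_iff)
    moreover have "mor (p \<boxplus> (r \<boxplus> q)) A P" using r' q' p' by (simp add: mor_iff)
    moreover have "supported (on (below e)) (p \<boxplus> (r \<boxplus> q))"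
      using supported_plus[OF p(1) rq p(2) supported_plus[OF r(1) q(1) r(2) q(2)]] .
    ultimately show ?thesis by blast
  qed
qed

lemma cls_equiv:
  assumes "cpt A" "mor b' A P" "equiv b b'"
  shows "cls b = cls b'"
proof -
  obtain c where c: "mor c A P" "b = \<theta> \<cdot> c \<boxplus> b'" using assms unfolding equiv_def by (auto simp: mor_iff)
  have "mor (\<theta> \<cdot> c) A P" using c \<theta>(1-3) by (simp add: mor_iff)
  then show ?thesis
    using cls_plus[OF assms(1) _ assms(2)] cls_\<theta>[OF assms(1) c(1)] c(2) cls_el[OF assms(1,2)]
      abelian_monoid.l_zero[OF abelian_group.axioms(1)[OF H_group[OF assms(1)]]] by simp
qed

text \<open>
  If \<open>b\<close> maps to zero, then the point of the leading term \<open>\<iota> (e, n) \<cdot> g\<close> is generated by earlier towers.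
  The block condition makes \<open>g\<close> vanish at a later stage, and the leading term disappears.
\<close>

lemma reduce_below:
  assumes "e \<in> E" "cpt A" "mor b A P" "supported (on (upto e)) b" "cls b = \<zero>\<^bsub>FunO H A\<^esub>"
  shows "\<exists>b'. mor b' A P \<and> supported (on (below e)) b' \<and> equiv b b'"
proof -
  interpret HA: abelian_group "FunO H A" by (rule H_group[OF assms(2)])
  note A = compact_obj[OF assms(2)] and s = stageD[OF assms(1)] and tr = transitionD[OF assms(1)]
  obtain n g r where g: "mor g A (stage (B e) n)" and r: "mor r A P" "supported (on (below e)) r"
    and eq: "equiv b (\<iota> (e, n) \<cdot> g \<boxplus> r)" using equiv_normal_form[OF assms(1-4)] by blast
  note g' = g[unfolded mor_iff] and r' = r(1)[unfolded mor_iff]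
  have ig: "mor (\<iota> (e, n) \<cdot> g) A P" using g' assms(1) by (simp add: mor_iff)
  have "mor (\<iota> (e, n) \<cdot> g \<boxplus> r) A P" using ig r' by (simp add: mor_iff)
  then have "cls (\<iota> (e, n) \<cdot> g \<boxplus> r) = \<zero>\<^bsub>FunO H A\<^esub>" using cls_equiv[OF assms(2) _ eq] assms(5) by simp
  then have z1: "act g (point (B e) n) \<oplus>\<^bsub>FunO H A\<^esub> cls r = \<zero>\<^bsub>FunO H A\<^esub>"
    using cls_plus[OF assms(2) ig r(1)] cls_inj[OF assms(2), of "(e, n)" g] g assms(1) by simp
  have z2: "cls (neg r) \<oplus>\<^bsub>FunO H A\<^esub> cls r = \<zero>\<^bsub>FunO H A\<^esub>"
    using cls_neg[OF assms(2) r(1)] cls_el[OF assms(2) r(1)] cls_el[OF assms(2), of "neg r"] r'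
    by (simp add: HA.a_comm mor_iff)
  have el: "act g (point (B e) n) \<in> el A" "cls r \<in> el A" "cls (neg r) \<in> el A"
    using g' s assms(2) cls_el[OF assms(2) r(1)] cls_el[OF assms(2), of "neg r"] r' by (auto simp: mor_iff)
  have "act g (point (B e) n) = cls (neg r)"
    using HA.minus_equality[OF z1 el(2,1)] HA.minus_equality[OF z2 el(2,3)] by simp
  moreover have "cls (neg r) \<in> gen (\<Union>d \<in> below e. points (B d)) A"
    using cls_gen[OF assms(2), of "neg r" "on (below e)"] supported_neg[OF r] r' below_E
    unfolding points_on by (auto simp: mor_iff)
  ultimately have "act g (point (B e) n) \<in> gen (\<Union>d \<in> below e. points (B d)) A" by simp
  then obtain m where m: "transition (B e) n m \<cdot> g = zer A (stage (B e) (n + m))"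
    using blockD[OF block_below[OF assms(1)] assms(2) g] by blast
  obtain q where q: "mor q A P" "supported (on (below e)) q"
      "equiv (\<iota> (e, n) \<cdot> g) (\<iota> (e, n + m) \<cdot> (transition (B e) n m \<cdot> g) \<boxplus> q)"
    using equiv_raise[OF assms(1) g] by blast
  note q' = q(1)[unfolded mor_iff]
  have "equiv (\<iota> (e, n) \<cdot> g) q" using q(3) q' unfolding m using A assms(1) by simp
  then have "equiv (\<iota> (e, n) \<cdot> g \<boxplus> r) (q \<boxplus> r)"
    using equiv_plus[OF _ equiv_refl[OF r(1)]] q' r' by simp
  then have "equiv b (q \<boxplus> r)" using equiv_trans[OF eq] by blast
  moreover have "mor (q \<boxplus> r) A P" using q' r' by (simp add: mor_iff)
  ultimately show ?thesis using supported_plus[OF q(1) r(1) q(2) r(2)] by blast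
qed

lemma supported_below_cases:
  assumes "cpt A" "mor b A P" "supported (on (below e)) b"
  shows "b = zer A P \<or> (\<exists>d \<in> below e. supported (on (upto d)) b)"
proof -
  have "on (below e) = (\<Union>d \<in> below e. on (upto d))" using below_eq by blast
  moreover have "on (upto d) \<subseteq> on (upto d') \<or> on (upto d') \<subseteq> on (upto d)"
    if "d \<in> below e" "d' \<in> below e" for d d'
    using upto_chain[of d d'] below_E(1)[of e] that by blast
  ultimately show ?thesis
    using supported_chain[OF assms(1,2), where I = "below e" and S = "\<lambda>d. on (upto d)"] assms(3) by simp
qed

lemma supported_cases:
  assumes "cpt A" "mor b A P"
  shows "b = zer A P \<or> (\<exists>d \<in> E. supported (on (upto d)) b)"
proof -
  have "(\<Union>d \<in> E. on (upto d)) = E \<times> UNIV" using E_eq by blast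
  moreover have "supported (E \<times> UNIV) b" unfolding supported_def by blast
  moreover have "on (upto d) \<subseteq> on (upto d') \<or> on (upto d') \<subseteq> on (upto d)" if "d \<in> E" "d' \<in> E" for d d'
    using upto_chain[OF that] by blast
  ultimately show ?thesis
    using supported_chain[OF assms, where I = E and S = "\<lambda>d. on (upto d)"] by simp
qed

text \<open>
  Removing leading towers lowers the position in the well-order, so it ends after finitely many
  steps.
\<close>

theorem \<theta>_exact:
  assumes "cpt A" "mor b A P" "cls b = \<zero>\<^bsub>FunO H A\<^esub>"
  obtains c where "mor c A P" "b = \<theta> \<cdot> c"
proof -
  note A = compact_obj[OF assms(1)]
  have zero: "\<exists>c. mor c A P \<and> zer A P = \<theta> \<cdot> c"
    using A \<theta>(1-3) by (intro exI[of _ "zer A P"]) (simp add: mor_iff)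
  have "e \<in> E \<Longrightarrow> mor b A P \<Longrightarrow> supported (on (upto e)) b \<Longrightarrow> cls b = \<zero>\<^bsub>FunO H A\<^esub> \<Longrightarrow>
      \<exists>c. mor c A P \<and> b = \<theta> \<cdot> c" for e b
    using wf_R
  proof (induction e arbitrary: b rule: wf_induct_rule)
    case (less e)
    obtain b' where b': "mor b' A P" "supported (on (below e)) b'" "equiv b b'"
      using reduce_below[OF less.prems(1) assms(1) less.prems(2-4)] by blast
    have z: "cls b' = \<zero>\<^bsub>FunO H A\<^esub>" using cls_equiv[OF assms(1) b'(1,3)] less.prems(4) by simp
    have "\<exists>c. mor c A P \<and> b' = \<theta> \<cdot> c"
      using supported_below_cases[OF assms(1) b'(1,2)]
    proof
      assume "b' = zer A P"
      then show ?thesis using zero by blast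
    next
      assume "\<exists>d \<in> below e. supported (on (upto d)) b'"
      then show ?thesis using less.IH b'(1) z unfolding below_def by blast
    qed
    then obtain c' where c': "mor c' A P" "b' = \<theta> \<cdot> c'" by blast
    obtain c where c: "mor c A P" "b = \<theta> \<cdot> c \<boxplus> b'" using b' unfolding equiv_def by (auto simp: mor_iff)
    have "b = \<theta> \<cdot> (c \<boxplus> c')" using c c' \<theta>(1-3) by (simp add: mor_iff comp_plus)
    moreover have "mor (c \<boxplus> c') A P" using c c' by (simp add: mor_iff)
    ultimately show ?case by blast
  qed
  then show ?thesis using supported_cases[OF assms(1,2)] assms(2,3) zero that by blast
qed

text \<open>
  On its leading tower, \<open>\<theta>\<close> is the map \<open>1 - shift\<close> of the telescope of that tower, because corrections lie in
  earlier towers.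
\<close>

lemma proj_\<theta>:
  assumes "e \<in> E" "cpt A" "mor c A P" "supported (on (upto e)) c"
  shows "proj (e, n) \<cdot> (\<theta> \<cdot> c) = proj (e, n) \<cdot> c \<boxplus>
    neg (case n of 0 \<Rightarrow> zer A (stage (B e) n) | Suc l \<Rightarrow> step (B e) l \<cdot> (proj (e, l) \<cdot> c))"
  using assms(2-4)
proof (induction rule: supported_induct)
  case zero
  show ?case using compact_obj[OF assms(2)] assms(1) \<theta>(1-3) stageD[OF assms(1)] by (simp split: nat.split)
next
  case (plus b j f)
  note A = compact_obj[OF assms(2)] and s = stageD[OF assms(1)]
  obtain d l where j: "j = (d, l)" "d \<in> E" "d = e \<or> d \<in> below e"
    using plus.hyps(3,4) unfolding upto_def by (cases j) auto
  have f: "mor f A (stage (B d) l)" using plus.hyps(5) j by simp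
  note f' = f[unfolded mor_iff] and b' = plus.hyps(1)[unfolded mor_iff]
    and t = tail[OF j(2)] and c = correction[OF j(2)] and sd = stageD[OF j(2)]
  have pe: "arr (proj (e, i))" "dom (proj (e, i)) = P" "cod (proj (e, i)) = stage (B e) i" for i
    using proj[of "(e, i)"] assms(1) by simp_all
  have jE: "(d, l) \<in> E \<times> UNIV" "(e, i) \<in> E \<times> UNIV" for i using j assms(1) by auto
  have "e \<notin> below d" using j(3) not_below_self below_mono[of d e] unfolding upto_def by auto
  then have pc: "proj (e, n) \<cdot> correction d l = zer (stage (B d) l) (stage (B e) n)"
    using c(2,4)[of l] jE(2) unfolding supported_def by auto
  have pt: "proj (e, n) \<cdot> tail d l = (if d = e \<and> n = Suc l then step (B e) l else zer (stage (B d) l) (stage (B e) n))"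
    unfolding tail_def using pe[of n] c(1-3)[of l] sd s pc assms(1) j(2) by (auto simp: comp_plus)
  have pi: "proj (e, i) \<cdot> (\<iota> (d, l) \<cdot> f) = (if d = e \<and> i = l then f else zer A (stage (B e) i))" for i
    using f' assms(1) j(2) by auto
  have "\<theta> \<cdot> (\<iota> (d, l) \<cdot> f) = \<iota> (d, l) \<cdot> f \<boxplus> neg (tail d l \<cdot> f)"
    using \<theta>(1-3) f' j(2) t \<theta>(4)[OF j(2)] by (simp add: comp_plus comp_neg flip: assoc)
  then have "proj (e, n) \<cdot> (\<theta> \<cdot> (\<iota> (d, l) \<cdot> f)) = proj (e, n) \<cdot> (\<iota> (d, l) \<cdot> f) \<boxplus> neg ((proj (e, n) \<cdot> tail d l) \<cdot> f)"
    using pe[of n] f' j(2) t by (simp add: comp_plus comp_neg assoc)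
  also have "\<dots> = proj (e, n) \<cdot> (\<iota> (d, l) \<cdot> f) \<boxplus>
    neg (case n of 0 \<Rightarrow> zer A (stage (B e) n) | Suc i \<Rightarrow> step (B e) i \<cdot> (proj (e, i) \<cdot> (\<iota> (d, l) \<cdot> f)))"
    unfolding pt pi using f' A s by (auto split: nat.split)
  finally have single: "proj (e, n) \<cdot> (\<theta> \<cdot> (\<iota> (d, l) \<cdot> f)) = proj (e, n) \<cdot> (\<iota> (d, l) \<cdot> f) \<boxplus>
    neg (case n of 0 \<Rightarrow> zer A (stage (B e) n) | Suc i \<Rightarrow> step (B e) i \<cdot> (proj (e, i) \<cdot> (\<iota> (d, l) \<cdot> f)))" .
  define ca where "ca w = (case n of 0 \<Rightarrow> zer A (stage (B e) n) | Suc i \<Rightarrow> step (B e) i \<cdot> (proj (e, i) \<cdot> w))" for w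
  have ca: "arr (ca w)" "dom (ca w) = A" "cod (ca w) = stage (B e) n" if "arr w" "dom w = A" "cod w = P" for w
    using that pe s A unfolding ca_def by (auto split: nat.split)
  have if': "arr (\<iota> (d, l) \<cdot> f)" "dom (\<iota> (d, l) \<cdot> f) = A" "cod (\<iota> (d, l) \<cdot> f) = P"
    using f' j(2) by simp_all
  have ca_plus: "ca (b \<boxplus> \<iota> (d, l) \<cdot> f) = ca b \<boxplus> ca (\<iota> (d, l) \<cdot> f)"
    unfolding ca_def using pe s A b' if' by (auto simp: comp_plus split: nat.split)
  have "proj (e, n) \<cdot> (\<theta> \<cdot> (b \<boxplus> \<iota> (d, l) \<cdot> f)) = proj (e, n) \<cdot> (\<theta> \<cdot> b) \<boxplus> proj (e, n) \<cdot> (\<theta> \<cdot> (\<iota> (d, l) \<cdot> f))"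
    using pe[of n] b' if' \<theta>(1-3) by (simp add: comp_plus)
  also have "\<dots> = (proj (e, n) \<cdot> b \<boxplus> neg (ca b)) \<boxplus> (proj (e, n) \<cdot> (\<iota> (d, l) \<cdot> f) \<boxplus> neg (ca (\<iota> (d, l) \<cdot> f)))"
    using plus.IH single unfolding ca_def by simp
  also have "\<dots> = proj (e, n) \<cdot> (b \<boxplus> \<iota> (d, l) \<cdot> f) \<boxplus> neg (ca (b \<boxplus> \<iota> (d, l) \<cdot> f))"
    unfolding ca_plus using pe[of n] b' if' ca[of b] ca[of "\<iota> (d, l) \<cdot> f"]
    by (simp add: comp_plus neg_plus plus_assoc plus_left_commute del: proj_inj_comp)
  finally show ?case unfolding ca_def j(1) .
qed

text \<open>
  The map \<open>1 - shift\<close> is injective: component \<open>0\<close> vanishes, hence so do all others in turn.  So the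
  leading tower does not occur in \<open>c\<close>.
\<close>

theorem \<theta>_mono:
  assumes "cpt A" "mor c A P" "\<theta> \<cdot> c = zer A P"
  shows "c = zer A P"
proof -
  note A = compact_obj[OF assms(1)]
  have "e \<in> E \<Longrightarrow> supported (on (upto e)) c \<Longrightarrow> c = zer A P" for e
    using wf_R
  proof (induction e rule: wf_induct_rule)
    case (less e)
    note c = assms(2)[unfolded mor_iff] and s = stageD[OF less.prems(1)]
    have pe: "arr (proj (e, i))" "dom (proj (e, i)) = P" "cod (proj (e, i)) = stage (B e) i" for i
      using proj[of "(e, i)"] less.prems(1) by simp_all
    have "proj (e, n) \<cdot> c = zer A (stage (B e) n)" for n
    proof (induction n)
      case 0
      show ?case using proj_\<theta>[OF less.prems(1) assms(1,2) less.prems(2), of 0] assms(3) c pe[of 0] A s by simp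
    next
      case (Suc n)
      then show ?case
        using proj_\<theta>[OF less.prems(1) assms(1,2) less.prems(2), of "Suc n"] assms(3) c pe[of "Suc n"] A s by simp
    qed
    then have "supported (on (below e)) c"
      using less.prems(2) c unfolding supported_def upto_def by auto
    then show ?case using supported_below_cases[OF assms(1,2)] less.IH below_E unfolding below_def by blast
  qed
  then show ?thesis using supported_cases[OF assms(1,2)] by blast
qed

theorem cls_surj:
  assumes "cpt A" "y \<in> el A"
  obtains b where "mor b A P" "cls b = y"
  using gen_cls[OF assms(1), of y "E \<times> UNIV"] generates[OF assms] that unfolding points_on by blast

end

section \<open>Transfinite exhaustion by towers\<close>

context includes cardinal_syntax
begin

lemma countable_small: "set_universe (U :: 'u itself) \<Longrightarrow> countable A \<Longrightarrow> small U A"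
proof -
  assume "set_universe U" "countable A"
  then have "\<not> |UNIV :: 'u set| \<le>o |UNIV :: nat set|" "|A| \<le>o |UNIV :: nat set|"
    unfolding set_universe_def countable_def by (auto simp flip: card_of_ordLeq)
  then have "|UNIV :: nat set| <o |UNIV :: 'u set|"
    by (simp add: not_ordLeq_iff_ordLess[OF card_of_Well_order card_of_Well_order])
  with \<open>|A| \<le>o |UNIV :: nat set|\<close> show "small U A" unfolding small_def by (rule ordLeq_ordLess_trans)
qed

lemma small_image: "small U A \<Longrightarrow> small U (f ` A)"
  unfolding small_def by (rule ordLeq_ordLess_trans[OF card_of_image])

lemma small_UN:
  assumes "set_universe (U :: 'u itself)" "small U I" "\<And>i. i \<in> I \<Longrightarrow> small U (A i)"
  shows "small U (\<Union>i \<in> I. A i)"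
proof -
  have "infinite (UNIV :: 'u set)" using assms(1) unfolding set_universe_def using countable_finite by blast
  then have "Cinfinite |UNIV :: 'u set|" unfolding cinfinite_def by (simp add: Field_card_of card_of_card_order_on)
  moreover have "regularCard |UNIV :: 'u set|" using assms(1) unfolding set_universe_def by blast
  ultimately show ?thesis using assms(2,3) unfolding small_def
    by (intro card_of_UNION_ordLess_infinite_Field_regularCard) auto
qed

end

lemma strict_well_order_exists:
  obtains R :: "('a \<times> 'a) set" where "wf R" "trans R" "\<forall>a b. a \<noteq> b \<longrightarrow> (a, b) \<in> R \<or> (b, a) \<in> R"
proof -
  obtain r :: "('a \<times> 'a) set" where r: "well_order_on UNIV r" using well_order_on by blast
  then have lin: "antisym r" "trans r" "total r"
    unfolding well_order_on_def linear_order_on_def partial_order_on_def preorder_on_def by auto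
  then have "trans (r - Id)" by (simp add: trans_diff_Id)
  moreover have "(a, b) \<in> r - Id \<or> (b, a) \<in> r - Id" if "a \<noteq> b" for a b
    using lin(3) that unfolding total_on_def by auto
  ultimately show ?thesis using that[of "r - Id"] r unfolding well_order_on_def by blast
qed

context cohomological_functor
begin

text \<open>
  The subfunctor generated below \<open>e\<close> is the union of the chain of those generated up to some \<open>d\<close> below
  \<open>e\<close>.  Each of these is exact as it arises from an exact one by adding a block.
\<close>

lemma exact_below:
  assumes "wf R" "trans R" "\<And>c d. c \<in> E \<Longrightarrow> d \<in> E \<Longrightarrow> c \<noteq> d \<Longrightarrow> (c, d) \<in> R \<or> (d, c) \<in> R"
    and "\<And>d. d \<in> E \<Longrightarrow> (d, e) \<in> R \<Longrightarrow> block (\<Union>c \<in> {c \<in> E. (c, d) \<in> R}. points (B c)) (B d)"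
  shows "exact (\<Union>d \<in> {d \<in> E. (d, e) \<in> R}. points (B d))"
  using assms(1,4)
proof (induction e rule: wf_induct_rule)
  case (less e)
  let ?S = "\<lambda>e. \<Union>d \<in> {d \<in> E. (d, e) \<in> R}. points (B d)"
  have mono: "?S c \<union> points (B c) \<subseteq> ?S d" if "c \<in> E" "(c, d) \<in> R" for c d
    using that assms(2) by (auto dest: transD)
  have "exact (?S d \<union> points (B d))" if d: "d \<in> E" "(d, e) \<in> R" for d
  proof (rule exact_block)
    show "block (?S d) (B d)" using less.prems d by blast
    show "exact (?S d)" using d(2)
    proof (rule less.IH)
      fix c assume "c \<in> E" "(c, d) \<in> R"
      then show "block (?S c) (B c)" using less.prems transD[OF assms(2) _ d(2)] by blast
    qed
  qed
  then have "exact (\<Union>d \<in> {d \<in> E. (d, e) \<in> R}. ?S d \<union> points (B d))"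
  proof (intro exact_chain)
    fix c d assume "c \<in> {d \<in> E. (d, e) \<in> R}" "d \<in> {d \<in> E. (d, e) \<in> R}"
    then show "?S c \<union> points (B c) \<subseteq> ?S d \<union> points (B d) \<or> ?S d \<union> points (B d) \<subseteq> ?S c \<union> points (B c)"
      using assms(3)[of c d] mono[of c d] mono[of d c] by blast
  qed simp
  moreover have "(\<Union>d \<in> {d \<in> E. (d, e) \<in> R}. ?S d \<union> points (B d)) = ?S e"
    using mono by blast
  ultimately show ?case by simp
qed

end

context countable_cohomological_functor
begin

lemma countable_skeleton: "countable K"
proof (rule countable_image_inj_on)
  have id: "Ident T A \<in> arrows T A A" "A \<in> Obj T" if "A \<in> K" for A
    using that compact_obj[OF skeleton_compact] ident_arrow by blast+
  then have "Ident T ` K \<subseteq> (\<Union>A \<in> K. \<Union>B \<in> K. arrows T A B)" by blast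
  then show "countable (Ident T ` K)" using countable_arrows countable_subset by blast
  show "inj_on (Ident T) K" using id hom_disjoint by (metis inj_onI)
qed

text \<open>
  All elements of \<open>H\<close> over the skeleton are well-ordered, and the tower at \<open>e\<close> starts at the element \<open>e\<close>
  itself, so that the family exhausts \<open>H\<close>.  There is a small number of elements because the skeleton is
  countable and the universe is regular.
\<close>

theorem block_family_exists:
  assumes "set_universe U" "has_small_coproducts U T"
  obtains E :: "('o \<times> 'u) set" and R B P \<iota> where "block_family k T U H E R B P \<iota>"
proof -
  define E where "E = {(A, x). A \<in> K \<and> x \<in> el A}"
  obtain R :: "(('o \<times> 'u) \<times> ('o \<times> 'u)) set" where
    R: "wf R" "trans R" "\<forall>d e. d \<noteq> e \<longrightarrow> (d, e) \<in> R \<or> (e, d) \<in> R" by (rule strict_well_order_exists)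
  let ?S = "\<lambda>B e. \<Union>d \<in> {d \<in> E. (d, e) \<in> R}. points (B d)"
  let ?Q = "\<lambda>B e b. e \<in> E \<longrightarrow> block (?S B e) b \<and> stage b 0 = fst e \<and> point b 0 = snd e"
  have "\<exists>B. \<forall>e. ?Q B e (B e)" using R(1)
  proof (rule dependent_wf_choice)
    fix f g :: "'o \<times> 'u \<Rightarrow> ('o, 'u, 'm) tower" and e b
    assume "\<And>d. (d, e) \<in> R \<Longrightarrow> f d = g d"
    then have "?S f e = ?S g e" by auto
    then show "?Q f e b = ?Q g e b" by simp
  next
    fix e and f :: "'o \<times> 'u \<Rightarrow> ('o, 'u, 'm) tower"
    assume f: "\<And>d. (d, e) \<in> R \<Longrightarrow> ?Q f d (f d)"
    show "\<exists>b. ?Q f e b"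
    proof (cases "e \<in> E")
      case True
      then obtain A x where e: "e = (A, x)" "A \<in> K" "x \<in> el A" unfolding E_def by blast
      have "exact (?S f e)" using R f by (intro exact_below) auto
      then show ?thesis using e(2,3) by (rule block_exists) (use e(1) in auto)
    qed simp
  qed
  then obtain B where B: "\<And>e. e \<in> E \<Longrightarrow> block (?S B e) (B e)"
    "\<And>e. e \<in> E \<Longrightarrow> stage (B e) 0 = fst e" "\<And>e. e \<in> E \<Longrightarrow> point (B e) 0 = snd e" by blast
  have pre: "coherent (?S B e) (B e)" if "e \<in> E" for e using B(1)[OF that] unfolding block_def by blast
  have sub: "(\<Union>e \<in> E. points (B e)) \<subseteq> elements" using points_elements[OF pre] by blast
  have gen: "y \<in> gen (\<Union>e \<in> E. points (B e)) A" if A: "cpt A" and y: "y \<in> el A" for A y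
  proof -
    obtain A' c c' where A': "A' \<in> K" "mor c A A'" "mor c' A' A" "c' \<cdot> c = Ident T A"
      using A by (rule skeleton_iso)
    note cA' = skeleton_compact[OF A'(1)]
    have y': "act c' y \<in> el A'" using A' A cA' y by (simp add: mor_iff)
    then have e: "(A', act c' y) \<in> E" using A' unfolding E_def by blast
    have "(stage (B (A', act c' y)) 0, point (B (A', act c' y)) 0) \<in> points (B (A', act c' y))"
      unfolding points_def by blast
    then have "(A', act c' y) \<in> points (B (A', act c' y))" using B(2,3)[OF e] by simp
    then have "(A', act c' y) \<in> (\<Union>e \<in> E. points (B e))" using e by blast
    then have "act c (act c' y) \<in> gen (\<Union>e \<in> E. points (B e)) A" using gen_single[OF sub A _ A'(2)] by blast
    moreover have "act c (act c' y) = act (c' \<cdot> c) y"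
      using act_comp[of c c' y] A'(2,3) A cA' y by (simp add: mor_iff)
    ultimately show ?thesis using A'(4) A y by simp
  qed
  have "small U (\<Union>A \<in> K. Pair A ` el A)"
  proof (rule small_UN[OF assms(1)])
    show "small U K" using countable_small[OF assms(1) countable_skeleton] .
    show "small U (Pair A ` el A)" if "A \<in> K" for A
    proof (rule small_image)
      have "small TYPE('u) (el A)"
        using cohomological skeleton_compact[OF that] unfolding cohomological_def compact_part_def by simp
      then show "small U (el A)" unfolding small_def .
    qed
  qed
  moreover have "(\<Union>A \<in> K. Pair A ` el A) = E" unfolding E_def by auto
  ultimately have "small U E" by simp
  then have "small U (\<Union>e \<in> E. Pair e ` (UNIV :: nat set))"
    by (rule small_UN[OF assms(1)]) (intro countable_small[OF assms(1)], simp)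
  moreover have "(\<Union>e \<in> E. Pair e ` (UNIV :: nat set)) = E \<times> UNIV" by auto
  ultimately have small: "small U (E \<times> (UNIV :: nat set))" by simp
  obtain P \<iota> where "is_coproduct T (E \<times> (UNIV :: nat set)) (\<lambda>j. stage (B (fst j)) (snd j)) P \<iota>"
  proof (rule small_coproduct_exists[OF assms(2) small])
    show "stage (B (fst j)) (snd j) \<in> Obj T" if "j \<in> E \<times> UNIV" for j
      using coherentD(7)[OF pre] that by auto
  qed
  then have "block_family k T U H E R B P \<iota>"
    using R B(1) gen small by unfold_locales auto
  then show ?thesis by (rule that)
qed

end


section \<open>The cone of the resolution\<close>

context block_family
begin

text \<open>
  For a triangle \<open>P \<rightarrow> P \<rightarrow> Q \<rightarrow> \<Sigma>P\<close> on \<open>\<theta>\<close>, an arrow from a compact object to \<open>Q\<close> lifts along \<open>g\<close> to \<open>P\<close>,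
  uniquely up to the image of \<open>\<theta>\<close>, on which \<open>cls\<close> vanishes.  So the choice of the lift \<open>b\<close> is
  immaterial.
\<close>

definition realize :: "'m \<Rightarrow> 'o \<Rightarrow> 'm \<Rightarrow> 'u" where
  "realize g A a = cls (SOME b. mor b A P \<and> g \<cdot> b = a)"

context
  fixes Q g h
  assumes cone: "Dist T P P Q \<theta> g h"
begin

lemma cone_arr: "arr g" "dom g = P" "cod g = Q" "arr h" "dom h = Q" "cod h = \<Sigma>\<^sub>o P" "Q \<in> Obj T"
  using dist_mor[OF cone] by (simp_all add: mor_iff)

text \<open>
  The composite \<open>h \<cdot> a : A \<rightarrow> \<Sigma>P\<close> is annihilated by \<open>\<Sigma>\<theta>\<close>.  As \<open>A\<close> is the suspension of a compact object,
  on which \<open>\<theta>\<close> is injective, \<open>h \<cdot> a = 0\<close>.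
\<close>

lemma cone_lift:
  assumes "cpt A" "mor a A Q"
  obtains b where "mor b A P" "g \<cdot> b = a"
proof -
  note A = compact_obj[OF assms(1)] and a = assms(2)[unfolded mor_iff]
  obtain W c c' where W: "cpt W" and c: "mor c A (\<Sigma>\<^sub>o W)" "mor c' (\<Sigma>\<^sub>o W) A" "c' \<cdot> c = Ident T A"
    using assms(1) by (rule compact_desuspension)
  note c' = c(1,2)[unfolded mor_iff] and W' = compact_obj[OF W]
  obtain Go Gm \<eta> \<epsilon> where "autoequivalence k T \<Sigma>\<^sub>o \<Sigma>\<^sub>m Go Gm \<eta> \<epsilon>" by (rule shift_autoequivalence)
  then interpret S: autoequivalence k T \<Sigma>\<^sub>o \<Sigma>\<^sub>m Go Gm \<eta> \<epsilon> .
  have "mor (h \<cdot> (a \<cdot> c')) (\<Sigma>\<^sub>o W) (\<Sigma>\<^sub>o P)" using cone_arr a c' by (simp add: mor_iff)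
  then obtain w where w: "mor w W P" "\<Sigma>\<^sub>m w = h \<cdot> (a \<cdot> c')" using S.full[OF W' obj(1)] by blast
  note w' = w(1)[unfolded mor_iff]
  have "neg (\<Sigma>\<^sub>m \<theta>) \<cdot> h = zer Q (\<Sigma>\<^sub>o P)" using dist_comp_zero[OF rotate[OF rotate[OF cone]]] .
  then have "neg (neg (\<Sigma>\<^sub>m \<theta> \<cdot> h)) = neg (zer Q (\<Sigma>\<^sub>o P))" using \<theta>(1-3) cone_arr by (simp add: comp_neg)
  then have "\<Sigma>\<^sub>m \<theta> \<cdot> h = zer Q (\<Sigma>\<^sub>o P)" using \<theta>(1-3) cone_arr by simp
  then have "(\<Sigma>\<^sub>m \<theta> \<cdot> h) \<cdot> (a \<cdot> c') = zer (\<Sigma>\<^sub>o W) (\<Sigma>\<^sub>o P)" using a c' W' by simp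
  then have "\<Sigma>\<^sub>m (\<theta> \<cdot> w) = \<Sigma>\<^sub>m (zer W P)"
    using \<theta>(1-3) cone_arr a c' w w' W' by (simp add: shift.functor_comp assoc)
  then have "\<theta> \<cdot> w = zer W P" using S.faithful[of "\<theta> \<cdot> w" "zer W P"] \<theta>(1-3) w' W' by simp
  then have "w = zer W P" using \<theta>_mono[OF W w(1)] by blast
  then have z: "h \<cdot> (a \<cdot> c') = zer (\<Sigma>\<^sub>o W) (\<Sigma>\<^sub>o P)" using w(2) W' by simp
  have "h \<cdot> a = (h \<cdot> (a \<cdot> c')) \<cdot> c" using cone_arr a c' c(3) by (simp add: assoc)
  then have "h \<cdot> a = zer A (\<Sigma>\<^sub>o P)" unfolding z using c' by simp
  then show ?thesis using weak_kernel[OF rotate[OF cone] assms(2)] that by blast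
qed

lemma cone_eq_iff:
  assumes "cpt A" "mor b A P" "mor b' A P"
  shows "g \<cdot> b = g \<cdot> b' \<longleftrightarrow> cls b = cls b'"
proof -
  interpret HA: abelian_group "FunO H A" by (rule H_group[OF assms(1)])
  note b = assms(2,3)[unfolded mor_iff]
  have d: "mor (b \<boxplus> neg b') A P" using b by (simp add: mor_iff)
  have *: "mor (neg b') A P" using b by (simp add: mor_iff)
  have "g \<cdot> b = g \<cdot> b' \<longleftrightarrow> g \<cdot> (b \<boxplus> neg b') = zer A Q"
  proof
    assume "g \<cdot> b = g \<cdot> b'"
    then show "g \<cdot> (b \<boxplus> neg b') = zer A Q" using b cone_arr by (simp add: comp_plus comp_neg)
  next
    assume "g \<cdot> (b \<boxplus> neg b') = zer A Q"
    then show "g \<cdot> b = g \<cdot> b'"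
      using b cone_arr minus_eq_zero[of "g \<cdot> b" "g \<cdot> b'"] by (simp add: comp_plus comp_neg)
  qed
  also have "\<dots> \<longleftrightarrow> cls (b \<boxplus> neg b') = \<zero>\<^bsub>FunO H A\<^esub>"
  proof
    assume "g \<cdot> (b \<boxplus> neg b') = zer A Q"
    then obtain c where c: "mor c A P" "\<theta> \<cdot> c = b \<boxplus> neg b'" using weak_kernel[OF cone d] by blast
    show "cls (b \<boxplus> neg b') = \<zero>\<^bsub>FunO H A\<^esub>" using cls_\<theta>[OF assms(1) c(1)] unfolding c(2) .
  next
    assume "cls (b \<boxplus> neg b') = \<zero>\<^bsub>FunO H A\<^esub>"
    then obtain c where c: "mor c A P" "b \<boxplus> neg b' = \<theta> \<cdot> c" using \<theta>_exact[OF assms(1) d] by blast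
    have "g \<cdot> (\<theta> \<cdot> c) = (g \<cdot> \<theta>) \<cdot> c" using c(1) \<theta>(1-3) cone_arr by (simp add: assoc mor_iff)
    also have "\<dots> = zer A Q" using c(1) dist_comp_zero[OF cone] cone_arr by (simp add: mor_iff)
    finally show "g \<cdot> (b \<boxplus> neg b') = zer A Q" using c(2) by simp
  qed
  also have "\<dots> \<longleftrightarrow> cls b = cls b'"
  proof -
    have n: "cls b' \<oplus>\<^bsub>FunO H A\<^esub> cls (neg b') = \<zero>\<^bsub>FunO H A\<^esub>" by (rule cls_neg[OF assms(1,3)])
    have el: "cls b \<in> el A" "cls b' \<in> el A" "cls (neg b') \<in> el A"
      using cls_el[OF assms(1)] assms(2,3) * by auto
    have "cls b \<oplus>\<^bsub>FunO H A\<^esub> cls (neg b') = \<zero>\<^bsub>FunO H A\<^esub> \<Longrightarrow> cls b = cls b'"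
      using HA.minus_equality[OF _ el(3,1)] HA.minus_equality[OF n el(3,2)] by simp
    then show ?thesis using n cls_plus[OF assms(1,2) *] by auto
  qed
  finally show ?thesis .
qed

lemma realize:
  assumes "cpt A" "mor b A P"
  shows "realize g A (g \<cdot> b) = cls b"
proof -
  have "\<exists>b'. mor b' A P \<and> g \<cdot> b' = g \<cdot> b" using assms(2) by blast
  then have "mor (SOME b'. mor b' A P \<and> g \<cdot> b' = g \<cdot> b) A P \<and> g \<cdot> (SOME b'. mor b' A P \<and> g \<cdot> b' = g \<cdot> b) = g \<cdot> b"
    by (rule someI_ex)
  then show ?thesis unfolding realize_def using cone_eq_iff[OF assms(1) _ assms(2)] by blast
qed

text \<open>
  Exactness of the resolution \<open>T(-, P) \<rightarrow> T(-, P) \<rightarrow> H \<rightarrow> 0\<close> makes \<open>T(-, Q)\<close> and \<open>H\<close> two cokernels of \<open>\<theta>\<close>.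
  Compatibility with scalars reduces to naturality, since scalars act by composition with multiples of the
  identity.
\<close>

theorem realize_functor_iso: "functor_iso k (compact_part U T) (hom_functor T Q) H (realize g)"
proof -
  have lift: "\<exists>b. mor b A P \<and> a = g \<cdot> b" if "cpt A" "a \<in> arrows T A Q" for A a
    using cone_lift[OF that(1), of a] that compact_obj[OF that(1)] cone_arr(7) unfolding mor_def by metis
  have in_arrows: "g \<cdot> b \<in> arrows T A Q" if "mor b A P" for A b
    using that cone_arr mor_obj[OF that] by (simp add: arrow_iff mor_iff)
  have nat: "realize g A (a \<cdot> f) = act f (realize g B a)"
    if A: "cpt A" and B: "cpt B" and f: "f \<in> arrows T A B" and a: "a \<in> arrows T B Q" for A B f a
  proof -
    have f': "mor f A B" using f A B compact_obj unfolding mor_def by blast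
    obtain b where b: "mor b B P" "a = g \<cdot> b" using lift[OF B a] by blast
    have "a \<cdot> f = g \<cdot> (b \<cdot> f)" using b f' cone_arr by (simp add: mor_iff assoc)
    moreover have "mor (b \<cdot> f) A P" using b f' by (simp add: mor_iff)
    ultimately show ?thesis using realize A B b cls_comp[OF B A b(1) f'] by simp
  qed
  have add: "realize g A (a \<oplus>\<^bsub>Hom T A Q\<^esub> a') = realize g A a \<oplus>\<^bsub>FunO H A\<^esub> realize g A a'"
    if A: "cpt A" and a: "a \<in> arrows T A Q" "a' \<in> arrows T A Q" for A a a'
  proof -
    obtain b b' where b: "mor b A P" "a = g \<cdot> b" "mor b' A P" "a' = g \<cdot> b'" using lift[OF A] a by metis
    have "a \<oplus>\<^bsub>Hom T A Q\<^esub> a' = a \<boxplus> a'" using b cone_arr by (simp add: plus_arr_def mor_iff)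
    also have "\<dots> = g \<cdot> (b \<boxplus> b')" using b cone_arr by (simp add: comp_plus mor_iff)
    finally show ?thesis using realize[OF A] b cls_plus[OF A b(1,3)] by (simp add: mor_iff)
  qed
  have smult: "realize g A (s \<odot>\<^bsub>Hom T A Q\<^esub> a) = s \<odot>\<^bsub>FunO H A\<^esub> realize g A a"
    if A: "cpt A" and s: "s \<in> carrier k" and a: "a \<in> arrows T A Q" for A s a
  proof -
    note A' = compact_obj[OF A]
    interpret AA: module k "Hom T A A" by (rule hom_module[OF A' A'])
    have "a \<cdot> (s \<odot>\<^bsub>Hom T A A\<^esub> Ident T A) = s \<odot>\<^bsub>Hom T A Q\<^esub> a"
      using comp_smult_right[OF A' A' cone_arr(7) s ident_arrow[OF A'] a] comp_ident_right[OF A' cone_arr(7) a]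
      by simp
    moreover have "s \<odot>\<^bsub>Hom T A A\<^esub> Ident T A \<in> arrows T A A"
      using s ident_arrow[OF A'] by (rule AA.smult_closed)
    ultimately have "realize g A (s \<odot>\<^bsub>Hom T A Q\<^esub> a) = act (s \<odot>\<^bsub>Hom T A A\<^esub> Ident T A) (realize g A a)"
      using nat[OF A A _ a] by metis
    also have "\<dots> = s \<odot>\<^bsub>FunO H A\<^esub> act (Ident T A) (realize g A a)"
      using lift[OF A a] realize[OF A] cls_el[OF A] A A' by (intro act_smult_arr[OF s]) auto
    also have "\<dots> = s \<odot>\<^bsub>FunO H A\<^esub> realize g A a"
      using lift[OF A a] realize[OF A] cls_el[OF A] A by auto
    finally show ?thesis .
  qed
  have bij: "bij_betw (realize g A) (arrows T A Q) (el A)" if A: "cpt A" for A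
    unfolding bij_betw_def
  proof (intro conjI inj_onI equalityI subsetI)
    fix a a' assume a: "a \<in> arrows T A Q" "a' \<in> arrows T A Q" "realize g A a = realize g A a'"
    obtain b b' where b: "mor b A P" "a = g \<cdot> b" "mor b' A P" "a' = g \<cdot> b'" using lift[OF A] a by metis
    then show "a = a'" using a(3) realize[OF A] cone_eq_iff[OF A] by simp
  next
    fix y assume "y \<in> realize g A ` arrows T A Q"
    then obtain b where "mor b A P" "y = realize g A (g \<cdot> b)" using lift[OF A] by blast
    then show "y \<in> el A" using realize[OF A] cls_el[OF A] by simp
  next
    fix y assume "y \<in> el A"
    then obtain b where b: "mor b A P" "cls b = y" using cls_surj[OF A] by blast
    then have "y = realize g A (g \<cdot> b)" using realize[OF A b(1)] by simp
    then show "y \<in> realize g A ` arrows T A Q" using in_arrows[OF b(1)] by (rule image_eqI)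
  qed
  then have "realize g A \<in> arrows T A Q \<rightarrow> el A" if "cpt A" for A using that bij_betwE by fast
  then show ?thesis
    using nat add smult bij
    unfolding functor_iso_def natural_transformation_def linear_map_def hom_functor_def compact_part_def
    by simp
qed

end

end

text \<open>
  A coproduct of compact objects behaves like a projective object: arrows out of it may be chosen
  summand by summand.  So \<open>\<eta>\<close> lifts to arrows \<open>f0\<close> between the generators and \<open>f1\<close> between the relations
  of the two resolutions, and fill-in yields the arrow of cones.
\<close>

lemma realize_natural_transformation:
  fixes T :: "('k, 'o, 'm, 'z) tricat_scheme"
  assumes "block_family k T U H E R B P \<iota>" "block_family k T U H' E' R' B' P' \<iota>'"
    and nt: "natural_transformation k (compact_part U T) H H' \<eta>"
    and cone: "Dist T P P Q (block_family.\<theta> T H E R B P \<iota>) g h"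
    and cone': "Dist T P' P' Q' (block_family.\<theta> T H' E' R' B' P' \<iota>') g' h'"
  obtains f where "f \<in> arrows T Q Q'"
    "\<And>A a. \<lbrakk>compact_object U T A; a \<in> arrows T A Q\<rbrakk> \<Longrightarrow>
      \<eta> A (block_family.realize T H E B P \<iota> g A a) = block_family.realize T H' E' B' P' \<iota>' g' A (f \<cdot>\<^bsub>T\<^esub> a)"
proof -
  interpret F: block_family k T U H E R B P \<iota> by (rule assms)
  interpret F': block_family k T U H' E' R' B' P' \<iota>' by (rule assms)
  note [simp] = F.assoc
  have \<eta>_linear: "linear_map k (FunO H A) (FunO H' A) (\<eta> A)" if "F.cpt A" for A
    using nt that unfolding natural_transformation_def compact_part_def by simp
  have \<eta>_el: "\<eta> A x \<in> F'.el A" if "F.cpt A" "x \<in> F.el A" for A x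
    using \<eta>_linear[OF that(1)] that(2) unfolding linear_map_def by auto
  have \<eta>_plus: "\<eta> A (x \<oplus>\<^bsub>FunO H A\<^esub> y) = \<eta> A x \<oplus>\<^bsub>FunO H' A\<^esub> \<eta> A y"
    if "F.cpt A" "x \<in> F.el A" "y \<in> F.el A" for A x y
    using \<eta>_linear[OF that(1)] that(2,3) unfolding linear_map_def by auto
  have \<eta>_zero: "\<eta> A (\<zero>\<^bsub>FunO H A\<^esub>) = \<zero>\<^bsub>FunO H' A\<^esub>" if A: "F.cpt A" for A
  proof (rule F'.H_idem_zero[OF A])
    show "\<eta> A (\<zero>\<^bsub>FunO H A\<^esub>) \<in> F'.el A" using \<eta>_el A F.H_zero by blast
    show "\<eta> A (\<zero>\<^bsub>FunO H A\<^esub>) \<oplus>\<^bsub>FunO H' A\<^esub> \<eta> A (\<zero>\<^bsub>FunO H A\<^esub>) = \<eta> A (\<zero>\<^bsub>FunO H A\<^esub>)"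
      using \<eta>_plus[OF A F.H_zero[OF A] F.H_zero[OF A]]
        abelian_monoid.l_zero[OF abelian_group.axioms(1)[OF F.H_group[OF A]] F.H_zero[OF A]] by simp
  qed
  have \<eta>_nat: "\<eta> A (F.act f x) = F'.act f (\<eta> D x)" if "F.cpt A" "F.cpt D" "F.mor f A D" "x \<in> F.el D" for A D f x
    using nt that unfolding natural_transformation_def compact_part_def F.mor_def by simp
  let ?X = "\<lambda>j. stage (B (fst j)) (snd j)" and ?x = "\<lambda>j. point (B (fst j)) (snd j)"
  let ?J = "E \<times> (UNIV :: nat set)"
  have "\<exists>y. F.mor y (?X j) P' \<and> F'.cls y = \<eta> (?X j) (?x j)" if "j \<in> ?J" for j
  proof -
    note c = F.summand_compact[OF that]
    show ?thesis using F'.cls_surj[OF c \<eta>_el[OF c F.x_el[OF that]]] by blast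
  qed
  then have "\<exists>y. \<forall>j \<in> ?J. F.mor (y j) (?X j) P' \<and> F'.cls (y j) = \<eta> (?X j) (?x j)"
    by (intro bchoice ballI)
  then obtain y where y: "\<And>j. j \<in> ?J \<Longrightarrow> F.mor (y j) (?X j) P'"
    "\<And>j. j \<in> ?J \<Longrightarrow> F'.cls (y j) = \<eta> (?X j) (?x j)" by blast
  define f0 where "f0 = F.copair P' y"
  have f0: "F.arr f0" "F.dom f0 = P" "F.cod f0 = P'" "\<And>j. j \<in> ?J \<Longrightarrow> f0 \<cdot>\<^bsub>T\<^esub> \<iota> j = y j"
    unfolding f0_def using F.copair[OF F'.obj(1) y(1)] by auto
  have cls_f0: "F'.cls (f0 \<cdot>\<^bsub>T\<^esub> b) = \<eta> A (F.cls b)" if A: "F.cpt A" and b: "F.mor b A P" for A b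
    using F.all_fsum[OF A b]
  proof induction
    case zero
    show ?case using f0(1-3) F.compact_obj[OF A] F.cls_zero[OF A] F'.cls_zero[OF A] \<eta>_zero[OF A] by simp
  next
    case (plus b j f)
    note b = F.fsum_arr[OF plus.hyps(1) F.compact_obj[OF A]] and f = plus.hyps(3)[unfolded F.mor_iff]
      and yj = y(1)[OF plus.hyps(2), unfolded F.mor_iff]
    have m: "F.mor b A P" "F.mor (\<iota> j \<cdot>\<^bsub>T\<^esub> f) A P" "F.mor (f0 \<cdot>\<^bsub>T\<^esub> b) A P'" "F.mor (y j \<cdot>\<^bsub>T\<^esub> f) A P'"
      using b f f0(1-3) plus.hyps(2) yj by (simp_all add: F.mor_iff)
    have "f0 \<cdot>\<^bsub>T\<^esub> (\<iota> j \<cdot>\<^bsub>T\<^esub> f) = (f0 \<cdot>\<^bsub>T\<^esub> \<iota> j) \<cdot>\<^bsub>T\<^esub> f" using f0(1-3) f plus.hyps(2) by simp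
    also have "\<dots> = y j \<cdot>\<^bsub>T\<^esub> f" using f0(4)[OF plus.hyps(2)] by simp
    finally have "f0 \<cdot>\<^bsub>T\<^esub> (F.plus_arr b (\<iota> j \<cdot>\<^bsub>T\<^esub> f)) = F.plus_arr (f0 \<cdot>\<^bsub>T\<^esub> b) (y j \<cdot>\<^bsub>T\<^esub> f)"
      using f0(1-3) b f plus.hyps(2) by (simp add: F.comp_plus del: F.assoc)
    then have "F'.cls (f0 \<cdot>\<^bsub>T\<^esub> (F.plus_arr b (\<iota> j \<cdot>\<^bsub>T\<^esub> f))) =
        \<eta> A (F.cls b) \<oplus>\<^bsub>FunO H' A\<^esub> F'.act f (\<eta> (?X j) (?x j))"
      using F'.cls_plus[OF A m(3,4)] plus.IH y[OF plus.hyps(2)]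
        F'.cls_comp[OF F.summand_compact[OF plus.hyps(2)] A _ plus.hyps(3)] by simp
    also have "F'.act f (\<eta> (?X j) (?x j)) = \<eta> A (F.cls (\<iota> j \<cdot>\<^bsub>T\<^esub> f))"
      using F.cls_inj[OF A plus.hyps(2,3)] \<eta>_nat[OF A F.summand_compact plus.hyps(3) F.x_el] plus.hyps(2) by simp
    also have "\<eta> A (F.cls b) \<oplus>\<^bsub>FunO H' A\<^esub> \<dots> = \<eta> A (F.cls (F.plus_arr b (\<iota> j \<cdot>\<^bsub>T\<^esub> f)))"
      using F.cls_plus[OF A m(1,2)] \<eta>_plus[OF A F.cls_el[OF A m(1)] F.cls_el[OF A m(2)]] by simp
    finally show ?case .
  qed
  have "\<exists>z. F.mor z (?X j) P' \<and> f0 \<cdot>\<^bsub>T\<^esub> (F.\<theta> \<cdot>\<^bsub>T\<^esub> \<iota> j) = F'.\<theta> \<cdot>\<^bsub>T\<^esub> z" if j: "j \<in> ?J" for j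
  proof -
    note c = F.summand_compact[OF j]
    have i: "F.mor (\<iota> j) (?X j) P" using j by (simp add: F.mor_iff)
    have m: "F.mor (F.\<theta> \<cdot>\<^bsub>T\<^esub> \<iota> j) (?X j) P" using i F.\<theta>(1-3) by (simp add: F.mor_iff)
    have "F'.cls (f0 \<cdot>\<^bsub>T\<^esub> (F.\<theta> \<cdot>\<^bsub>T\<^esub> \<iota> j)) = \<zero>\<^bsub>FunO H' (?X j)\<^esub>"
      using cls_f0[OF c m] F.cls_\<theta>[OF c i] \<eta>_zero[OF c] by simp
    moreover have "F.mor (f0 \<cdot>\<^bsub>T\<^esub> (F.\<theta> \<cdot>\<^bsub>T\<^esub> \<iota> j)) (?X j) P'" using m f0(1-3) by (simp add: F.mor_iff)
    ultimately show ?thesis using F'.\<theta>_exact[OF c] by blast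
  qed
  then have "\<exists>z. \<forall>j \<in> ?J. F.mor (z j) (?X j) P' \<and> f0 \<cdot>\<^bsub>T\<^esub> (F.\<theta> \<cdot>\<^bsub>T\<^esub> \<iota> j) = F'.\<theta> \<cdot>\<^bsub>T\<^esub> z j"
    by (intro bchoice ballI)
  then obtain z where z: "\<And>j. j \<in> ?J \<Longrightarrow> F.mor (z j) (?X j) P'"
    "\<And>j. j \<in> ?J \<Longrightarrow> f0 \<cdot>\<^bsub>T\<^esub> (F.\<theta> \<cdot>\<^bsub>T\<^esub> \<iota> j) = F'.\<theta> \<cdot>\<^bsub>T\<^esub> z j" by blast
  define f1 where "f1 = F.copair P' z"
  have f1: "F.arr f1" "F.dom f1 = P" "F.cod f1 = P'" "\<And>j. j \<in> ?J \<Longrightarrow> f1 \<cdot>\<^bsub>T\<^esub> \<iota> j = z j"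
    unfolding f1_def using F.copair[OF F'.obj(1) z(1)] by auto
  have "f0 \<cdot>\<^bsub>T\<^esub> F.\<theta> = F'.\<theta> \<cdot>\<^bsub>T\<^esub> f1"
    by (rule F.ext) (use f0(1-3) f1 F.\<theta>(1-3) F'.\<theta>(1-3) z(2) in simp_all)
  moreover have "F.mor f0 P P'" "F.mor f1 P P'" using f0 f1 by (simp_all add: F.mor_iff)
  ultimately obtain f where f: "F.mor f Q Q'" "f \<cdot>\<^bsub>T\<^esub> g = g' \<cdot>\<^bsub>T\<^esub> f0"
    using F.dist_fill[OF cone cone'] by metis
  have "\<eta> A (F.realize g A a) = F'.realize g' A (f \<cdot>\<^bsub>T\<^esub> a)" if A: "F.cpt A" and a: "a \<in> arrows T A Q" for A a
  proof -
    have "F.mor a A Q" using a F.compact_obj[OF A] F.cone_arr(7)[OF cone] unfolding F.mor_def by blast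
    then obtain b where b: "F.mor b A P" "g \<cdot>\<^bsub>T\<^esub> b = a" using F.cone_lift[OF cone A] by blast
    note b' = b(1)[unfolded F.mor_iff] and fQ = f(1)[unfolded F.mor_iff]
    have "f \<cdot>\<^bsub>T\<^esub> a = (f \<cdot>\<^bsub>T\<^esub> g) \<cdot>\<^bsub>T\<^esub> b"
      unfolding b(2)[symmetric] using b' fQ F.cone_arr[OF cone] by simp
    also have "\<dots> = g' \<cdot>\<^bsub>T\<^esub> (f0 \<cdot>\<^bsub>T\<^esub> b)"
      unfolding f(2) using b' f0(1-3) F'.cone_arr[OF cone'] by simp
    finally have fa: "f \<cdot>\<^bsub>T\<^esub> a = g' \<cdot>\<^bsub>T\<^esub> (f0 \<cdot>\<^bsub>T\<^esub> b)" .
    have "F.mor (f0 \<cdot>\<^bsub>T\<^esub> b) A P'" using b' f0(1-3) by (simp add: F.mor_iff)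
    then have "F'.realize g' A (f \<cdot>\<^bsub>T\<^esub> a) = F'.cls (f0 \<cdot>\<^bsub>T\<^esub> b)" unfolding fa by (rule F'.realize[OF cone' A])
    also have "\<dots> = \<eta> A (F.realize g A a)"
      using cls_f0[OF A b(1)] F.realize[OF cone A b(1)] unfolding b(2) by simp
    finally show ?thesis by simp
  qed
  moreover have "f \<in> arrows T Q Q'" using f(1) unfolding F.mor_def by blast
  ultimately show ?thesis using that by blast
qed


section \<open>Representability\<close>

lemma (in block_family) cone_exists:
  obtains Q g h where "Q \<in> Obj T" "Dist T P P Q \<theta> g h"
proof -
  have "\<theta> \<in> arrows T P P" using \<theta>(1-3) by (simp add: arrow_iff)
  then obtain Q g h where "Dist T P P Q \<theta> g h" using TR1_cone[OF obj(1) obj(1)] by blast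
  then show ?thesis using that dist_mor(6) by blast
qed

lemma block_family_exists:
  fixes H :: "('k, 'o, 'm, 'u) modfun" and T :: "('k, 'o, 'm, 'z) tricat_scheme"
  assumes "set_universe TYPE('u)" "compactly_generated TYPE('u) k T"
    and "has_countable_skeleton (compact_part TYPE('u) T)"
    and "cohomological k (compact_part TYPE('u) T) H"
  obtains E :: "('o \<times> 'u) set" and R B P \<iota> where "block_family k T TYPE('u) H E R B P \<iota>"
proof -
  interpret triangulated_category k T using assms(2) unfolding compactly_generated_def by blast
  obtain K where K: "skeleton (compact_part TYPE('u) T) K" "countable (\<Union>A \<in> K. \<Union>B \<in> K. arrows T A B)"
    using assms(3) unfolding has_countable_skeleton_def compact_part_def by auto
  interpret countable_cohomological_functor k T "TYPE('u)" H K
    using assms(4) K by unfold_locales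
  have "has_small_coproducts TYPE('u) T" using assms(2) unfolding compactly_generated_def by blast
  then show ?thesis using block_family_exists[OF assms(1)] that by metis
qed

theorem corollary1p10:
  fixes k :: "'k ring"
    and T :: "('k, 'o, 'm) tricat"
  assumes "set_universe TYPE('u)"
    and "small TYPE('u) (carrier k)"
    and "compactly_generated TYPE('u) k T"
    and "has_countable_skeleton (compact_part TYPE('u) T)"
  shows "(\<forall>H :: ('k, 'o, 'm, 'u) modfun.
            cohomological k (compact_part TYPE('u) T) H \<longrightarrow>
            (\<exists>X \<in> Obj T. \<exists>\<phi>.
               functor_iso k (compact_part TYPE('u) T) (hom_functor T X) H \<phi>)) \<and>
         (\<forall>(H :: ('k, 'o, 'm, 'u) modfun) (H' :: ('k, 'o, 'm, 'u) modfun) \<eta>.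
            cohomological k (compact_part TYPE('u) T) H \<longrightarrow>
            cohomological k (compact_part TYPE('u) T) H' \<longrightarrow>
            natural_transformation k (compact_part TYPE('u) T) H H' \<eta> \<longrightarrow>
            (\<exists>X \<in> Obj T. \<exists>X' \<in> Obj T. \<exists>f \<in> arrows T X X'. \<exists>\<phi> \<phi>'.
               functor_iso k (compact_part TYPE('u) T) (hom_functor T X) H \<phi> \<and>
               functor_iso k (compact_part TYPE('u) T) (hom_functor T X') H' \<phi>' \<and>
               (\<forall>C \<in> Obj (compact_part TYPE('u) T). \<forall>g \<in> arrows T C X.
                  \<eta> C (\<phi> C g) = \<phi>' C (hom_transformation T f C g))))"
proof (intro conjI allI impI)
  fix H :: "('k, 'o, 'm, 'u) modfun"
  assume H: "cohomological k (compact_part TYPE('u) T) H"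
  obtain E :: "('o \<times> 'u) set" and R B P \<iota> where F: "block_family k T TYPE('u) H E R B P \<iota>"
    using assms(1,3,4) H by (rule block_family_exists)
  interpret F: block_family k T "TYPE('u)" H E R B P \<iota> by (rule F)
  obtain Q g h where Q: "Q \<in> Obj T" "Dist T P P Q F.\<theta> g h" by (rule F.cone_exists)
  show "\<exists>X \<in> Obj T. \<exists>\<phi>. functor_iso k (compact_part TYPE('u) T) (hom_functor T X) H \<phi>"
    using F.realize_functor_iso[OF Q(2)] Q(1) by blast
next
  fix H H' :: "('k, 'o, 'm, 'u) modfun" and \<eta>
  assume H: "cohomological k (compact_part TYPE('u) T) H"
    and H': "cohomological k (compact_part TYPE('u) T) H'"
    and nt: "natural_transformation k (compact_part TYPE('u) T) H H' \<eta>"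
  obtain E :: "('o \<times> 'u) set" and R B P \<iota> where F: "block_family k T TYPE('u) H E R B P \<iota>"
    using assms(1,3,4) H by (rule block_family_exists)
  obtain E' :: "('o \<times> 'u) set" and R' B' P' \<iota>' where F': "block_family k T TYPE('u) H' E' R' B' P' \<iota>'"
    using assms(1,3,4) H' by (rule block_family_exists)
  interpret F: block_family k T "TYPE('u)" H E R B P \<iota> by (rule F)
  interpret F': block_family k T "TYPE('u)" H' E' R' B' P' \<iota>' by (rule F')
  obtain Q g h where Q: "Q \<in> Obj T" "Dist T P P Q F.\<theta> g h" by (rule F.cone_exists)
  obtain Q' g' h' where Q': "Q' \<in> Obj T" "Dist T P' P' Q' F'.\<theta> g' h'" by (rule F'.cone_exists)
  obtain f where f: "f \<in> arrows T Q Q'"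
    "\<And>A a. \<lbrakk>compact_object TYPE('u) T A; a \<in> arrows T A Q\<rbrakk> \<Longrightarrow>
      \<eta> A (F.realize g A a) = F'.realize g' A (f \<cdot>\<^bsub>T\<^esub> a)"
    using realize_natural_transformation[OF F F' nt Q(2) Q'(2)] by blast
  have "\<forall>A \<in> Obj (compact_part TYPE('u) T). \<forall>a \<in> arrows T A Q.
      \<eta> A (F.realize g A a) = F'.realize g' A (hom_transformation T f A a)"
    using f(2) unfolding hom_transformation_def compact_part_def by simp
  then show "\<exists>X \<in> Obj T. \<exists>X' \<in> Obj T. \<exists>f \<in> arrows T X X'. \<exists>\<phi> \<phi>'.
      functor_iso k (compact_part TYPE('u) T) (hom_functor T X) H \<phi> \<and>
      functor_iso k (compact_part TYPE('u) T) (hom_functor T X') H' \<phi>' \<and>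
      (\<forall>C \<in> Obj (compact_part TYPE('u) T). \<forall>g \<in> arrows T C X.
         \<eta> C (\<phi> C g) = \<phi>' C (hom_transformation T f C g))"
    using Q(1) Q'(1) f(1) F.realize_functor_iso[OF Q(2)] F'.realize_functor_iso[OF Q'(2)] by blast
qed

end
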